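(* Suppose $d$ is sufficiently large. Under the five assumptions stated in the context ($\mathbf g$-relevant Hessian boundedness, Lipschitz Hessian, Krylov subspace regularity I and II, and the spectral assumption (5)), after at most $\mathcal O(\varepsilon_g^{-3/2})$ gradient and Hessian-vector product evaluations, the first-order Newton-MR method (Algorithm A in the context) reaches an iterate satisfying the approximate first-order optimality condition $\|\nabla f(\mathbf x_k)\|\le\varepsilon_g$.
   Context: Setting: $f:\mathbb R^d\to\mathbb R$ is twice continuously differentiable and attains its minimum; $\mathbf g(\mathbf x)=\nabla f(\mathbf x)$, $\mathbf H(\mathbf x)=\nabla^2 f(\mathbf x)$, $\mathbf g_k=\mathbf g(\mathbf x_k)$, $\mathbf H_k=\mathbf H(\mathbf x_k)$; $\|\cdot\|$ is the Euclidean/spectral norm. Exact arithmetic is assumed. Each outer iteration evaluates one gradient and each MINRES iteration costs one Hessian-vector product; function evaluations in the line-search are not counted. $\mathcal O(\cdot)$ refers to $\varepsilon_g\to0$, the hidden constant not depending on $\varepsilon_g$. "$d$ sufficiently large" means that the trivial bound of MINRES iterations by the grade $g\le d$ is not the active bound. MINRES. For a symmetric $\mathbf H$ and $\mathbf g\ne\mathbf 0$ let $\mathcal K_t(\mathbf H,\mathbf g)=\mathrm{Span}\{\mathbf g,\mathbf H\mathbf g,\dots,\mathbf H^{t-1}\mathbf g\}$; the grade $g$ of $\mathbf g$ with respect to $\mathbf H$ is the integer with $\dim\mathcal K_t=\min\{t,g\}$ for all $t\ge1$. The MINRES iterates are $\mathbf s_0=\mathbf 0$, $\mathbf s_t=\arg\min_{\mathbf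 s\in\mathcal K_t(\mathbf H,\mathbf g)}\|\mathbf H\mathbf s+\mathbf g\|^2$ (if the minimizer is not unique, which can only occur at $t=g$ with $\mathbf g\notin\mathrm{Range}(\mathbf H)$, then $\mathbf s_g=\mathbf s_{g-1}$), with residuals $\mathbf r_t=-\mathbf g-\mathbf H\mathbf s_t$. The NPC (nonpositive curvature) condition is detected at iteration $t$ if $\mathbf r_{t-1}\neq\mathbf 0$ and $\langle\mathbf r_{t-1},\mathbf H\mathbf r_{t-1}\rangle\le0$. The procedure MINRES$(\mathbf H,\mathbf g,\eta)$ does, for $t=1,2,\dots$: if the NPC condition is detected at iteration $t$, return $\mathbf d=\mathbf r_{t-1}$ with flag `NPC'; otherwise, if $\|\mathbf H\mathbf r_{t-1}\|\le\eta\|\mathbf H\mathbf s_{t-1}\|$, return $\mathbf d=\mathbf s_{t-1}$ with flag `SOL'; otherwise continue. Algorithm A (first-order Newton-MR). Inputs: $\mathbf x_0\in\mathbb R^d$, $0<\varepsilon_g\le1$, $\theta>0$, line-search parameters $0<\rho_S<1/2$ and $0<\rho_N<1$. While $\|\mathbf g_k\|>\varepsilon_g$: call MINRES$(\mathbf H_k,\mathbf g_k,\theta\sqrt{\varepsilon_g})$ to get $\mathbf d_k$ and a flag. If the flag is `SOL', let $\alpha_k$ be the largest $0<\alpha\le1$ with $f(\mathbf x_k+\alpha\mathbf d_k)\le f(\mathbf x_k)+\rho_S\,\alpha\langle\mathbf g_k,\mathbf d_k\rangle$; if the flag is `NPC', let $\alpha_k$ be the largest $\alpha>0$ with $f(\mathbf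 x_k+\alpha\mathbf d_k)\le f(\mathbf x_k)+\rho_N\,\alpha\langle\mathbf g_k,\mathbf d_k\rangle$. Set $\mathbf x_{k+1}=\mathbf x_k+\alpha_k\mathbf d_k$, $k\leftarrow k+1$. Spectral notation. An eigenvalue $\lambda$ of $\mathbf H$ is $\mathbf g$-relevant if $\mathbf g$ is not orthogonal to $\mathrm{Null}(\mathbf H-\lambda\mathbf I)$. Let $\psi_+,\psi_-,\psi_0$ be the numbers of distinct positive, negative, zero $\mathbf g$-relevant eigenvalues, $\psi=\psi_++\psi_-+\psi_0$, labelled $\lambda_1>\dots>\lambda_{\psi_+}>0>\lambda_{\psi_++\psi_0+1}>\dots>\lambda_\psi$. $\mathbf U$, $\mathbf U_{i+}$ ($1\le i\le\psi_+$), $\mathbf U_{j-}$ ($\psi_++\psi_0+1\le j\le\psi$) are matrices whose columns form orthonormal eigenvector bases of, respectively, the sum of the eigenspaces of all nonzero $\mathbf g$-relevant eigenvalues, of $\lambda_1,\dots,\lambda_i$, and of $\lambda_j,\dots,\lambda_\psi$. Assumptions. (1) There is $0\le L_g<\infty$ with $\|\mathbf U^\top\mathbf H(\mathbf x)\mathbf U\|\le L_g$ for all $\mathbf x\in\mathbb R^d$. (2) $\|\nabla^2f(\mathbf x)-\nabla^2f(\mathbf y)\|\le L_H\|\mathbf x-\mathbf y\|$ for all $\mathbf x,\mathbf y$, with $0\le L_H<\infty$. (3) Krylov subspace regularity I: there is $\sigma>0$ such that for every $\mathbf x$ and every $t\le g$, if the NPC condition has not been detected at iterations $1,\dots,t$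 of MINRES applied to $\mathbf H(\mathbf x),\mathbf g(\mathbf x)$, then $\langle\mathbf s,\mathbf H(\mathbf x)\mathbf s\rangle\ge\sigma\|\mathbf s\|^2$ for all $\mathbf s\in\mathcal K_t(\mathbf H(\mathbf x),\mathbf g(\mathbf x))$. (4) Krylov subspace regularity II: there is $\omega>0$ such that for every iterate $\mathbf x_k$ of the algorithm at which MINRES returns `NPC', $\|\mathbf d_k\|\ge\omega\|\mathbf g_k\|$. (5) There exist $\mu>0$ and $L_g^2/(L_g^2+\theta^2\varepsilon_g)\le\nu\le1$ such that for any $\mathbf x\in\mathbb R^d$ with $\mathbf g\notin\mathrm{Null}(\mathbf H)$ at least one of the following holds: (i) $\psi_+\ge1$, $\psi_-\ge1$ and there are $1\le i\le\psi_+$, $\psi_++\psi_0+1\le j\le\psi$ with $\min\{\lambda_i,|\lambda_j|\}\ge\mu$ and $\|(\mathbf U_{i+}\mathbf U_{i+}^\top+\mathbf U_{j-}\mathbf U_{j-}^\top)\mathbf g\|^2\ge\nu\|\mathbf U\mathbf U^\top\mathbf g\|^2$; (ii) $\psi_+\ge1$ and there is $1\le i\le\psi_+$ with $\lambda_i\ge\mu$ and $\|\mathbf U_{i+}\mathbf U_{i+}^\top\mathbf g\|^2\ge\nu\|\mathbf U\mathbf U^\top\mathbf g\|^2$; (iii) $\psi_-\ge1$ and there is $\psi_++\psi_0+1\le j\le\psi$ with $|\lambda_j|\ge\mu$ and $\|\mathbf U_{j-}\mathbf U_{j-}^\top\mathbf g\|^2\ge\nu\|\mathbf U\mathbf U^\top\mathbf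 g\|^2$. *)

theory Defs
  imports
    Complex_Main
    "Jordan_Normal_Form.VS_Connect"
    "Jordan_Normal_Form.Char_Poly"
    "Jordan_Normal_Form.Matrix_Kernel"
begin

text \<open>
  \<open>\<real>\<^sup>d\<close> is rendered as \<^term>\<open>carrier_vec d :: real vec set\<close>, with the dimension a term and not a type.
  This lets a constant be quantified before the dimension, and it allows matrices whose number of
  columns depends on the point, such as the eigenvector bases below.
\<close>

definition vnorm :: "real vec \<Rightarrow> real" where
  "vnorm v = sqrt (v \<bullet> v)"

definition spectral_norm :: "real mat \<Rightarrow> real" where
  "spectral_norm A = Sup {vnorm (A *\<^sub>v v) | v. v \<in> carrier_vec (dim_col A) \<and> vnorm v \<le> 1}"

abbreviation vec_span :: "nat \<Rightarrow> real vec set \<Rightarrow> real vec set" where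
  "vec_span d S \<equiv> LinearCombinations.module.span class_ring (module_vec TYPE(real) d) S"

abbreviation subspace_dim :: "nat \<Rightarrow> real vec set \<Rightarrow> nat" where
  "subspace_dim d W \<equiv> vectorspace.dim class_ring (module_vec TYPE(real) d \<lparr>carrier := W\<rparr>)"

text \<open>The type of vectors of arbitrary length carries no topology, so the Frechet derivatives
  are written out.\<close>

definition has_gradient :: "nat \<Rightarrow> (real vec \<Rightarrow> real) \<Rightarrow> real vec \<Rightarrow> real vec \<Rightarrow> bool" where
  "has_gradient d f v x \<longleftrightarrow> v \<in> carrier_vec d \<and>
     (\<forall>e>0. \<exists>\<delta>>0. \<forall>h\<in>carrier_vec d. vnorm h < \<delta> \<longrightarrow>
        \<bar>f (x + h) - f x - v \<bullet> h\<bar> \<le> e * vnorm h)"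

definition has_jacobian :: "nat \<Rightarrow> (real vec \<Rightarrow> real vec) \<Rightarrow> real mat \<Rightarrow> real vec \<Rightarrow> bool" where
  "has_jacobian d G A x \<longleftrightarrow> A \<in> carrier_mat d d \<and>
     (\<forall>e>0. \<exists>\<delta>>0. \<forall>h\<in>carrier_vec d. vnorm h < \<delta> \<longrightarrow>
        vnorm (G (x + h) - G x - A *\<^sub>v h) \<le> e * vnorm h)"

definition twice_continuously_differentiable ::
  "nat \<Rightarrow> (real vec \<Rightarrow> real) \<Rightarrow> (real vec \<Rightarrow> real vec) \<Rightarrow> (real vec \<Rightarrow> real mat) \<Rightarrow> bool" where
  "twice_continuously_differentiable d f g H \<longleftrightarrow>
     (\<forall>x\<in>carrier_vec d. has_gradient d f (g x) x) \<and>
     (\<forall>x\<in>carrier_vec d. has_jacobian d g (H x) x) \<and>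
     (\<forall>x\<in>carrier_vec d. \<forall>e>0. \<exists>\<delta>>0. \<forall>y\<in>carrier_vec d.
        vnorm (y - x) < \<delta> \<longrightarrow> spectral_norm (H y - H x) < e)"

definition krylov :: "real mat \<Rightarrow> real vec \<Rightarrow> nat \<Rightarrow> real vec set" where
  "krylov H g t = vec_span (dim_vec g) {(H ^\<^sub>m i) *\<^sub>v g | i. i < t}"

definition is_grade :: "real mat \<Rightarrow> real vec \<Rightarrow> nat \<Rightarrow> bool" where
  "is_grade H g m \<longleftrightarrow> (\<forall>t\<ge>1. subspace_dim (dim_vec g) (krylov H g t) = min t m)"

definition is_minres_minimizer :: "real mat \<Rightarrow> real vec \<Rightarrow> nat \<Rightarrow> real vec \<Rightarrow> bool" where
  "is_minres_minimizer H g t s \<longleftrightarrow> s \<in> krylov H g t \<and>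
     (\<forall>u\<in>krylov H g t. (vnorm (H *\<^sub>v s + g))\<^sup>2 \<le> (vnorm (H *\<^sub>v u + g))\<^sup>2)"

fun minres_iterate :: "real mat \<Rightarrow> real vec \<Rightarrow> nat \<Rightarrow> real vec" where
  "minres_iterate H g 0 = 0\<^sub>v (dim_vec g)"
| "minres_iterate H g (Suc t) =
     (if \<exists>!s. is_minres_minimizer H g (Suc t) s
      then THE s. is_minres_minimizer H g (Suc t) s
      else minres_iterate H g t)"

definition minres_residual :: "real mat \<Rightarrow> real vec \<Rightarrow> nat \<Rightarrow> real vec" where
  "minres_residual H g t = - g - H *\<^sub>v minres_iterate H g t"

text \<open>The two tests of iteration \<open>t \<ge> 1\<close>; both look at the iterate and residual of index \<open>t - 1\<close>.\<close>

definition npc_detected :: "real mat \<Rightarrow> real vec \<Rightarrow> nat \<Rightarrow> bool" where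
  "npc_detected H g t \<longleftrightarrow>
     minres_residual H g (t - 1) \<noteq> 0\<^sub>v (dim_vec g) \<and>
     minres_residual H g (t - 1) \<bullet> (H *\<^sub>v minres_residual H g (t - 1)) \<le> 0"

definition sol_detected :: "real mat \<Rightarrow> real vec \<Rightarrow> real \<Rightarrow> nat \<Rightarrow> bool" where
  "sol_detected H g \<eta> t \<longleftrightarrow>
     vnorm (H *\<^sub>v minres_residual H g (t - 1)) \<le> \<eta> * vnorm (H *\<^sub>v minres_iterate H g (t - 1))"

datatype minres_flag = SOL | NPC

text \<open>\<open>minres_returns H g \<eta> t p flag\<close>: the call MINRES\<open>(H, g, \<eta>)\<close> stops at iteration \<open>t\<close>
  and returns the direction \<open>p\<close> with the given flag.\<close>

definition minres_returns ::
  "real mat \<Rightarrow> real vec \<Rightarrow> real \<Rightarrow> nat \<Rightarrow> real vec \<Rightarrow> minres_flag \<Rightarrow> bool" where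
  "minres_returns H g \<eta> t p flag \<longleftrightarrow> t \<ge> 1 \<and>
     (\<forall>i. 1 \<le> i \<and> i < t \<longrightarrow> \<not> npc_detected H g i \<and> \<not> sol_detected H g \<eta> i) \<and>
     (case flag of
        NPC \<Rightarrow> npc_detected H g t \<and> p = minres_residual H g (t - 1)
      | SOL \<Rightarrow> \<not> npc_detected H g t \<and> sol_detected H g \<eta> t \<and> p = minres_iterate H g (t - 1))"

text \<open>The flag decides between step lengths in \<open>(0, 1]\<close> and in \<open>(0, \<infinity>)\<close>. If there is no largest
  admissible step length, no \<open>\<alpha>\<close> satisfies the predicate and the method below gets stuck.\<close>

definition line_search ::
  "(real vec \<Rightarrow> real) \<Rightarrow> (real vec \<Rightarrow> real vec) \<Rightarrow> real \<Rightarrow> real \<Rightarrow> real vec \<Rightarrow> real vec \<Rightarrow>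
   minres_flag \<Rightarrow> real \<Rightarrow> bool" where
  "line_search f g \<rho>\<^sub>S \<rho>\<^sub>N x p flag \<alpha> \<longleftrightarrow>
     (let A = (case flag of
                 SOL \<Rightarrow> {\<beta>. 0 < \<beta> \<and> \<beta> \<le> 1 \<and> f (x + \<beta> \<cdot>\<^sub>v p) \<le> f x + \<rho>\<^sub>S * \<beta> * (g x \<bullet> p)}
               | NPC \<Rightarrow> {\<beta>. 0 < \<beta> \<and> f (x + \<beta> \<cdot>\<^sub>v p) \<le> f x + \<rho>\<^sub>N * \<beta> * (g x \<bullet> p)})
      in \<alpha> \<in> A \<and> (\<forall>\<beta>\<in>A. \<beta> \<le> \<alpha>))"

text \<open>\<open>newton_mr f g H \<theta> \<rho>\<^sub>S \<rho>\<^sub>N \<epsilon> x\<^sub>0 x n\<close>: started at \<open>x\<^sub>0\<close>, the method produces the outer iterate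
  \<open>x\<close>, and the outer iterations before \<open>x\<close> used \<open>n\<close> gradient and Hessian-vector product evaluations
  (one gradient per outer iteration and one product per MINRES iteration). The method is
  deterministic, so the pairs \<open>(x, n)\<close> form a single, possibly finite, sequence.\<close>

inductive newton_mr ::
  "(real vec \<Rightarrow> real) \<Rightarrow> (real vec \<Rightarrow> real vec) \<Rightarrow> (real vec \<Rightarrow> real mat) \<Rightarrow>
   real \<Rightarrow> real \<Rightarrow> real \<Rightarrow> real \<Rightarrow> real vec \<Rightarrow> real vec \<Rightarrow> nat \<Rightarrow> bool"
  for f g H \<theta> \<rho>\<^sub>S \<rho>\<^sub>N \<epsilon> x\<^sub>0 where
  start: "newton_mr f g H \<theta> \<rho>\<^sub>S \<rho>\<^sub>N \<epsilon> x\<^sub>0 x\<^sub>0 0"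
| step: "newton_mr f g H \<theta> \<rho>\<^sub>S \<rho>\<^sub>N \<epsilon> x\<^sub>0 (x + \<alpha> \<cdot>\<^sub>v p) (n + 1 + t)"
    if "newton_mr f g H \<theta> \<rho>\<^sub>S \<rho>\<^sub>N \<epsilon> x\<^sub>0 x n"
      and "vnorm (g x) > \<epsilon>"
      and "minres_returns (H x) (g x) (\<theta> * sqrt \<epsilon>) t p flag"
      and "line_search f g \<rho>\<^sub>S \<rho>\<^sub>N x p flag \<alpha>"

abbreviation eigenspace :: "real mat \<Rightarrow> real \<Rightarrow> real vec set" where
  "eigenspace H l \<equiv> mat_kernel (H - l \<cdot>\<^sub>m 1\<^sub>m (dim_row H))"

definition relevant :: "real mat \<Rightarrow> real vec \<Rightarrow> real set" where
  "relevant H g = {l. eigenvalue H l \<and> (\<exists>v\<in>eigenspace H l. v \<bullet> g \<noteq> 0)}"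

definition psi_pos :: "real mat \<Rightarrow> real vec \<Rightarrow> nat" where
  "psi_pos H g = card {l \<in> relevant H g. l > 0}"

definition psi_neg :: "real mat \<Rightarrow> real vec \<Rightarrow> nat" where
  "psi_neg H g = card {l \<in> relevant H g. l < 0}"

definition psi_zero :: "real mat \<Rightarrow> real vec \<Rightarrow> nat" where
  "psi_zero H g = card {l \<in> relevant H g. l = 0}"

definition psi :: "real mat \<Rightarrow> real vec \<Rightarrow> nat" where
  "psi H g = psi_pos H g + psi_neg H g + psi_zero H g"

text \<open>\<open>lam H g i\<close>, for \<open>1 \<le> i \<le> psi H g\<close>, is the \<open>i\<close>-th largest relevant eigenvalue.\<close>

definition lam :: "real mat \<Rightarrow> real vec \<Rightarrow> nat \<Rightarrow> real" where
  "lam H g i = rev (sorted_list_of_set (relevant H g)) ! (i - 1)"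

text \<open>The columns of \<open>U\<close> form an orthonormal eigenvector basis of the sum of the eigenspaces of
  the eigenvalues in \<open>\<Lambda>\<close>; if \<open>\<Lambda>\<close> is empty, \<open>U\<close> has no columns.\<close>

definition eigenbasis_mat :: "real mat \<Rightarrow> real set \<Rightarrow> real mat \<Rightarrow> bool" where
  "eigenbasis_mat H \<Lambda> U \<longleftrightarrow>
     dim_row U = dim_row H \<and>
     U\<^sup>T * U = 1\<^sub>m (dim_col U) \<and>
     (\<forall>j<dim_col U. \<exists>l\<in>\<Lambda>. eigenvector H (col U j) l) \<and>
     vec_span (dim_row H) (set (cols U)) = vec_span (dim_row H) (\<Union>l\<in>\<Lambda>. eigenspace H l)"

definition is_U :: "real mat \<Rightarrow> real vec \<Rightarrow> real mat \<Rightarrow> bool" where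
  "is_U H g U \<longleftrightarrow> eigenbasis_mat H {l \<in> relevant H g. l \<noteq> 0} U"

definition is_U_pos :: "real mat \<Rightarrow> real vec \<Rightarrow> nat \<Rightarrow> real mat \<Rightarrow> bool" where
  "is_U_pos H g i P \<longleftrightarrow> eigenbasis_mat H (lam H g ` {1..i}) P"

definition is_U_neg :: "real mat \<Rightarrow> real vec \<Rightarrow> nat \<Rightarrow> real mat \<Rightarrow> bool" where
  "is_U_neg H g j N \<longleftrightarrow> eigenbasis_mat H (lam H g ` {j..psi H g}) N"

text \<open>The matrices \<open>U\<close>, \<open>P\<close>, \<open>N\<close> are determined only up to the choice of an orthonormal basis,
  on which none of the norms below depends; the conditions are stated for every choice.\<close>

definition relevant_hessian_bounded ::
  "nat \<Rightarrow> (real vec \<Rightarrow> real vec) \<Rightarrow> (real vec \<Rightarrow> real mat) \<Rightarrow> real \<Rightarrow> bool" where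
  "relevant_hessian_bounded d g H L\<^sub>g \<longleftrightarrow>
     (\<forall>x\<in>carrier_vec d. \<forall>U. is_U (H x) (g x) U \<longrightarrow> spectral_norm (U\<^sup>T * H x * U) \<le> L\<^sub>g)"

definition lipschitz_hessian :: "nat \<Rightarrow> (real vec \<Rightarrow> real mat) \<Rightarrow> real \<Rightarrow> bool" where
  "lipschitz_hessian d H L\<^sub>H \<longleftrightarrow>
     (\<forall>x\<in>carrier_vec d. \<forall>y\<in>carrier_vec d. spectral_norm (H x - H y) \<le> L\<^sub>H * vnorm (x - y))"

definition krylov_regularity_I ::
  "nat \<Rightarrow> (real vec \<Rightarrow> real vec) \<Rightarrow> (real vec \<Rightarrow> real mat) \<Rightarrow> real \<Rightarrow> bool" where
  "krylov_regularity_I d g H \<sigma> \<longleftrightarrow>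
     (\<forall>x\<in>carrier_vec d. \<forall>m t. is_grade (H x) (g x) m \<and> t \<le> m \<and>
        (\<forall>i\<in>{1..t}. \<not> npc_detected (H x) (g x) i) \<longrightarrow>
        (\<forall>s\<in>krylov (H x) (g x) t. s \<bullet> (H x *\<^sub>v s) \<ge> \<sigma> * (vnorm s)\<^sup>2))"

definition krylov_regularity_II ::
  "(real vec \<Rightarrow> real) \<Rightarrow> (real vec \<Rightarrow> real vec) \<Rightarrow> (real vec \<Rightarrow> real mat) \<Rightarrow>
   real \<Rightarrow> real \<Rightarrow> real \<Rightarrow> real \<Rightarrow> real vec \<Rightarrow> real \<Rightarrow> bool" where
  "krylov_regularity_II f g H \<theta> \<rho>\<^sub>S \<rho>\<^sub>N \<epsilon> x\<^sub>0 \<omega> \<longleftrightarrow>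
     (\<forall>x n t p. newton_mr f g H \<theta> \<rho>\<^sub>S \<rho>\<^sub>N \<epsilon> x\<^sub>0 x n \<and> vnorm (g x) > \<epsilon> \<and>
        minres_returns (H x) (g x) (\<theta> * sqrt \<epsilon>) t p NPC \<longrightarrow> vnorm p \<ge> \<omega> * vnorm (g x))"

definition both_sided_dominance :: "real mat \<Rightarrow> real vec \<Rightarrow> real \<Rightarrow> real \<Rightarrow> bool" where
  "both_sided_dominance H g \<mu> \<nu> \<longleftrightarrow>
     psi_pos H g \<ge> 1 \<and> psi_neg H g \<ge> 1 \<and>
     (\<exists>i j. 1 \<le> i \<and> i \<le> psi_pos H g \<and> psi_pos H g + psi_zero H g + 1 \<le> j \<and> j \<le> psi H g \<and>
        min (lam H g i) \<bar>lam H g j\<bar> \<ge> \<mu> \<and>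
        (\<forall>U P N. is_U H g U \<and> is_U_pos H g i P \<and> is_U_neg H g j N \<longrightarrow>
           (vnorm ((P * P\<^sup>T + N * N\<^sup>T) *\<^sub>v g))\<^sup>2 \<ge> \<nu> * (vnorm ((U * U\<^sup>T) *\<^sub>v g))\<^sup>2))"

definition positive_dominance :: "real mat \<Rightarrow> real vec \<Rightarrow> real \<Rightarrow> real \<Rightarrow> bool" where
  "positive_dominance H g \<mu> \<nu> \<longleftrightarrow>
     psi_pos H g \<ge> 1 \<and>
     (\<exists>i. 1 \<le> i \<and> i \<le> psi_pos H g \<and> lam H g i \<ge> \<mu> \<and>
        (\<forall>U P. is_U H g U \<and> is_U_pos H g i P \<longrightarrow>
           (vnorm ((P * P\<^sup>T) *\<^sub>v g))\<^sup>2 \<ge> \<nu> * (vnorm ((U * U\<^sup>T) *\<^sub>v g))\<^sup>2))"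

definition negative_dominance :: "real mat \<Rightarrow> real vec \<Rightarrow> real \<Rightarrow> real \<Rightarrow> bool" where
  "negative_dominance H g \<mu> \<nu> \<longleftrightarrow>
     psi_neg H g \<ge> 1 \<and>
     (\<exists>j. psi_pos H g + psi_zero H g + 1 \<le> j \<and> j \<le> psi H g \<and> \<bar>lam H g j\<bar> \<ge> \<mu> \<and>
        (\<forall>U N. is_U H g U \<and> is_U_neg H g j N \<longrightarrow>
           (vnorm ((N * N\<^sup>T) *\<^sub>v g))\<^sup>2 \<ge> \<nu> * (vnorm ((U * U\<^sup>T) *\<^sub>v g))\<^sup>2))"

definition spectral_assumption ::
  "nat \<Rightarrow> (real vec \<Rightarrow> real vec) \<Rightarrow> (real vec \<Rightarrow> real mat) \<Rightarrow> real \<Rightarrow> real \<Rightarrow> bool" where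
  "spectral_assumption d g H \<mu> \<nu> \<longleftrightarrow>
     (\<forall>x\<in>carrier_vec d. g x \<notin> mat_kernel (H x) \<longrightarrow>
        both_sided_dominance (H x) (g x) \<mu> \<nu> \<or>
        positive_dominance (H x) (g x) \<mu> \<nu> \<or>
        negative_dominance (H x) (g x) \<mu> \<nu>)"

end

theory Submission
  imports
    Defs
    "Jordan_Normal_Form.Schur_Decomposition"
    "Jordan_Normal_Form.DL_Rank"
begin

text \<open>
  Every outer step is charged to the decrease of \<open>f\<close> that it achieves. The total decrease is at most
  \<open>\<Delta>\<close>, so the bound follows once each step pays for its own evaluations at a rate of
  \<open>\<epsilon>\<^sub>g powr (- 3 / 2)\<close> per unit of decrease. The two flags behave differently.

  \<^item> A step along a residual \<open>r\<close> of nonpositive curvature decreases \<open>f\<close> by a multiple of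
    \<open>\<parallel>r\<parallel> powr (3 / 2)\<close>, which the second regularity assumption bounds below by a multiple of
    \<open>\<epsilon>\<^sub>g powr (3 / 2)\<close>. This decrease pays for a bounded number of evaluations only. No more occur:
    as long as no nonpositive curvature is met, the first regularity assumption makes the Hessian
    uniformly positive on the Krylov space, so the residuals decay geometrically; as the returned
    residual is still comparable to the gradient, it appears after boundedly many iterations.

  \<^item> A step along a MINRES solution \<open>s\<close> needs only logarithmically many iterations in \<open>1 / \<epsilon>\<^sub>g\<close>, again
    by the geometric decay; a bound of order \<open>\<epsilon>\<^sub>g powr (- 1 / 2)\<close> is all that is used. In exchange its
    decrease has the better order \<open>\<epsilon>\<^sub>g\<close>: the curvature along \<open>s\<close> is at least \<open>\<sigma>\<close>, so a unit step
    decreases \<open>f\<close> by a multiple of \<open>\<parallel>s\<parallel>\<^sup>2\<close>, and if the next gradient is longer than \<open>\<epsilon>\<^sub>g\<close> then \<open>s\<close> has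
    length at least of order \<open>sqrt \<epsilon>\<^sub>g\<close>; shorter steps are taken only along long \<open>s\<close> and decrease \<open>f\<close> by at
    least a constant. The only exception is a step whose successor is already an approximate
    stationary point, and it is the last one.

  Three supporting facts carry this. The norm of the Hessian on the Krylov spaces is at most \<open>L\<^sub>g\<close>
  because these spaces involve only relevant eigenvalues (\<open>vnorm_mult_mat_vec_le_relevant\<close>, which
  rests on the spectral theorem \<open>symmetric_orthonormal_eigenvectors\<close> and, for the symmetry of the
  Hessian, on \<open>hessian_symmetric\<close>). The MINRES iterates agree with those of the conjugate residual
  recurrence before nonpositive curvature, which gives both their existence and the descent
  inequality \<open>\<langle>g, s\<rangle> \<le> - \<langle>s, H s\<rangle>\<close> (\<open>iterate_of_positive_curvature\<close>). The residual decay is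
  \<open>residual_decay\<close>, and the charging argument is \<open>amortized_count\<close>.
\<close>


section \<open>Euclidean geometry of real vectors\<close>

lemma scalar_prod_self_nonneg: "(v :: real vec) \<bullet> v \<ge> 0"
  unfolding scalar_prod_def by (intro sum_nonneg) auto

lemma scalar_prod_self_eq_0_iff:
  assumes "(v :: real vec) \<in> carrier_vec d"
  shows "v \<bullet> v = 0 \<longleftrightarrow> v = 0\<^sub>v d"
  using conjugate_square_eq_0_vec[OF assms] by simp

lemma vnorm_nonneg [simp]: "vnorm v \<ge> 0"
  by (simp add: vnorm_def scalar_prod_self_nonneg)

lemma vnorm_square: "(vnorm v)\<^sup>2 = v \<bullet> v"
  by (simp add: vnorm_def scalar_prod_self_nonneg)

lemma vnorm_0 [simp]: "vnorm (0\<^sub>v d) = 0"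
  by (simp add: vnorm_def)

lemma vnorm_eq_0_iff: "v \<in> carrier_vec d \<Longrightarrow> vnorm v = 0 \<longleftrightarrow> v = 0\<^sub>v d"
  by (simp add: vnorm_def scalar_prod_self_eq_0_iff)

lemma vnorm_smult: "vnorm (c \<cdot>\<^sub>v v) = \<bar>c\<bar> * vnorm v"
proof -
  have "(c \<cdot>\<^sub>v v) \<bullet> (c \<cdot>\<^sub>v v) = c\<^sup>2 * (v \<bullet> v)"
    by (simp add: power2_eq_square)
  thus ?thesis by (simp add: vnorm_def real_sqrt_mult)
qed

lemma scalar_prod_abs_le_vnorm:
  assumes "v \<in> carrier_vec d" "w \<in> carrier_vec d"
  shows "\<bar>v \<bullet> w\<bar> \<le> vnorm v * vnorm w"
proof -
  define u where "u = (w \<bullet> w) \<cdot>\<^sub>v v - (v \<bullet> w) \<cdot>\<^sub>v w"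
  have u: "u \<bullet> u = (w \<bullet> w) * ((v \<bullet> v) * (w \<bullet> w) - (v \<bullet> w)\<^sup>2)"
    unfolding u_def using assms
    by (simp add: minus_scalar_prod_distrib[of _ d] scalar_prod_minus_distrib[of _ d]
        comm_scalar_prod[of w d v] power2_eq_square algebra_simps)
  have "(v \<bullet> w)\<^sup>2 \<le> (v \<bullet> v) * (w \<bullet> w)"
  proof (cases "w \<bullet> w = 0")
    case True
    hence "w = 0\<^sub>v d" using scalar_prod_self_eq_0_iff[OF assms(2)] by simp
    thus ?thesis using assms by simp
  next
    case False
    hence "w \<bullet> w > 0" using scalar_prod_self_nonneg[of w] by linarith
    thus ?thesis using scalar_prod_self_nonneg[of u] unfolding u by (simp add: zero_le_mult_iff)
  qed
  hence "sqrt ((v \<bullet> w)\<^sup>2) \<le> sqrt ((v \<bullet> v) * (w \<bullet> w))" by (rule real_sqrt_le_mono)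
  thus ?thesis by (simp add: vnorm_def real_sqrt_mult)
qed

lemma vnorm_triangle:
  assumes "v \<in> carrier_vec d" "w \<in> carrier_vec d"
  shows "vnorm (v + w) \<le> vnorm v + vnorm w"
proof (rule power2_le_imp_le)
  have "(vnorm (v + w))\<^sup>2 = v \<bullet> v + 2 * (v \<bullet> w) + w \<bullet> w"
    using assms
    by (simp add: vnorm_square scalar_prod_add_distrib[of _ d] add_scalar_prod_distrib[of _ d]
        comm_scalar_prod[of w d v])
  also have "\<dots> \<le> v \<bullet> v + 2 * (vnorm v * vnorm w) + w \<bullet> w"
    using scalar_prod_abs_le_vnorm[OF assms] by simp
  also have "\<dots> = (vnorm v + vnorm w)\<^sup>2"
    by (simp add: power2_sum vnorm_square)
  finally show "(vnorm (v + w))\<^sup>2 \<le> (vnorm v + vnorm w)\<^sup>2" .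
qed simp

text \<open>The supremum in the definition of the spectral norm says something only if the set is bounded;
  the Frobenius norm is a bound.\<close>

lemma vnorm_mult_mat_vec_bounded:
  assumes "A \<in> carrier_mat m n"
  obtains B where "\<And>v. v \<in> carrier_vec n \<Longrightarrow> vnorm (A *\<^sub>v v) \<le> B * vnorm v"
proof
  fix v :: "real vec" assume v: "v \<in> carrier_vec n"
  define B where "B = (\<Sum>i=0..<m. row A i \<bullet> row A i)"
  have B: "B \<ge> 0" unfolding B_def by (intro sum_nonneg scalar_prod_self_nonneg)
  have "(A *\<^sub>v v) \<bullet> (A *\<^sub>v v) = (\<Sum>i=0..<m. (row A i \<bullet> v)\<^sup>2)"
    using assms v by (simp add: scalar_prod_def[of "A *\<^sub>v v"] power2_eq_square)
  also have "\<dots> \<le> (\<Sum>i=0..<m. (row A i \<bullet> row A i) * (v \<bullet> v))"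
  proof (rule sum_mono)
    fix i
    have "row A i \<in> carrier_vec n" using assms by auto
    from power_mono[OF scalar_prod_abs_le_vnorm[OF this v] abs_ge_zero, of 2]
    show "(row A i \<bullet> v)\<^sup>2 \<le> (row A i \<bullet> row A i) * (v \<bullet> v)"
      by (simp add: power_mult_distrib vnorm_square)
  qed
  finally have "(A *\<^sub>v v) \<bullet> (A *\<^sub>v v) \<le> B * (v \<bullet> v)" by (simp add: B_def sum_distrib_right)
  hence "sqrt ((A *\<^sub>v v) \<bullet> (A *\<^sub>v v)) \<le> sqrt (B * (v \<bullet> v))" by (rule real_sqrt_le_mono)
  thus "vnorm (A *\<^sub>v v) \<le> sqrt (\<Sum>i=0..<m. row A i \<bullet> row A i) * vnorm v"
    by (simp add: vnorm_def real_sqrt_mult B_def)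
qed

lemma vnorm_mult_mat_vec_le_spectral_norm:
  assumes A: "A \<in> carrier_mat m n" and v: "v \<in> carrier_vec n"
  shows "vnorm (A *\<^sub>v v) \<le> spectral_norm A * vnorm v"
proof (cases "v = 0\<^sub>v n")
  case True
  have "A *\<^sub>v v = 0\<^sub>v m" using A True by (intro eq_vecI) auto
  thus ?thesis using True by simp
next
  case False
  hence pos: "vnorm v > 0" using vnorm_eq_0_iff[OF v] vnorm_nonneg[of v] by linarith
  obtain B where B: "\<And>v. v \<in> carrier_vec n \<Longrightarrow> vnorm (A *\<^sub>v v) \<le> B * vnorm v"
    using vnorm_mult_mat_vec_bounded[OF A] by blast
  have "vnorm (A *\<^sub>v u) \<le> \<bar>B\<bar>" if u: "u \<in> carrier_vec n" "vnorm u \<le> 1" for u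
  proof -
    have "vnorm (A *\<^sub>v u) \<le> B * vnorm u" by (rule B[OF u(1)])
    also have "\<dots> \<le> \<bar>B\<bar> * 1" using u(2) by (intro mult_mono) auto
    finally show ?thesis by simp
  qed
  hence bdd: "bdd_above {vnorm (A *\<^sub>v v) | v. v \<in> carrier_vec (dim_col A) \<and> vnorm v \<le> 1}"
    using A by (intro bdd_aboveI[of _ "\<bar>B\<bar>"]) auto
  define u where "u = inverse (vnorm v) \<cdot>\<^sub>v v"
  have u: "u \<in> carrier_vec n" "vnorm u = 1" using v pos by (auto simp: u_def vnorm_smult)
  have "vnorm (A *\<^sub>v u) \<le> spectral_norm A"
    unfolding spectral_norm_def using u A by (intro cSup_upper bdd) auto
  moreover have "A *\<^sub>v u = inverse (vnorm v) \<cdot>\<^sub>v (A *\<^sub>v v)"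
    unfolding u_def by (rule mult_mat_vec[OF A v])
  ultimately show ?thesis using pos by (simp add: vnorm_smult field_simps)
qed

lemma transpose_scalar_prod:
  fixes A :: "real mat"
  assumes "A \<in> carrier_mat m n" "v \<in> carrier_vec n" "w \<in> carrier_vec m"
  shows "(A *\<^sub>v v) \<bullet> w = v \<bullet> (A\<^sup>T *\<^sub>v w)"
  using assms transpose_vec_mult_scalar[of A m n v w]
  by (metis comm_scalar_prod mult_mat_vec_carrier transpose_carrier_mat)

lemma symmetric_scalar_prod:
  fixes A :: "real mat"
  assumes "A \<in> carrier_mat d d" "A\<^sup>T = A" "v \<in> carrier_vec d" "w \<in> carrier_vec d"
  shows "(A *\<^sub>v v) \<bullet> w = v \<bullet> (A *\<^sub>v w)"
  using assms transpose_scalar_prod by metis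

section \<open>The spectral theorem for real symmetric matrices\<close>

lemma symmetric_complex_eigenvalue_real:
  fixes A :: "real mat"
  assumes A: "A \<in> carrier_mat d d" "A\<^sup>T = A"
    and e: "eigenvalue (map_mat complex_of_real A) e"
  shows "e \<in> \<real>"
proof -
  let ?A = "map_mat complex_of_real A"
  have cA: "?A \<in> carrier_mat d d" using A by simp
  obtain v where v: "v \<in> carrier_vec d" "v \<noteq> 0\<^sub>v d" "?A *\<^sub>v v = e \<cdot>\<^sub>v v"
    using e A(1) unfolding eigenvalue_def eigenvector_def by auto
  have cv: "conjugate v \<in> carrier_vec d" using v(1) by simp
  have sym: "?A\<^sup>T = ?A" using A arg_cong[OF A(2), of "map_mat complex_of_real"]
    by (intro eq_matI) (auto simp: mat_eq_iff)
  have cAv: "?A *\<^sub>v conjugate v = conjugate (?A *\<^sub>v v)"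
    using A(1) v(1)
    by (intro eq_vecI) (auto simp: scalar_prod_def)
  have "(?A *\<^sub>v v) \<bullet> conjugate v = v \<bullet> (?A *\<^sub>v conjugate v)"
    using transpose_vec_mult_scalar[OF cA v(1) cv] sym v cv cA
    by (metis comm_scalar_prod mult_mat_vec_carrier)
  also have "\<dots> = v \<bullet> conjugate (e \<cdot>\<^sub>v v)" using cAv v(3) by simp
  also have "\<dots> = cnj e * (v \<bullet> conjugate v)" using v(1) by (simp add: conjugate_smult_vec)
  finally have "e * (v \<bullet> conjugate v) = cnj e * (v \<bullet> conjugate v)" using v(1,3) by simp
  moreover have "v \<bullet> conjugate v \<noteq> 0" using conjugate_square_eq_0_vec[OF v(1)] v(2) by simp
  ultimately have "cnj e = e" by simp
  thus ?thesis by (simp add: Reals_cnj_iff)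
qed

text \<open>The triangularisation used below needs the characteristic polynomial to split over the reals. It
  splits over the complex numbers, and all its roots are real by the previous lemma.\<close>

lemma symmetric_char_poly_splits:
  fixes A :: "real mat"
  assumes A: "A \<in> carrier_mat d d" "A\<^sup>T = A"
  obtains es where "char_poly A = (\<Prod>e\<leftarrow>es. [:- e, 1:])"
proof -
  let ?A = "map_mat complex_of_real A"
  have cA: "?A \<in> carrier_mat d d" using A by simp
  obtain cs where cs: "char_poly ?A = (\<Prod>e\<leftarrow>cs. [:- e, 1:])"
    using char_poly_factorized[OF cA] by auto
  have "c \<in> \<real>" if "c \<in> set cs" for c
  proof -
    have "poly (char_poly ?A) c = 0" unfolding cs poly_prod_list using that
      by (auto simp: prod_list_zero_iff)
    thus ?thesis using symmetric_complex_eigenvalue_real[OF A] eigenvalue_root_char_poly[OF cA] by auto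
  qed
  hence re: "map (complex_of_real \<circ> Re) cs = cs" by (intro map_idI) auto
  define es where "es = map Re cs"
  interpret map_of_real: map_poly_comm_ring_hom complex_of_real ..
  have "map_poly complex_of_real (char_poly A) = char_poly ?A"
    by (rule of_real_hom.char_poly_hom[OF A(1), symmetric])
  also have "\<dots> = (\<Prod>e\<leftarrow>map (complex_of_real \<circ> Re) cs. [:- e, 1:])" unfolding cs re ..
  also have "\<dots> = map_poly complex_of_real (\<Prod>e\<leftarrow>es. [:- e, 1:])"
    unfolding es_def by (simp add: map_of_real.hom_prod_list o_def)
  finally have "map_poly complex_of_real (char_poly A) = map_poly complex_of_real (\<Prod>e\<leftarrow>es. [:- e, 1:])" .
  hence "char_poly A = (\<Prod>e\<leftarrow>es. [:- e, 1:])"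
    by (metis (no_types, lifting) coeff_map_poly of_real_0 of_real_eq_iff poly_eqI)
  thus thesis by (rule that)
qed

text \<open>Subtracting the projections onto the members of the list one after the other leaves every scalar
  product with a vector orthogonal to the list unchanged. These scalar products are all that the
  diagonalisation below needs, so no formula for \<open>w\<close> appears.\<close>

lemma orthogonal_part_exists:
  fixes p :: "real vec"
  assumes "p \<in> carrier_vec d" "set qs \<subseteq> carrier_vec d"
    and "\<And>i j. i < length qs \<Longrightarrow> j < length qs \<Longrightarrow> qs ! i \<bullet> qs ! j = (if i = j then 1 else 0)"
  obtains w where "w \<in> carrier_vec d" "\<And>q. q \<in> set qs \<Longrightarrow> q \<bullet> w = 0"
    "\<And>v. v \<in> carrier_vec d \<Longrightarrow> (\<And>q. q \<in> set qs \<Longrightarrow> q \<bullet> v = 0) \<Longrightarrow> w \<bullet> v = p \<bullet> v"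
proof -
  have "\<exists>w\<in>carrier_vec d. (\<forall>q\<in>set qs. q \<bullet> w = 0) \<and>
      (\<forall>v\<in>carrier_vec d. (\<forall>q\<in>set qs. q \<bullet> v = 0) \<longrightarrow> w \<bullet> v = p \<bullet> v)"
    using assms(2,3)
  proof (induction qs)
    case Nil
    thus ?case using assms(1) by auto
  next
    case (Cons q qs)
    have on: "qs ! i \<bullet> qs ! j = (if i = j then 1 else 0)" if "i < length qs" "j < length qs" for i j
      using Cons.prems(2)[of "Suc i" "Suc j"] that by simp
    have qq: "q \<bullet> q = 1" using Cons.prems(2)[of 0 0] by simp
    have qc: "q \<in> carrier_vec d" and qsc: "set qs \<subseteq> carrier_vec d" using Cons.prems(1) by auto
    have qs: "q' \<bullet> q = 0" if "q' \<in> set qs" for q'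
      using that Cons.prems(2)[of "Suc i" 0 for i] by (auto simp: in_set_conv_nth)
    obtain w where w: "w \<in> carrier_vec d" "\<forall>q\<in>set qs. q \<bullet> w = 0"
      "\<forall>v\<in>carrier_vec d. (\<forall>q\<in>set qs. q \<bullet> v = 0) \<longrightarrow> w \<bullet> v = p \<bullet> v"
      using Cons.IH[OF qsc on] by blast
    show ?case
    proof (intro bexI[of _ "w - (q \<bullet> w) \<cdot>\<^sub>v q"] conjI ballI impI)
      fix q' assume q': "q' \<in> set (q # qs)"
      hence "q' \<in> carrier_vec d" using Cons.prems(1) by auto
      thus "q' \<bullet> (w - (q \<bullet> w) \<cdot>\<^sub>v q) = 0"
        using q' qs qq w(2) w(1) qc by (auto simp: scalar_prod_minus_distrib[of _ d])
    next
      fix v :: "real vec" assume v: "v \<in> carrier_vec d" "\<forall>q\<in>set (q # qs). q \<bullet> v = 0"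
      thus "(w - (q \<bullet> w) \<cdot>\<^sub>v q) \<bullet> v = p \<bullet> v"
        using w qc by (auto simp: minus_scalar_prod_distrib[of _ d])
    qed (use w qc in auto)
  qed
  thus thesis using that by blast
qed

text \<open>A triangularisation of \<open>A\<close> provides a basis whose initial segments span invariant subspaces.
  Orthonormalising it keeps these spans, and a symmetric matrix that preserves the flag spanned by an
  orthonormal basis is diagonal in it. In the induction the span of the first \<open>k\<close> columns of \<open>P\<close> is
  represented by its orthogonal complement, the last conjunct.\<close>

lemma symmetric_orthonormal_eigenvectors:
  fixes A :: "real mat"
  assumes A: "A \<in> carrier_mat d d" "A\<^sup>T = A"
  obtains qs ls where "length qs = d" "set qs \<subseteq> carrier_vec d"
    "\<And>i j. i < d \<Longrightarrow> j < d \<Longrightarrow> qs ! i \<bullet> qs ! j = (if i = j then 1 else 0)"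
    "\<And>i. i < d \<Longrightarrow> A *\<^sub>v (qs ! i) = ls i \<cdot>\<^sub>v (qs ! i)"
proof -
  obtain es where es: "char_poly A = (\<Prod>e\<leftarrow>es. [:- e, 1:])"
    using symmetric_char_poly_splits[OF A] by blast
  obtain B where B: "B \<in> carrier_mat d d" "upper_triangular B" "similar_mat A B"
    using schur_decomposition_exists[OF A(1) es] by blast
  then obtain P R where "similar_mat_wit A B P R" unfolding similar_mat_def by blast
  from similar_mat_witD2[OF A(1) this] have P: "P \<in> carrier_mat d d" "R \<in> carrier_mat d d"
    "P * R = 1\<^sub>m d" "R * P = 1\<^sub>m d" "A = P * B * R" by auto
  have AP: "A * P = P * B"
    using P B(1) by (metis (no_types, lifting) assoc_mult_mat mult_carrier_mat right_mult_one_mat)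
  have "\<exists>qs ls. length qs = k \<and> set qs \<subseteq> carrier_vec d \<and>
      (\<forall>i<k. \<forall>j<k. qs ! i \<bullet> qs ! j = (if i = j then 1 else 0)) \<and>
      (\<forall>i<k. A *\<^sub>v (qs ! i) = ls i \<cdot>\<^sub>v (qs ! i)) \<and>
      (\<forall>v\<in>carrier_vec d. (\<forall>q\<in>set qs. q \<bullet> v = 0) \<longleftrightarrow> (\<forall>i<k. col P i \<bullet> v = 0))"
    if "k \<le> d" for k
    using that
  proof (induction k)
    case 0
    show ?case by (rule exI[of _ "[]"]) auto
  next
    case (Suc k)
    then obtain qs ls where qs: "length qs = k" "set qs \<subseteq> carrier_vec d"
      "\<And>i j. i < k \<Longrightarrow> j < k \<Longrightarrow> qs ! i \<bullet> qs ! j = (if i = j then 1 else 0)"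
      "\<And>i. i < k \<Longrightarrow> A *\<^sub>v (qs ! i) = ls i \<cdot>\<^sub>v (qs ! i)"
      "\<And>v. v \<in> carrier_vec d \<Longrightarrow> (\<forall>q\<in>set qs. q \<bullet> v = 0) \<longleftrightarrow> (\<forall>i<k. col P i \<bullet> v = 0)"
      by fastforce
    have k: "k < d" using Suc.prems by simp
    let ?p = "col P k"
    have p: "?p \<in> carrier_vec d" using P(1) by auto
    obtain w where w: "w \<in> carrier_vec d" "\<And>q. q \<in> set qs \<Longrightarrow> q \<bullet> w = 0"
      "\<And>v. v \<in> carrier_vec d \<Longrightarrow> (\<And>q. q \<in> set qs \<Longrightarrow> q \<bullet> v = 0) \<Longrightarrow> w \<bullet> v = ?p \<bullet> v"
      using orthogonal_part_exists[OF p qs(2)] qs(1,3) by metis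
    have q_eig: "q \<bullet> (A *\<^sub>v v) = 0" if "q \<in> set qs" "v \<in> carrier_vec d" "q \<bullet> v = 0" for q v
    proof -
      obtain i where "i < k" "q = qs ! i" using \<open>q \<in> set qs\<close> qs(1) by (auto simp: in_set_conv_nth)
      hence "A *\<^sub>v q = ls i \<cdot>\<^sub>v q" using qs(4) by simp
      thus ?thesis using symmetric_scalar_prod[OF A, of q v] that qs(2) by auto
    qed
    \<comment> \<open>the \<open>k\<close>-th row of \<open>P\<^sup>-\<^sup>1\<close> separates the \<open>k\<close>-th column of \<open>P\<close> from the earlier ones\<close>
    have "w \<noteq> 0\<^sub>v d"
    proof
      assume w0: "w = 0\<^sub>v d"
      have r: "row R k \<in> carrier_vec d" using P(2) by auto
      have c: "col P i \<bullet> row R k = (if i = k then 1 else 0)" if "i < d" for i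
      proof -
        have "(R * P) $$ (k, i) = (if i = k then 1 else 0)" unfolding P(4) using k that by simp
        moreover have "(R * P) $$ (k, i) = row R k \<bullet> col P i" using P(1,2) k that by simp
        moreover have "row R k \<bullet> col P i = col P i \<bullet> row R k"
          by (rule comm_scalar_prod[OF r]) (use P(1) in auto)
        ultimately show ?thesis by simp
      qed
      have "\<forall>q\<in>set qs. q \<bullet> row R k = 0" using qs(5)[OF r] c k by auto
      hence "w \<bullet> row R k = 1" using w(3)[OF r] c[OF k] by simp
      thus False using w0 r by simp
    qed
    hence "w \<bullet> w > 0"
      using scalar_prod_self_eq_0_iff[OF w(1)] scalar_prod_self_nonneg[of w] by linarith
    hence nw: "vnorm w > 0" by (simp add: vnorm_def)
    have Aw: "A *\<^sub>v w = B $$ (k, k) \<cdot>\<^sub>v w"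
    proof -
      \<comment> \<open>\<open>z\<close> is orthogonal to the list and, as the computation shows, also to itself\<close>
      define z where "z = A *\<^sub>v w - B $$ (k, k) \<cdot>\<^sub>v w"
      have Awc: "A *\<^sub>v w \<in> carrier_vec d" using A w by auto
      have z: "z \<in> carrier_vec d" using Awc w by (auto simp: z_def)
      have zq: "q \<bullet> z = 0" if "q \<in> set qs" for q
      proof -
        have "q \<in> carrier_vec d" using that qs(2) by auto
        thus ?thesis unfolding z_def using q_eig[OF that w(1) w(2)[OF that]] w(2)[OF that] Awc w(1)
          by (simp add: scalar_prod_minus_distrib[of _ d])
      qed
      have Az: "A *\<^sub>v z \<in> carrier_vec d" using A z by auto
      have "(A *\<^sub>v w) \<bullet> z = w \<bullet> (A *\<^sub>v z)" by (rule symmetric_scalar_prod[OF A w(1) z])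
      also have "\<dots> = ?p \<bullet> (A *\<^sub>v z)" using w(3)[OF Az] q_eig[OF _ z] zq by auto
      also have "\<dots> = (A *\<^sub>v ?p) \<bullet> z" by (rule symmetric_scalar_prod[OF A p z, symmetric])
      also have "A *\<^sub>v ?p = P *\<^sub>v col B k"
        using col_mult2[OF A(1) P(1) k] col_mult2[OF P(1) B(1) k] unfolding AP by simp
      also have "\<dots> \<bullet> z = col B k \<bullet> (P\<^sup>T *\<^sub>v z)"
        by (rule transpose_scalar_prod[of _ d d]) (use P(1) B(1) z k in auto)
      also have "\<dots> = (\<Sum>i=0..<d. B $$ (i, k) * (col P i \<bullet> z))"
        using P(1) B(1) z k unfolding scalar_prod_def[of "col B k"]
        by (intro sum.cong) auto
      also have "\<dots> = (\<Sum>i=0..<d. if i = k then B $$ (k, k) * (?p \<bullet> z) else 0)"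
      proof (rule sum.cong[OF refl])
        fix i assume i: "i \<in> {0..<d}"
        have "B $$ (i, k) = 0" if "i > k" using B(1,2) that i k by (auto simp: upper_triangular_def)
        moreover have "col P i \<bullet> z = 0" if "i < k" using qs(5)[OF z] zq that by auto
        ultimately show "B $$ (i, k) * (col P i \<bullet> z) = (if i = k then B $$ (k, k) * (?p \<bullet> z) else 0)"
          by (cases i k rule: linorder_cases) auto
      qed
      also have "\<dots> = B $$ (k, k) * (w \<bullet> z)" using k w(3)[OF z zq] by simp
      finally have "z \<bullet> z = 0"
        using Awc w(1) z by (subst (1) z_def) (simp add: minus_scalar_prod_distrib[of _ d])
      hence "z = 0\<^sub>v d" using scalar_prod_self_eq_0_iff[OF z] by simp
      thus ?thesis using Awc w(1) A(1) unfolding z_def by (auto simp: vec_eq_iff)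
    qed
    define q where "q = inverse (vnorm w) \<cdot>\<^sub>v w"
    have q: "q \<in> carrier_vec d" using w(1) by (simp add: q_def)
    have qq: "q \<bullet> q = 1"
      using nw by (simp add: vnorm_square[symmetric] q_def vnorm_smult)
    have qsq: "q' \<bullet> q = 0" "q \<bullet> q' = 0" if "q' \<in> set qs" for q'
      using w(1) w(2)[OF that] that qs(2) comm_scalar_prod[of q' d w] by (auto simp: q_def)
    have Aq: "A *\<^sub>v q = B $$ (k, k) \<cdot>\<^sub>v q"
      unfolding q_def using A(1) w(1) Aw by (simp add: mult_mat_vec smult_smult_assoc mult.commute)
    have qv: "q \<bullet> v = inverse (vnorm w) * (w \<bullet> v)" if "v \<in> carrier_vec d" for v
      using that w(1) by (simp add: q_def)
    show ?case
    proof (intro exI[of _ "qs @ [q]"] exI[of _ "ls(k := B $$ (k, k))"] conjI ballI allI impI)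
      fix i j assume "i < Suc k" "j < Suc k"
      thus "(qs @ [q]) ! i \<bullet> (qs @ [q]) ! j = (if i = j then 1 else 0)"
        using qs(1,3) qq qsq by (auto simp: nth_append less_Suc_eq)
    next
      fix i assume "i < Suc k"
      thus "A *\<^sub>v (qs @ [q]) ! i = (ls(k := B $$ (k, k))) i \<cdot>\<^sub>v (qs @ [q]) ! i"
        using qs(1,4) Aq by (auto simp: nth_append less_Suc_eq)
    next
      fix v :: "real vec" assume v: "v \<in> carrier_vec d"
      show "(\<forall>q\<in>set (qs @ [q]). q \<bullet> v = 0) \<longleftrightarrow> (\<forall>i<Suc k. col P i \<bullet> v = 0)"
        using qs(5)[OF v] w(3)[OF v] qv[OF v] nw by (auto simp: less_Suc_eq)
    qed (use qs q in auto)
  qed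
  from this[of d] show thesis using that by (metis order_refl)
qed

text \<open>A square matrix with orthonormal columns also has orthonormal rows.\<close>

lemma orthonormal_family_total:
  fixes v :: "real vec"
  assumes "length qs = d" "set qs \<subseteq> carrier_vec d"
    and "\<And>i j. i < d \<Longrightarrow> j < d \<Longrightarrow> qs ! i \<bullet> qs ! j = (if i = j then 1 else 0)"
    and v: "v \<in> carrier_vec d"
  shows "v \<bullet> v = (\<Sum>i<d. (qs ! i \<bullet> v)\<^sup>2)"
proof -
  define Q where "Q = mat_of_cols d qs"
  have Q: "Q \<in> carrier_mat d d" using assms(1) by (auto simp: Q_def)
  have QT: "Q\<^sup>T \<in> carrier_mat d d" using Q by auto
  have col: "col Q i = qs ! i" if "i < d" for i
    unfolding Q_def by (rule col_mat_of_cols) (use assms that in \<open>auto simp: subset_iff\<close>)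
  have "Q\<^sup>T * Q = 1\<^sub>m d"
    by (intro eq_matI) (use Q assms(3) col in auto)
  hence "Q * Q\<^sup>T = 1\<^sub>m d" by (rule mat_mult_left_right_inverse[OF QT Q])
  hence "v = Q *\<^sub>v (Q\<^sup>T *\<^sub>v v)" using Q QT v by (metis assoc_mult_mat_vec one_mult_mat_vec)
  hence "v \<bullet> v = (Q *\<^sub>v (Q\<^sup>T *\<^sub>v v)) \<bullet> v" by simp
  also have "\<dots> = (Q\<^sup>T *\<^sub>v v) \<bullet> (Q\<^sup>T *\<^sub>v v)"
    by (rule transpose_scalar_prod[OF Q]) (use Q QT v in auto)
  also have "\<dots> = (\<Sum>i<d. (qs ! i \<bullet> v)\<^sup>2)"
    using Q col by (auto simp: scalar_prod_def[of "Q\<^sup>T *\<^sub>v v"] power2_eq_square atLeast0LessThan intro!: sum.cong)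
  finally show ?thesis .
qed

section \<open>Relevant eigenvalues and the norm of the matrix on vectors they carry\<close>

lemma eigenspace_eq:
  assumes "A \<in> carrier_mat d d"
  shows "eigenspace A l = {v \<in> carrier_vec d. A *\<^sub>v v = l \<cdot>\<^sub>v v}"
proof -
  have "(A - l \<cdot>\<^sub>m 1\<^sub>m d) *\<^sub>v v = 0\<^sub>v d \<longleftrightarrow> A *\<^sub>v v = l \<cdot>\<^sub>v v" if v: "v \<in> carrier_vec d" for v
  proof -
    have "(A - l \<cdot>\<^sub>m 1\<^sub>m d) *\<^sub>v v = A *\<^sub>v v - (l \<cdot>\<^sub>m 1\<^sub>m d) *\<^sub>v v"
      by (rule minus_mult_distrib_mat_vec[of _ d d]) (use assms v in auto)
    also have "(l \<cdot>\<^sub>m 1\<^sub>m d) *\<^sub>v v = l \<cdot>\<^sub>v v"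
      using v by (intro eq_vecI) auto
    finally show ?thesis using assms v by (auto simp: vec_eq_iff)
  qed
  thus ?thesis using assms by (auto simp: mat_kernel_def)
qed

text \<open>The hypothesis on the relevant part of the Hessian quantifies over all eigenbasis matrices and would
  be void without one. The members of a full orthonormal eigenbasis that belong to \<open>\<Lambda>\<close> form such a
  matrix: an eigenvector to an eigenvalue in \<open>\<Lambda>\<close> is orthogonal to all the other members.\<close>

lemma eigenbasis_mat_exists:
  fixes A :: "real mat"
  assumes A: "A \<in> carrier_mat d d" "A\<^sup>T = A"
  obtains U where "eigenbasis_mat A \<Lambda> U"
proof -
  interpret vec_space "TYPE(real)" d .
  obtain qs ls where qs: "length qs = d" "set qs \<subseteq> carrier_vec d"
    "\<And>i j. i < d \<Longrightarrow> j < d \<Longrightarrow> qs ! i \<bullet> qs ! j = (if i = j then 1 else 0)"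
    "\<And>i. i < d \<Longrightarrow> A *\<^sub>v (qs ! i) = ls i \<cdot>\<^sub>v (qs ! i)"
    using symmetric_orthonormal_eigenvectors[OF A] by metis
  have qc: "qs ! i \<in> carrier_vec d" if "i < d" for i using qs(1,2) that by (auto simp: subset_iff)
  define ks where "ks = filter (\<lambda>i. ls i \<in> \<Lambda>) [0..<d]"
  define U where "U = mat_of_cols d (map ((!) qs) ks)"
  have ks: "distinct ks" "set ks = {i. i < d \<and> ls i \<in> \<Lambda>}" by (auto simp: ks_def)
  have ksn: "ks ! a < d" "ls (ks ! a) \<in> \<Lambda>" if "a < length ks" for a
    using ks(2) nth_mem[OF that] by auto
  have dimU: "dim_row U = d" "dim_col U = length ks" by (auto simp: U_def)
  hence U: "U \<in> carrier_mat d (length ks)" by auto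
  have colU: "col U a = qs ! (ks ! a)" if "a < length ks" for a
    unfolding U_def using that qc ksn by (subst col_mat_of_cols) auto
  have colsU: "set (cols U) \<subseteq> carrier_vec d" using U cols_dim by blast
  have UTU: "U\<^sup>T * U = 1\<^sub>m (dim_col U)"
  proof (rule eq_matI)
    fix a b assume "a < dim_row (1\<^sub>m (dim_col U))" "b < dim_col (1\<^sub>m (dim_col U))"
    thus "(U\<^sup>T * U) $$ (a, b) = 1\<^sub>m (dim_col U) $$ (a, b)"
      using dimU ksn ks(1) by (auto simp: colU qs(3) nth_eq_iff_index_eq)
  qed auto
  have eig: "eigenvector A (col U a) (ls (ks ! a))" if "a < length ks" for a
  proof -
    have "qs ! (ks ! a) \<bullet> qs ! (ks ! a) = 1" using qs(3) ksn[OF that] by simp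
    hence "qs ! (ks ! a) \<noteq> 0\<^sub>v d" by auto
    thus ?thesis unfolding eigenvector_def colU[OF that]
      using qs(4)[OF ksn(1)[OF that]] qc[OF ksn(1)[OF that]] A(1) by auto
  qed
  have span_eq: "span (set (cols U)) = span (\<Union>l\<in>\<Lambda>. eigenspace A l)"
  proof
    have sub: "(\<Union>l\<in>\<Lambda>. eigenspace A l) \<subseteq> carrier_vec d" by (auto simp: eigenspace_eq[OF A(1)])
    have "set (cols U) \<subseteq> (\<Union>l\<in>\<Lambda>. eigenspace A l)"
    proof
      fix u assume "u \<in> set (cols U)"
      then obtain a where a: "a < length ks" "u = col U a"
        using dimU by (auto simp: cols_def)
      hence "u \<in> eigenspace A (ls (ks ! a))"
        using eig[OF a(1)] A(1) by (auto simp: eigenspace_eq[OF A(1)] eigenvector_def)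
      thus "u \<in> (\<Union>l\<in>\<Lambda>. eigenspace A l)" using ksn(2)[OF a(1)] by auto
    qed
    thus "span (set (cols U)) \<subseteq> span (\<Union>l\<in>\<Lambda>. eigenspace A l)" by (rule span_is_monotone)
    show "span (\<Union>l\<in>\<Lambda>. eigenspace A l) \<subseteq> span (set (cols U))"
    proof (rule span_subsetI[OF colsU], rule subsetI)
      fix v assume "v \<in> (\<Union>l\<in>\<Lambda>. eigenspace A l)"
      then obtain l where l: "l \<in> \<Lambda>" and v: "v \<in> carrier_vec d" "A *\<^sub>v v = l \<cdot>\<^sub>v v"
        by (auto simp: eigenspace_eq[OF A(1)])
      define y where "y = U\<^sup>T *\<^sub>v v"
      have y: "y \<in> carrier_vec (length ks)" using U v by (auto simp: y_def)
      have Uy: "U *\<^sub>v y \<in> carrier_vec d" using U y by auto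
      have q_Uy: "qs ! i \<bullet> (v - U *\<^sub>v y) = 0" if i: "i < d" for i
      proof -
        have "qs ! i \<bullet> (U *\<^sub>v y) = (U *\<^sub>v y) \<bullet> qs ! i"
          by (rule comm_scalar_prod[OF qc[OF i] Uy])
        also have "\<dots> = y \<bullet> (U\<^sup>T *\<^sub>v (qs ! i))" by (rule transpose_scalar_prod[OF U y qc[OF i]])
        also have "\<dots> = (\<Sum>a=0..<length ks. y $ a * (qs ! (ks ! a) \<bullet> qs ! i))"
          using U by (auto simp: scalar_prod_def[of y] colU intro!: sum.cong)
        also have "\<dots> = qs ! i \<bullet> v"
        proof (cases "ls i \<in> \<Lambda>")
          case True
          then obtain a where a: "a < length ks" "ks ! a = i"
            using ks(2) i by (metis (mono_tags, lifting) in_set_conv_nth mem_Collect_eq)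
          have "(\<Sum>b=0..<length ks. y $ b * (qs ! (ks ! b) \<bullet> qs ! i)) =
              (\<Sum>b=0..<length ks. if b = a then y $ a else 0)"
            using a ks(1) ksn i by (intro sum.cong) (auto simp: qs(3) nth_eq_iff_index_eq)
          also have "\<dots> = y $ a" using a by simp
          also have "\<dots> = qs ! i \<bullet> v" using a U by (simp add: y_def colU)
          finally show ?thesis .
        next
          case False
          hence "l \<noteq> ls i" using l by auto
          moreover have "ls i * (qs ! i \<bullet> v) = l * (qs ! i \<bullet> v)"
            using symmetric_scalar_prod[OF A qc[OF i] v(1)] qs(4)[OF i] v qc[OF i] by simp
          ultimately have "qs ! i \<bullet> v = 0" by simp
          moreover have "(\<Sum>a=0..<length ks. y $ a * (qs ! (ks ! a) \<bullet> qs ! i)) = 0"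
            using False ksn i by (intro sum.neutral) (auto simp: qs(3))
          ultimately show ?thesis by simp
        qed
        finally show ?thesis
          using qc[OF i] v Uy by (simp add: scalar_prod_minus_distrib[of _ d])
      qed
      have vU: "v - U *\<^sub>v y \<in> carrier_vec d" using v Uy by auto
      have "(v - U *\<^sub>v y) \<bullet> (v - U *\<^sub>v y) = 0"
        using orthonormal_family_total[OF qs(1-3) vU] q_Uy by simp
      hence "v - U *\<^sub>v y = 0\<^sub>v d" using scalar_prod_self_eq_0_iff[OF vU] by simp
      hence "v = U *\<^sub>v y" using v Uy by (auto simp: vec_eq_iff)
      thus "v \<in> span (set (cols U))"
        using col_space_eq[OF U] U y Uy unfolding col_space_def by auto
    qed
  qed
  have "eigenbasis_mat A \<Lambda> U"
    unfolding eigenbasis_mat_def using dimU A(1) UTU eig ksn(2) span_eq by auto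
  thus thesis by (rule that)
qed

text \<open>An eigenvector in the column space of \<open>U\<close> is carried by \<open>U\<^sup>T\<close> to an eigenvector of the compressed
  matrix, with the same eigenvalue.\<close>

lemma eigenvalue_abs_le_spectral_norm_compression:
  fixes A :: "real mat"
  assumes A: "A \<in> carrier_mat d d" "A\<^sup>T = A" and U: "eigenbasis_mat A \<Lambda> U"
    and l: "l \<in> \<Lambda>" "eigenvalue A l"
  shows "\<bar>l\<bar> \<le> spectral_norm (U\<^sup>T * A * U)"
proof -
  interpret vec_space "TYPE(real)" d .
  define k where "k = dim_col U"
  have Uc: "U \<in> carrier_mat d k" and UTU: "U\<^sup>T * U = 1\<^sub>m k"
    and sp: "span (set (cols U)) = span (\<Union>l\<in>\<Lambda>. eigenspace A l)"
    using U A(1) unfolding eigenbasis_mat_def k_def by auto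
  have UT: "U\<^sup>T \<in> carrier_mat k d" using Uc by simp
  let ?M = "U\<^sup>T * A * U"
  have M: "?M \<in> carrier_mat k k" by (rule mult_carrier_mat[OF mult_carrier_mat[OF UT A(1)] Uc])
  obtain v where v: "v \<in> carrier_vec d" "v \<noteq> 0\<^sub>v d" "A *\<^sub>v v = l \<cdot>\<^sub>v v"
    using l(2) A(1) unfolding eigenvalue_def eigenvector_def by auto
  have "v \<in> span (\<Union>l\<in>\<Lambda>. eigenspace A l)"
    by (rule span_mem) (use v l in \<open>auto simp: eigenspace_eq[OF A(1)]\<close>)
  then obtain y where y: "y \<in> carrier_vec k" "v = U *\<^sub>v y"
    using col_space_eq[OF Uc] unfolding col_space_def sp by (auto simp: k_def)
  have UTv: "U\<^sup>T *\<^sub>v v = y"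
    unfolding y(2) using assoc_mult_mat_vec[OF UT Uc y(1)] UTU y(1) by simp
  have "?M *\<^sub>v y = U\<^sup>T *\<^sub>v (A *\<^sub>v v)"
    unfolding y(2) using assoc_mult_mat_vec[OF mult_carrier_mat[OF UT A(1)] Uc y(1)]
      assoc_mult_mat_vec[OF UT A(1), of "U *\<^sub>v y"] Uc y(1) by simp
  also have "\<dots> = l \<cdot>\<^sub>v y" unfolding v(3) using mult_mat_vec[OF UT v(1)] UTv by simp
  finally have "\<bar>l\<bar> * vnorm y \<le> spectral_norm ?M * vnorm y"
    using vnorm_mult_mat_vec_le_spectral_norm[OF M y(1)] by (simp add: vnorm_smult)
  moreover have "y \<noteq> 0\<^sub>v k"
    using v(2) Uc unfolding y(2) by auto
  hence "vnorm y > 0" using vnorm_eq_0_iff[OF y(1)] vnorm_nonneg[of y] by linarith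
  ultimately show ?thesis by simp
qed

text \<open>In an orthonormal eigenbasis the coordinates of \<open>v\<close> vanish except at relevant eigenvalues, and each
  of these is at most \<open>L\<close> in absolute value. The hypothesis on \<open>v\<close> is the property that Krylov vectors
  inherit from \<open>g\<close>.\<close>

lemma vnorm_mult_mat_vec_le_relevant:
  fixes A :: "real mat"
  assumes A: "A \<in> carrier_mat d d" "A\<^sup>T = A" and L: "0 \<le> L"
    and bd: "\<And>U. is_U A g U \<Longrightarrow> spectral_norm (U\<^sup>T * A * U) \<le> L"
    and v: "v \<in> carrier_vec d"
    and orth: "\<And>l u. l \<notin> relevant A g \<Longrightarrow> u \<in> eigenspace A l \<Longrightarrow> u \<bullet> v = 0"
  shows "vnorm (A *\<^sub>v v) \<le> L * vnorm v"
proof -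
  obtain qs ls where qs: "length qs = d" "set qs \<subseteq> carrier_vec d"
    "\<And>i j. i < d \<Longrightarrow> j < d \<Longrightarrow> qs ! i \<bullet> qs ! j = (if i = j then 1 else 0)"
    "\<And>i. i < d \<Longrightarrow> A *\<^sub>v (qs ! i) = ls i \<cdot>\<^sub>v (qs ! i)"
    using symmetric_orthonormal_eigenvectors[OF A] by metis
  have qc: "qs ! i \<in> carrier_vec d" if "i < d" for i using qs(1,2) that by (auto simp: subset_iff)
  obtain U where U: "eigenbasis_mat A {l \<in> relevant A g. l \<noteq> 0} U"
    using eigenbasis_mat_exists[OF A] by blast
  have le: "\<bar>l\<bar> \<le> L" if "l \<in> relevant A g" for l
  proof (cases "l = 0")
    case False
    have "\<bar>l\<bar> \<le> spectral_norm (U\<^sup>T * A * U)"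
      by (rule eigenvalue_abs_le_spectral_norm_compression[OF A U])
        (use that False in \<open>auto simp: relevant_def\<close>)
    also have "\<dots> \<le> L" by (rule bd) (use U in \<open>simp add: is_U_def\<close>)
    finally show ?thesis .
  qed (use L in simp)
  have Av: "A *\<^sub>v v \<in> carrier_vec d" using A v by auto
  have "(A *\<^sub>v v) \<bullet> (A *\<^sub>v v) = (\<Sum>i<d. (qs ! i \<bullet> (A *\<^sub>v v))\<^sup>2)"
    by (rule orthonormal_family_total[OF qs(1-3) Av])
  also have "\<dots> \<le> (\<Sum>i<d. L\<^sup>2 * (qs ! i \<bullet> v)\<^sup>2)"
  proof (rule sum_mono)
    fix i assume "i \<in> {..<d}"
    hence i: "i < d" by simp
    have eq: "qs ! i \<bullet> (A *\<^sub>v v) = ls i * (qs ! i \<bullet> v)"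
      using symmetric_scalar_prod[OF A qc[OF i] v] qs(4)[OF i] qc[OF i] v by simp
    show "(qs ! i \<bullet> (A *\<^sub>v v))\<^sup>2 \<le> L\<^sup>2 * (qs ! i \<bullet> v)\<^sup>2"
    proof (cases "ls i \<in> relevant A g")
      case True
      have "(ls i)\<^sup>2 \<le> L\<^sup>2" using power_mono[OF le[OF True], of 2] by simp
      thus ?thesis unfolding eq by (simp add: power_mult_distrib mult_right_mono)
    next
      case False
      hence "qs ! i \<bullet> v = 0"
        by (rule orth) (use qc[OF i] qs(4)[OF i] in \<open>auto simp: eigenspace_eq[OF A(1)]\<close>)
      thus ?thesis unfolding eq by simp
    qed
  qed
  also have "\<dots> = L\<^sup>2 * (v \<bullet> v)"
    using orthonormal_family_total[OF qs(1-3) v] by (simp add: sum_distrib_left)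
  finally have "(vnorm (A *\<^sub>v v))\<^sup>2 \<le> (L * vnorm v)\<^sup>2"
    by (simp add: vnorm_square power_mult_distrib)
  thus ?thesis by (rule power2_le_imp_le) (use L in simp)
qed

lemma mult_mat_zero_vec: "A \<in> carrier_mat m n \<Longrightarrow> A *\<^sub>v 0\<^sub>v n = (0\<^sub>v m :: real vec)"
  by (intro eq_vecI) auto

section \<open>Krylov subspaces and their grade\<close>

context
  fixes d :: nat and H :: "real mat" and g :: "real vec"
  assumes H: "H \<in> carrier_mat d d" and g: "g \<in> carrier_vec d"
begin

interpretation vec_space "TYPE(real)" d .

lemma pow_mat_vec_carrier: "(H ^\<^sub>m i) *\<^sub>v g \<in> carrier_vec d"
  by (rule mult_mat_vec_carrier[OF pow_carrier_mat[OF H] g])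

lemma mult_pow_mat_vec: "H *\<^sub>v ((H ^\<^sub>m i) *\<^sub>v g) = (H ^\<^sub>m Suc i) *\<^sub>v g"
proof -
  have "H * H ^\<^sub>m i = H ^\<^sub>m i * H"
  proof (induction i)
    case (Suc i)
    have "H * (H ^\<^sub>m i * H) = (H * H ^\<^sub>m i) * H"
      using H by (simp add: assoc_mult_mat[of _ d d _ d _ d])
    thus ?case using Suc by simp
  qed (use H in auto)
  thus ?thesis
    using H g by (metis assoc_mult_mat_vec pow_carrier_mat pow_mat.simps(2))
qed

lemma krylov_eq_span: "krylov H g t = span {(H ^\<^sub>m i) *\<^sub>v g | i. i < t}"
  using g by (simp add: krylov_def)

lemma krylov_generators_carrier: "{(H ^\<^sub>m i) *\<^sub>v g | i. i < t} \<subseteq> carrier_vec d"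
  using pow_mat_vec_carrier by auto

lemma krylov_carrier: "krylov H g t \<subseteq> carrier_vec d"
  unfolding krylov_eq_span using span_is_subset2[OF krylov_generators_carrier] by simp

lemma krylov_add: "u \<in> krylov H g t \<Longrightarrow> v \<in> krylov H g t \<Longrightarrow> u + v \<in> krylov H g t"
  unfolding krylov_eq_span by (rule span_add1[OF krylov_generators_carrier])

lemma krylov_smult: "v \<in> krylov H g t \<Longrightarrow> c \<cdot>\<^sub>v v \<in> krylov H g t"
  unfolding krylov_eq_span by (rule smult_in_span[OF krylov_generators_carrier])

lemma krylov_diff:
  assumes "u \<in> krylov H g t" "v \<in> krylov H g t"
  shows "u - v \<in> krylov H g t"
proof -
  have "u - v = u + (-1) \<cdot>\<^sub>v v" using assms krylov_carrier by (intro eq_vecI) auto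
  thus ?thesis using krylov_add[OF assms(1) krylov_smult[OF assms(2), of "-1"]] by simp
qed

lemma krylov_mono: "t \<le> t' \<Longrightarrow> krylov H g t \<subseteq> krylov H g t'"
  unfolding krylov_eq_span by (intro span_is_monotone) auto

lemma krylov_0: "krylov H g 0 = {0\<^sub>v d}"
  unfolding krylov_eq_span using span_empty by simp

lemma krylov_as_lists: "krylov H g t = span_list (map (\<lambda>i. (H ^\<^sub>m i) *\<^sub>v g) [0..<t])"
proof -
  have "{(H ^\<^sub>m i) *\<^sub>v g | i. i < t} = set (map (\<lambda>i. (H ^\<^sub>m i) *\<^sub>v g) [0..<t])" by auto
  thus ?thesis
    using span_list_as_span[of "map (\<lambda>i. (H ^\<^sub>m i) *\<^sub>v g) [0..<t]"] krylov_generators_carrier[of t]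
    unfolding krylov_eq_span by simp
qed

text \<open>Coefficient lists make it possible to split off the last generator, even if it already lies in the
  span of the others.\<close>

lemma krylov_Suc: "krylov H g (Suc t) = {u + c \<cdot>\<^sub>v ((H ^\<^sub>m t) *\<^sub>v g) | u c. u \<in> krylov H g t}"
proof -
  let ?w = "\<lambda>c t. lincomb_list c (map (\<lambda>i. (H ^\<^sub>m i) *\<^sub>v g) [0..<t])"
  have w: "?w c n = sumlist (map (\<lambda>i. c i \<cdot>\<^sub>v ((H ^\<^sub>m i) *\<^sub>v g)) [0..<n])" for c n
    unfolding lincomb_list_def by (intro arg_cong[of _ _ sumlist]) auto
  have wS: "?w c (Suc t) = ?w c t + c t \<cdot>\<^sub>v ((H ^\<^sub>m t) *\<^sub>v g)" for c
  proof -
    have "?w c (Suc t) = sumlist (map (\<lambda>i. c i \<cdot>\<^sub>v ((H ^\<^sub>m i) *\<^sub>v g)) [0..<t]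
        @ [c t \<cdot>\<^sub>v ((H ^\<^sub>m t) *\<^sub>v g)])"
      unfolding w by simp
    also have "\<dots> = ?w c t + sumlist [c t \<cdot>\<^sub>v ((H ^\<^sub>m t) *\<^sub>v g)]"
      unfolding w using pow_mat_vec_carrier by (intro sumlist_append) auto
    finally show ?thesis using pow_mat_vec_carrier by simp
  qed
  have wcong: "?w (c(t := e)) t = ?w c t" for c e
    unfolding w by (intro arg_cong[of _ _ sumlist]) auto
  show ?thesis
  proof (intro equalityI subsetI)
    fix v assume "v \<in> krylov H g (Suc t)"
    then obtain c where "v = ?w c (Suc t)" unfolding krylov_as_lists span_list_def by auto
    thus "v \<in> {u + c \<cdot>\<^sub>v ((H ^\<^sub>m t) *\<^sub>v g) | u c. u \<in> krylov H g t}"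
      unfolding krylov_as_lists span_list_def using wS by auto
  next
    fix v assume "v \<in> {u + c \<cdot>\<^sub>v ((H ^\<^sub>m t) *\<^sub>v g) | u c. u \<in> krylov H g t}"
    then obtain c e where "v = ?w c t + e \<cdot>\<^sub>v ((H ^\<^sub>m t) *\<^sub>v g)"
      unfolding krylov_as_lists span_list_def by auto
    hence "v = ?w (c(t := e)) (Suc t)" unfolding wS wcong by simp
    thus "v \<in> krylov H g (Suc t)" unfolding krylov_as_lists span_list_def by auto
  qed
qed

lemma gradient_in_krylov: "g \<in> krylov H g (Suc t)"
proof -
  have "(H ^\<^sub>m 0) *\<^sub>v g \<in> krylov H g (Suc t)"
    unfolding krylov_eq_span by (rule span_mem[OF krylov_generators_carrier]) blast
  thus ?thesis using H g by simp
qed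

lemma zero_in_krylov: "0\<^sub>v d \<in> krylov H g t"
  using krylov_mono[of 0 t] krylov_0 by auto

lemma mult_mat_vec_in_krylov:
  "u \<in> krylov H g t \<Longrightarrow> H *\<^sub>v u \<in> krylov H g (Suc t)"
proof (induction t arbitrary: u)
  case 0
  hence "H *\<^sub>v u = 0\<^sub>v d" using mult_mat_zero_vec[OF H] unfolding krylov_0 by simp
  thus ?case using zero_in_krylov by simp
next
  case (Suc t)
  then obtain v c where v: "v \<in> krylov H g t" "u = v + c \<cdot>\<^sub>v ((H ^\<^sub>m t) *\<^sub>v g)"
    unfolding krylov_Suc by auto
  have vc: "v \<in> carrier_vec d" using v krylov_carrier by auto
  have "H *\<^sub>v u = H *\<^sub>v v + c \<cdot>\<^sub>v ((H ^\<^sub>m Suc t) *\<^sub>v g)"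
    unfolding v(2) using H vc pow_mat_vec_carrier
    by (simp add: mult_add_distrib_mat_vec[of _ d d] mult_mat_vec[of _ d d] mult_pow_mat_vec
        del: pow_mat.simps)
  thus ?case using Suc.IH[OF v(1)] unfolding krylov_Suc[of "Suc t"] by blast
qed

lemma orthogonal_eigenvector_krylov:
  assumes "H\<^sup>T = H" "u \<in> carrier_vec d" "H *\<^sub>v u = l \<cdot>\<^sub>v u" "u \<bullet> g = 0" "v \<in> krylov H g t"
  shows "u \<bullet> v = 0"
  using assms(5)
proof (induction t arbitrary: v)
  case 0
  thus ?case using krylov_0 assms(2) by auto
next
  case (Suc t)
  have pow: "u \<bullet> ((H ^\<^sub>m i) *\<^sub>v g) = 0" for i
  proof (induction i)
    case 0
    thus ?case using H g assms(4) by simp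
  next
    case (Suc i)
    have "u \<bullet> (H *\<^sub>v ((H ^\<^sub>m i) *\<^sub>v g)) = (H *\<^sub>v u) \<bullet> ((H ^\<^sub>m i) *\<^sub>v g)"
      by (rule symmetric_scalar_prod[OF H assms(1,2) pow_mat_vec_carrier, symmetric])
    also have "\<dots> = 0" unfolding assms(3) using Suc assms(2) pow_mat_vec_carrier by simp
    finally show ?case unfolding mult_pow_mat_vec .
  qed
  obtain w c where "w \<in> krylov H g t" "v = w + c \<cdot>\<^sub>v ((H ^\<^sub>m t) *\<^sub>v g)"
    using Suc.prems unfolding krylov_Suc by auto
  thus ?case using Suc.IH pow assms(2) krylov_carrier pow_mat_vec_carrier
    by (auto simp: scalar_prod_add_distrib[of _ d] subset_iff)
qed

text \<open>The grade is the first power of the matrix whose image of the vector is spanned by the earlier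
  ones; from there on the Krylov spaces are constant. The second property is how the grade is compared
  with the number of MINRES iterations.\<close>

lemma grade_exists:
  obtains m where "is_grade H g m"
    "\<And>t. (\<And>j. j < t \<Longrightarrow> (H ^\<^sub>m j) *\<^sub>v g \<notin> krylov H g j) \<Longrightarrow> t \<le> m"
proof -
  let ?h = "\<lambda>i. (H ^\<^sub>m i) *\<^sub>v g"
  let ?G = "\<lambda>t. {?h i | i. i < t}"
  have G_Suc: "?G (Suc t) = insert (?h t) (?G t)" for t by (auto simp: less_Suc_eq)
  have fin: "finite (?G t)" for t by simp
  have indep: "lin_indpt (?G t) \<and> card (?G t) = t" if "\<forall>j<t. ?h j \<notin> krylov H g j" for t
    using that
  proof (induction t)
    case 0
    show ?case using finite_lin_indpt2[of "{}"] by auto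
  next
    case (Suc t)
    have IH: "lin_indpt (?G t)" "card (?G t) = t" using Suc by auto
    have ns: "?h t \<notin> span (?G t)" using Suc.prems unfolding krylov_eq_span by auto
    have nG: "?h t \<notin> ?G t" using ns span_mem[OF krylov_generators_carrier] by blast
    have "\<not> lin_dep (?G t \<union> {?h t})"
      using lin_dep_iff_in_span[of "?G t" "?h t"] IH(1) ns nG pow_mat_vec_carrier
        krylov_generators_carrier by auto
    thus ?case unfolding G_Suc using nG IH(2) fin by simp
  qed
  have ex: "\<exists>k. ?h k \<in> krylov H g k"
  proof (rule ccontr)
    assume "\<not> ?thesis"
    hence "lin_indpt (?G (Suc d))" "card (?G (Suc d)) = Suc d" using indep[of "Suc d"] by auto
    thus False using li_le_dim(2)[OF fin_dim _ , of "?G (Suc d)"] krylov_generators_carrier dim_is_n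
      by auto
  qed
  define m where "m = (LEAST k. ?h k \<in> krylov H g k)"
  have m: "?h m \<in> krylov H g m" unfolding m_def by (rule LeastI_ex[OF ex])
  have least: "?h j \<notin> krylov H g j" if "j < m" for j
    using not_less_Least[of j "\<lambda>k. ?h k \<in> krylov H g k"] that unfolding m_def by auto
  have const: "krylov H g (m + n) = krylov H g m \<and> ?h (m + n) \<in> krylov H g m" for n
  proof (induction n)
    case 0
    show ?case using m by simp
  next
    case (Suc n)
    have sub: "krylov H g (Suc (m + n)) \<subseteq> krylov H g m"
      unfolding krylov_Suc using Suc by (auto intro!: krylov_add krylov_smult)
    have "?h (m + Suc n) \<in> krylov H g (Suc (m + n))"
      using mult_mat_vec_in_krylov[of "?h (m + n)" "m + n"] Suc mult_pow_mat_vec[of "m + n"] by auto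
    thus ?case using sub krylov_mono[of m "m + Suc n"] by auto
  qed
  have dim: "subspace_dim d (krylov H g t) = t" if "t \<le> m" for t
  proof -
    have "lin_indpt (?G t) \<and> card (?G t) = t" using indep[of t] least that by auto
    moreover have "maximal (?G t) (\<lambda>T. T \<subseteq> ?G t \<and> lin_indpt T)"
      using calculation by (auto simp: maximal_def)
    ultimately show ?thesis
      using dim_span[OF _ fin[of t], of "?G t"] krylov_generators_carrier[of t]
      unfolding krylov_eq_span by auto
  qed
  have "is_grade H g m"
    unfolding is_grade_def
  proof (intro allI impI)
    fix t :: nat
    show "subspace_dim (dim_vec g) (krylov H g t) = min t m"
    proof (cases "t \<le> m")
      case True
      thus ?thesis using dim g by simp
    next
      case False
      hence "krylov H g t = krylov H g m" using const[of "t - m"] by simp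
      thus ?thesis using dim[of m] g False by simp
    qed
  qed
  moreover have "t \<le> m" if "\<And>j. j < t \<Longrightarrow> ?h j \<notin> krylov H g j" for t
    using that[of m] m by (meson not_le)
  ultimately show thesis by (rule that)
qed

end

section \<open>MINRES before nonpositive curvature\<close>

lemma vnorm_add_square_orthogonal:
  assumes "v \<in> carrier_vec d" "w \<in> carrier_vec d" "v \<bullet> w = 0"
  shows "(vnorm (v + w))\<^sup>2 = (vnorm v)\<^sup>2 + (vnorm w)\<^sup>2"
  using assms
  by (simp add: vnorm_square scalar_prod_add_distrib[of _ d] add_scalar_prod_distrib[of _ d]
      comm_scalar_prod[of w d v])

context
  fixes d :: nat and H :: "real mat" and g :: "real vec"
  assumes H: "H \<in> carrier_mat d d" and sym: "H\<^sup>T = H" and g: "g \<in> carrier_vec d"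
begin

abbreviation (input) kry :: "nat \<Rightarrow> real vec set" where "kry t \<equiv> krylov H g t"
abbreviation (input) res :: "nat \<Rightarrow> real vec" where "res t \<equiv> minres_residual H g t"
abbreviation (input) itr :: "nat \<Rightarrow> real vec" where "itr t \<equiv> minres_iterate H g t"

lemmas krylov_memD = krylov_carrier[OF H g, THEN subsetD]

lemma mult_carrier: "v \<in> carrier_vec d \<Longrightarrow> H *\<^sub>v v \<in> carrier_vec d"
  using H by simp

lemma mult_add: "u \<in> carrier_vec d \<Longrightarrow> v \<in> carrier_vec d \<Longrightarrow> H *\<^sub>v (u + v) = H *\<^sub>v u + H *\<^sub>v v"
  by (rule mult_add_distrib_mat_vec[OF H])

lemma mult_diff: "u \<in> carrier_vec d \<Longrightarrow> v \<in> carrier_vec d \<Longrightarrow> H *\<^sub>v (u - v) = H *\<^sub>v u - H *\<^sub>v v"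
  by (rule mult_minus_distrib_mat_vec[OF H])

lemma mult_smult: "v \<in> carrier_vec d \<Longrightarrow> H *\<^sub>v (c \<cdot>\<^sub>v v) = c \<cdot>\<^sub>v (H *\<^sub>v v)"
  by (rule mult_mat_vec[OF H])

lemmas mult_linear = mult_add mult_diff mult_smult mult_carrier
lemmas scalar_prod_linear = scalar_prod_add_distrib[of _ d] add_scalar_prod_distrib[of _ d]
  scalar_prod_minus_distrib[of _ d] minus_scalar_prod_distrib[of _ d]

text \<open>The least-squares characterisation of a minimiser: its residual is orthogonal to the image of the
  Krylov space.\<close>

lemma residual_norm_expansion: 
  assumes "s \<in> kry t" "u \<in> kry t" "\<And>v. v \<in> kry t \<Longrightarrow> (- g - H *\<^sub>v s) \<bullet> (H *\<^sub>v v) = 0"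
  shows "(vnorm (H *\<^sub>v u + g))\<^sup>2 = (vnorm (H *\<^sub>v s + g))\<^sup>2 + (vnorm (H *\<^sub>v (u - s)))\<^sup>2"
proof -
  have c: "s \<in> carrier_vec d" "u \<in> carrier_vec d" using assms krylov_memD by auto
  have us: "u - s \<in> kry t" by (rule krylov_diff[OF H g assms(2,1)])
  have usc: "u - s \<in> carrier_vec d" using c by simp
  have e: "H *\<^sub>v u + g = (H *\<^sub>v s + g) + H *\<^sub>v (u - s)"
    unfolding mult_diff[OF c(2,1)] using mult_carrier[OF c(1)] mult_carrier[OF c(2)] g H by (intro eq_vecI) auto
  have "- g - H *\<^sub>v s = (-1) \<cdot>\<^sub>v (H *\<^sub>v s + g)"
    using mult_carrier[OF c(1)] g H by (intro eq_vecI) auto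
  hence "(H *\<^sub>v s + g) \<bullet> (H *\<^sub>v (u - s)) = 0"
    using assms(3)[OF us] mult_carrier[OF c(1)] mult_carrier[OF usc] g H by simp
  thus ?thesis
    unfolding e using mult_carrier[OF c(1)] mult_carrier[OF usc] g by (intro vnorm_add_square_orthogonal) auto
qed

text \<open>Injectivity on the Krylov space makes the minimiser unique, which is when the iterate is the
  minimiser and not a copy of its predecessor.\<close>

lemma minres_iterate_eqI:
  assumes s: "s \<in> kry (Suc t)"
    and orth: "\<And>v. v \<in> kry (Suc t) \<Longrightarrow> (- g - H *\<^sub>v s) \<bullet> (H *\<^sub>v v) = 0"
    and inj: "\<And>v. v \<in> kry (Suc t) \<Longrightarrow> H *\<^sub>v v = 0\<^sub>v d \<Longrightarrow> v = 0\<^sub>v d"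
  shows "itr (Suc t) = s"
proof -
  have expand: "(vnorm (H *\<^sub>v u + g))\<^sup>2 = (vnorm (H *\<^sub>v s + g))\<^sup>2 + (vnorm (H *\<^sub>v (u - s)))\<^sup>2"
    if "u \<in> kry (Suc t)" for u
    by (rule residual_norm_expansion[OF s that]) (rule orth)
  have min: "is_minres_minimizer H g (Suc t) s"
    unfolding is_minres_minimizer_def
  proof (intro conjI ballI s)
    fix u assume "u \<in> kry (Suc t)"
    from expand[OF this]
    show "(vnorm (H *\<^sub>v s + g))\<^sup>2 \<le> (vnorm (H *\<^sub>v u + g))\<^sup>2"
      using zero_le_power2[of "vnorm (H *\<^sub>v (u - s))"] by linarith
  qed
  have uniq: "u = s" if "is_minres_minimizer H g (Suc t) u" for u
  proof -
    have u: "u \<in> kry (Suc t)" "(vnorm (H *\<^sub>v u + g))\<^sup>2 \<le> (vnorm (H *\<^sub>v s + g))\<^sup>2"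
      using that s unfolding is_minres_minimizer_def by blast+
    have c: "u \<in> carrier_vec d" "s \<in> carrier_vec d" using u s krylov_memD by auto
    have us: "u - s \<in> kry (Suc t)" by (rule krylov_diff[OF H g u(1) s])
    have "(vnorm (H *\<^sub>v (u - s)))\<^sup>2 \<le> 0" using expand[OF u(1)] u(2) by linarith
    hence "vnorm (H *\<^sub>v (u - s)) = 0" by simp
    hence "H *\<^sub>v (u - s) = 0\<^sub>v d" using vnorm_eq_0_iff[OF mult_carrier[OF krylov_memD[OF us]]] by simp
    hence "u - s = 0\<^sub>v d" by (rule inj[OF us])
    thus ?thesis using c by (auto simp: vec_eq_iff)
  qed
  have "\<exists>!s. is_minres_minimizer H g (Suc t) s" using min uniq by blast
  moreover have "(THE s. is_minres_minimizer H g (Suc t) s) = s" using min uniq by (rule the_equality)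
  ultimately show ?thesis by simp
qed

text \<open>A cone, given in dual form, that contains the residuals up to index \<open>t\<close>. The test vectors \<open>z\<close> have
  nonnegative scalar product with each of these residuals, because each is \<open>- g\<close> minus an element of
  the image of the Krylov space. The residual at \<open>t\<close> is itself a test vector, so it forms a nonnegative
  scalar product with everything in the cone, in particular with the iterate.\<close>

definition residual_cone :: "nat \<Rightarrow> real vec \<Rightarrow> bool" where
  "residual_cone t v \<longleftrightarrow> (\<forall>z\<in>carrier_vec d. (\<forall>u\<in>kry t. z \<bullet> (H *\<^sub>v u) = 0) \<and> z \<bullet> g \<le> 0 \<longrightarrow> 0 \<le> z \<bullet> v)"

definition minres_stage :: "nat \<Rightarrow> bool" where
  "minres_stage t \<longleftrightarrow> itr t \<in> kry t \<and> (\<forall>u\<in>kry t. res t \<bullet> (H *\<^sub>v u) = 0) \<and>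
     (\<forall>u\<in>kry t. H *\<^sub>v u = 0\<^sub>v d \<longrightarrow> u = 0\<^sub>v d) \<and> residual_cone t (itr t)"

text \<open>The direction \<open>p\<close> of the conjugate residual method: its image is orthogonal to the image of the
  current Krylov space, and adjoining it gives the next one.\<close>

definition search_direction :: "nat \<Rightarrow> real vec \<Rightarrow> bool" where
  "search_direction t p \<longleftrightarrow> p \<in> kry (Suc t) \<and> (\<forall>u\<in>kry t. (H *\<^sub>v p) \<bullet> (H *\<^sub>v u) = 0) \<and> residual_cone t p \<and>
     res t \<bullet> (H *\<^sub>v p) = res t \<bullet> (H *\<^sub>v res t) \<and>
     (\<forall>v\<in>kry (Suc t). \<exists>u\<in>kry t. \<exists>c. v = u + c \<cdot>\<^sub>v p)"

lemma residual_cone_mono: "residual_cone t v \<Longrightarrow> t \<le> t' \<Longrightarrow> residual_cone t' v"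
  unfolding residual_cone_def using krylov_mono[OF H g, of t t'] by blast

lemma residual_cone_add_smult:
  assumes "residual_cone t u" "residual_cone t v" "0 \<le> c" "u \<in> carrier_vec d" "v \<in> carrier_vec d"
  shows "residual_cone t (u + c \<cdot>\<^sub>v v)"
  using assms unfolding residual_cone_def by (auto simp: scalar_prod_linear)

lemma residual_eq: "res t = - g - H *\<^sub>v itr t"
  by (simp add: minres_residual_def)

lemma residual_in_krylov: "itr t \<in> kry t \<Longrightarrow> res t \<in> kry (Suc t)"
proof -
  assume s: "itr t \<in> kry t"
  have "res t = 0\<^sub>v d - g - H *\<^sub>v itr t"
    unfolding residual_eq using g mult_carrier[OF krylov_memD[OF s]] H by (intro eq_vecI) auto
  thus ?thesis
    using krylov_diff[OF H g krylov_diff[OF H g zero_in_krylov[OF H g] gradient_in_krylov[OF H g]]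
        mult_mat_vec_in_krylov[OF H g s]] by simp
qed

lemma residual_cone_residual:
  assumes s: "itr t \<in> kry t"
  shows "residual_cone t (res t)"
  unfolding residual_cone_def
proof (intro ballI impI)
  fix z :: "real vec"
  assume z: "z \<in> carrier_vec d" "(\<forall>u\<in>kry t. z \<bullet> (H *\<^sub>v u) = 0) \<and> z \<bullet> g \<le> 0"
  have "z \<bullet> res t = - (z \<bullet> g) - z \<bullet> (H *\<^sub>v itr t)"
    unfolding residual_eq using z(1) g mult_carrier[OF krylov_memD[OF s]] by (simp add: scalar_prod_linear)
  thus "0 \<le> z \<bullet> res t" using z(2) s by auto
qed

text \<open>The next iterate moves along \<open>p\<close> until the residual is orthogonal to the image of \<open>p\<close>. It keeps its
  orthogonality to the image of the smaller Krylov space because the image of \<open>p\<close> has it too. The step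
  length is positive, so the iterate stays in the residual cone.\<close>

lemma minres_stage_Suc:
  assumes st: "minres_stage t" and se: "search_direction t p" and pos: "res t \<bullet> (H *\<^sub>v res t) > 0"
  obtains a where "a > 0" "itr (Suc t) = itr t + a \<cdot>\<^sub>v p" "res (Suc t) = res t - a \<cdot>\<^sub>v (H *\<^sub>v p)"
    "minres_stage (Suc t)"
proof -
  have s: "itr t \<in> kry t" and ro: "\<And>u. u \<in> kry t \<Longrightarrow> res t \<bullet> (H *\<^sub>v u) = 0"
    and inj: "\<And>u. u \<in> kry t \<Longrightarrow> H *\<^sub>v u = 0\<^sub>v d \<Longrightarrow> u = 0\<^sub>v d" and cs: "residual_cone t (itr t)"
    using st by (auto simp: minres_stage_def)
  have p: "p \<in> kry (Suc t)" and po: "\<And>u. u \<in> kry t \<Longrightarrow> (H *\<^sub>v p) \<bullet> (H *\<^sub>v u) = 0" and cp: "residual_cone t p"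
    and rp: "res t \<bullet> (H *\<^sub>v p) = res t \<bullet> (H *\<^sub>v res t)"
    and sp: "\<And>v. v \<in> kry (Suc t) \<Longrightarrow> \<exists>u\<in>kry t. \<exists>c. v = u + c \<cdot>\<^sub>v p"
    using se by (auto simp: search_direction_def)
  have r: "res t \<in> kry (Suc t)" by (rule residual_in_krylov[OF s])
  note c = krylov_memD[OF s] krylov_memD[OF p] krylov_memD[OF r]
  note image_carrier = mult_carrier[OF c(1)] mult_carrier[OF c(2)] mult_carrier[OF c(3)]
  have "H *\<^sub>v p \<noteq> 0\<^sub>v d" using rp pos c by auto
  hence pp: "(H *\<^sub>v p) \<bullet> (H *\<^sub>v p) > 0"
    using scalar_prod_self_eq_0_iff[OF image_carrier(2)] scalar_prod_self_nonneg[of "H *\<^sub>v p"] by linarith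
  define a where "a = (res t \<bullet> (H *\<^sub>v res t)) / ((H *\<^sub>v p) \<bullet> (H *\<^sub>v p))"
  have a: "a > 0" using pos pp by (simp add: a_def)
  define s' where "s' = itr t + a \<cdot>\<^sub>v p"
  have s': "s' \<in> kry (Suc t)"
    unfolding s'_def using s p krylov_mono[OF H g, of t "Suc t"]
    by (intro krylov_add[OF H g] krylov_smult[OF H g]) auto
  have r'_eq: "- g - H *\<^sub>v s' = res t - a \<cdot>\<^sub>v (H *\<^sub>v p)"
    unfolding s'_def residual_eq using g c image_carrier by (simp add: mult_linear) (intro eq_vecI; auto)
  have orth: "(- g - H *\<^sub>v s') \<bullet> (H *\<^sub>v v) = 0" if v: "v \<in> kry (Suc t)" for v
  proof -
    obtain u e where u: "u \<in> kry t" "v = u + e \<cdot>\<^sub>v p" using sp[OF v] by auto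
    have "a * ((H *\<^sub>v p) \<bullet> (H *\<^sub>v p)) = res t \<bullet> (H *\<^sub>v p)" using pp rp by (simp add: a_def)
    thus ?thesis unfolding r'_eq u(2) using ro[OF u(1)] po[OF u(1)] c image_carrier krylov_memD[OF u(1)] mult_carrier[OF krylov_memD[OF u(1)]]
      by (simp add: mult_linear scalar_prod_linear)
  qed
  have inj': "v = 0\<^sub>v d" if v: "v \<in> kry (Suc t)" and v0: "H *\<^sub>v v = 0\<^sub>v d" for v
  proof -
    obtain u e where u: "u \<in> kry t" "v = u + e \<cdot>\<^sub>v p" using sp[OF v] by auto
    note uc = krylov_memD[OF u(1)] mult_carrier[OF krylov_memD[OF u(1)]]
    have "(H *\<^sub>v p) \<bullet> (H *\<^sub>v v) = e * ((H *\<^sub>v p) \<bullet> (H *\<^sub>v p))"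
      unfolding u(2) using po[OF u(1)] c image_carrier uc by (simp add: mult_linear scalar_prod_linear)
    hence "e = 0" using v0 pp image_carrier by simp
    hence "v = u" unfolding u(2) using uc c H by (intro eq_vecI) auto
    thus ?thesis using inj[OF u(1)] v0 by simp
  qed
  have it: "itr (Suc t) = s'" by (rule minres_iterate_eqI[OF s' orth inj'])
  have rs: "res (Suc t) = - g - H *\<^sub>v s'" unfolding residual_eq it ..
  have "residual_cone (Suc t) s'"
    unfolding s'_def using residual_cone_add_smult[OF cs cp less_imp_le[OF a] c(1,2)] by (rule residual_cone_mono) simp
  hence "minres_stage (Suc t)"
    unfolding minres_stage_def using it rs s' orth inj' by auto
  thus thesis using that a it rs r'_eq s'_def by metis
qed

text \<open>The new direction is the new residual plus the multiple of the old direction that restores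
  orthogonality of the images. Positive curvature along the new residual makes this multiple positive,
  which keeps the direction in the cone, and makes the residual a vector outside the present Krylov
  space, so that the direction spans the next one.\<close>

lemma search_direction_Suc:
  assumes st: "minres_stage t" and se: "search_direction t p" and pos: "res t \<bullet> (H *\<^sub>v res t) > 0"
    and pos': "res (Suc t) \<bullet> (H *\<^sub>v res (Suc t)) > 0"
  shows "\<exists>p. search_direction (Suc t) p"
proof -
  obtain a where a: "a > 0" "itr (Suc t) = itr t + a \<cdot>\<^sub>v p" "res (Suc t) = res t - a \<cdot>\<^sub>v (H *\<^sub>v p)"
    and st': "minres_stage (Suc t)"
    using minres_stage_Suc[OF st se pos] .
  have s': "itr (Suc t) \<in> kry (Suc t)" and ro': "\<And>u. u \<in> kry (Suc t) \<Longrightarrow> res (Suc t) \<bullet> (H *\<^sub>v u) = 0"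
    using st' by (auto simp: minres_stage_def)
  have p: "p \<in> kry (Suc t)" and po: "\<And>u. u \<in> kry t \<Longrightarrow> (H *\<^sub>v p) \<bullet> (H *\<^sub>v u) = 0" and cp: "residual_cone t p"
    and rp: "res t \<bullet> (H *\<^sub>v p) = res t \<bullet> (H *\<^sub>v res t)"
    and sp: "\<And>v. v \<in> kry (Suc t) \<Longrightarrow> \<exists>u\<in>kry t. \<exists>c. v = u + c \<cdot>\<^sub>v p"
    using se by (auto simp: search_direction_def)
  have s: "itr t \<in> kry t" using st by (simp add: minres_stage_def)
  have r: "res t \<in> kry (Suc t)" by (rule residual_in_krylov[OF s])
  have r': "res (Suc t) \<in> kry (Suc (Suc t))" by (rule residual_in_krylov[OF s'])
  have p': "p \<in> kry (Suc (Suc t))" using p krylov_mono[OF H g, of "Suc t" "Suc (Suc t)"] by auto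
  note c = krylov_memD[OF p] krylov_memD[OF r] krylov_memD[OF r']
  note image_carrier = mult_carrier[OF c(1)] mult_carrier[OF c(2)] mult_carrier[OF c(3)]
  have "H *\<^sub>v p \<noteq> 0\<^sub>v d" using rp pos c by auto
  hence pp: "(H *\<^sub>v p) \<bullet> (H *\<^sub>v p) > 0"
    using scalar_prod_self_eq_0_iff[OF image_carrier(1)] scalar_prod_self_nonneg[of "H *\<^sub>v p"] by linarith
  define b where "b = (res (Suc t) \<bullet> (H *\<^sub>v res (Suc t))) / (a * ((H *\<^sub>v p) \<bullet> (H *\<^sub>v p)))"
  have b: "b > 0" using pos' pp a by (simp add: b_def)
  define q where "q = res (Suc t) + b \<cdot>\<^sub>v p"
  have q: "q \<in> kry (Suc (Suc t))"
    unfolding q_def using r' p' by (intro krylov_add[OF H g] krylov_smult[OF H g])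
  have qc: "q \<in> carrier_vec d" by (rule krylov_memD[OF q])
  have Hq: "H *\<^sub>v q = H *\<^sub>v res (Suc t) + b \<cdot>\<^sub>v (H *\<^sub>v p)"
    unfolding q_def using c by (simp add: mult_linear)
  \<comment> \<open>Since \<open>a\<close> times the image of \<open>p\<close> is the last change of the residual, its product with the image
     of the new residual is minus the curvature along the new residual.\<close>
  have rp': "(H *\<^sub>v res (Suc t)) \<bullet> (H *\<^sub>v p) = - (res (Suc t) \<bullet> (H *\<^sub>v res (Suc t))) / a"
  proof -
    have eq: "a \<cdot>\<^sub>v (H *\<^sub>v p) = res t - res (Suc t)"
      unfolding a(3) using c image_carrier H by (intro eq_vecI) auto
    have "a * ((H *\<^sub>v res (Suc t)) \<bullet> (H *\<^sub>v p)) = (H *\<^sub>v res (Suc t)) \<bullet> (a \<cdot>\<^sub>v (H *\<^sub>v p))"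
      using image_carrier by simp
    also have "\<dots> = (H *\<^sub>v res (Suc t)) \<bullet> res t - (H *\<^sub>v res (Suc t)) \<bullet> res (Suc t)"
      unfolding eq using c image_carrier by (simp add: scalar_prod_linear)
    also have "(H *\<^sub>v res (Suc t)) \<bullet> res t = res (Suc t) \<bullet> (H *\<^sub>v res t)"
      by (rule symmetric_scalar_prod[OF H sym c(3,2)])
    also have "\<dots> = 0" by (rule ro'[OF r])
    also have "(H *\<^sub>v res (Suc t)) \<bullet> res (Suc t) = res (Suc t) \<bullet> (H *\<^sub>v res (Suc t))"
      by (rule symmetric_scalar_prod[OF H sym c(3,3)])
    finally show ?thesis using a(1) by (simp add: field_simps)
  qed
  have qo: "(H *\<^sub>v q) \<bullet> (H *\<^sub>v v) = 0" if v: "v \<in> kry (Suc t)" for v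
  proof -
    obtain u e where u: "u \<in> kry t" "v = u + e \<cdot>\<^sub>v p" using sp[OF v] by auto
    note uc = krylov_memD[OF u(1)] mult_carrier[OF krylov_memD[OF u(1)]]
    have "(H *\<^sub>v res (Suc t)) \<bullet> (H *\<^sub>v u) = res (Suc t) \<bullet> (H *\<^sub>v (H *\<^sub>v u))"
      by (rule symmetric_scalar_prod[OF H sym c(3) uc(2)])
    also have "\<dots> = 0" by (rule ro'[OF mult_mat_vec_in_krylov[OF H g u(1)]])
    finally have 1: "(H *\<^sub>v res (Suc t)) \<bullet> (H *\<^sub>v u) = 0" .
    have 2: "(H *\<^sub>v res (Suc t)) \<bullet> (H *\<^sub>v p) + b * ((H *\<^sub>v p) \<bullet> (H *\<^sub>v p)) = 0"
      unfolding rp' b_def using a(1) pp by (simp add: field_simps)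
    have "(H *\<^sub>v q) \<bullet> (H *\<^sub>v v) =
        e * ((H *\<^sub>v res (Suc t)) \<bullet> (H *\<^sub>v p) + b * ((H *\<^sub>v p) \<bullet> (H *\<^sub>v p)))"
      unfolding Hq u(2) using 1 po[OF u(1)] c image_carrier uc
      by (simp add: mult_linear scalar_prod_linear algebra_simps)
    thus ?thesis using 2 by simp
  qed
  have cq: "residual_cone (Suc t) q"
    unfolding q_def using b c
    by (intro residual_cone_add_smult residual_cone_residual s' residual_cone_mono[OF cp]) auto
  have rq: "res (Suc t) \<bullet> (H *\<^sub>v q) = res (Suc t) \<bullet> (H *\<^sub>v res (Suc t))"
    unfolding Hq using ro'[OF p] c image_carrier by (simp add: scalar_prod_linear)
  have sq: "\<exists>u\<in>kry (Suc t). \<exists>e. v = u + e \<cdot>\<^sub>v q" if v: "v \<in> kry (Suc (Suc t))" for v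
  proof -
    define h where "h = (H ^\<^sub>m Suc t) *\<^sub>v g"
    have h: "h \<in> carrier_vec d" unfolding h_def by (rule pow_mat_vec_carrier[OF H g])
    obtain u e where u: "u \<in> kry (Suc t)" "v = u + e \<cdot>\<^sub>v h"
      using v unfolding krylov_Suc[OF H g, of "Suc t"] h_def by blast
    obtain w f where w: "w \<in> kry (Suc t)" "res (Suc t) = w + f \<cdot>\<^sub>v h"
      using r' unfolding krylov_Suc[OF H g, of "Suc t"] h_def by blast
    \<comment> \<open>otherwise the new residual would lie in the Krylov space to whose image it is orthogonal\<close>
    have "f \<noteq> 0"
    proof
      assume "f = 0"
      hence "res (Suc t) = w" unfolding w(2) using krylov_memD[OF w(1)] h by (intro eq_vecI) auto
      thus False using ro'[OF w(1)] pos' by simp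
    qed
    note cc = krylov_memD[OF u(1)] krylov_memD[OF w(1)]
    have "v = (u - (e / f) \<cdot>\<^sub>v (w + b \<cdot>\<^sub>v p)) + (e / f) \<cdot>\<^sub>v q"
      unfolding q_def u(2) w(2) using cc h c(1) \<open>f \<noteq> 0\<close>
      by (intro eq_vecI) (auto simp: field_simps)
    moreover have "u - (e / f) \<cdot>\<^sub>v (w + b \<cdot>\<^sub>v p) \<in> kry (Suc t)"
      by (intro krylov_diff[OF H g] krylov_smult[OF H g] krylov_add[OF H g] u w p)
    ultimately show ?thesis by blast
  qed
  show ?thesis unfolding search_direction_def using q qo cq rq sq by blast
qed

lemma minres_stage_0: "minres_stage 0"
  unfolding minres_stage_def krylov_0[OF H g] residual_cone_def using g H
  by (auto simp: mult_mat_zero_vec[OF H] residual_eq)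

lemma search_direction_0: "\<exists>p. search_direction 0 p"
proof (intro exI[of _ "res 0"])
  have s: "itr 0 \<in> kry 0" using minres_stage_0 by (simp add: minres_stage_def)
  have r0: "res 0 = - g" unfolding residual_eq using g by (simp add: mult_mat_zero_vec[OF H])
  have "\<exists>u\<in>kry 0. \<exists>c. v = u + c \<cdot>\<^sub>v res 0" if v: "v \<in> kry (Suc 0)" for v
  proof -
    obtain u c where "u \<in> kry 0" "v = u + c \<cdot>\<^sub>v ((H ^\<^sub>m 0) *\<^sub>v g)"
      using v unfolding krylov_Suc[OF H g, of 0] by blast
    moreover from this have "v = u + (- c) \<cdot>\<^sub>v res 0"
      unfolding r0 using g H krylov_memD[of u 0] by (intro eq_vecI) auto
    ultimately show ?thesis by blast
  qed
  thus "search_direction 0 (res 0)"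
    unfolding search_direction_def using residual_in_krylov[OF s] residual_cone_residual[OF s] mult_carrier[OF krylov_memD[OF residual_in_krylov[OF s]]]
    by (auto simp: krylov_0[OF H g] mult_mat_zero_vec[OF H])
qed

lemma minres_stage_search_direction:
  assumes "\<And>j. j < t \<Longrightarrow> res j \<bullet> (H *\<^sub>v res j) > 0"
  shows "minres_stage t \<and> (res t \<bullet> (H *\<^sub>v res t) > 0 \<longrightarrow> (\<exists>p. search_direction t p))"
  using assms
proof (induction t)
  case 0
  show ?case using minres_stage_0 search_direction_0 by simp
next
  case (Suc t)
  have pos: "res t \<bullet> (H *\<^sub>v res t) > 0" using Suc.prems by simp
  then obtain p where p: "minres_stage t" "search_direction t p" using Suc by auto
  show ?case using minres_stage_Suc[OF p pos] search_direction_Suc[OF p pos] by metis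
qed


text \<open>The descent inequality is where the cone enters: \<open>g = - r - H s\<close> for the residual \<open>r\<close> and the iterate
  \<open>s\<close>, so it amounts to \<open>\<langle>r, s\<rangle> \<ge> 0\<close>. The other relations express that \<open>r\<close> is orthogonal to \<open>H s\<close>.\<close>

lemma iterate_of_positive_curvature:
  assumes pos: "\<And>j. j < t \<Longrightarrow> res j \<bullet> (H *\<^sub>v res j) > 0"
  shows "itr t \<in> kry t" "\<And>u. u \<in> kry t \<Longrightarrow> res t \<bullet> (H *\<^sub>v u) = 0"
    and "g \<bullet> res t = - (vnorm (res t))\<^sup>2"
    and "(vnorm g)\<^sup>2 = (vnorm (res t))\<^sup>2 + (vnorm (H *\<^sub>v itr t))\<^sup>2"
    and "g \<bullet> itr t \<le> - (itr t \<bullet> (H *\<^sub>v itr t))"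
    and "vnorm (H *\<^sub>v itr t + g) = vnorm (res t)"
proof -
  have st: "minres_stage t" using minres_stage_search_direction[of t] pos by blast
  show s: "itr t \<in> kry t" and ro: "\<And>u. u \<in> kry t \<Longrightarrow> res t \<bullet> (H *\<^sub>v u) = 0"
    using st by (auto simp: minres_stage_def)
  have cs: "residual_cone t (itr t)" using st by (simp add: minres_stage_def)
  define r where "r = res t"
  define s where "s = itr t"
  have sc: "s \<in> carrier_vec d" and rc: "r \<in> carrier_vec d"
    using krylov_memD[OF s] krylov_memD[OF residual_in_krylov[OF s]] by (auto simp: r_def s_def)
  note Hs = mult_carrier[OF sc]
  have g_eq: "g = - r - H *\<^sub>v s"
    unfolding r_def s_def residual_eq using g Hs H by (intro eq_vecI) (auto simp: s_def)
  have rHs: "r \<bullet> (H *\<^sub>v s) = 0" using ro[OF s] by (simp add: r_def s_def)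
  have rg: "r \<bullet> g = - (r \<bullet> r)"
    by (subst g_eq) (use rHs rc Hs in \<open>simp add: scalar_prod_linear\<close>)
  thus "g \<bullet> res t = - (vnorm (res t))\<^sup>2"
    using comm_scalar_prod[OF g rc] by (simp add: vnorm_square r_def)
  have neg: "H *\<^sub>v s + g = (-1) \<cdot>\<^sub>v r"
    using g rc Hs H by (subst g_eq) (intro eq_vecI, auto)
  thus "vnorm (H *\<^sub>v itr t + g) = vnorm (res t)"
    unfolding r_def s_def by (simp add: vnorm_smult)
  have "g = (-1) \<cdot>\<^sub>v (r + H *\<^sub>v s)"
    using g rc Hs H by (subst g_eq) (intro eq_vecI, auto)
  hence "(vnorm g)\<^sup>2 = (vnorm (r + H *\<^sub>v s))\<^sup>2" by (simp add: vnorm_smult)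
  also have "\<dots> = (vnorm r)\<^sup>2 + (vnorm (H *\<^sub>v s))\<^sup>2"
    by (rule vnorm_add_square_orthogonal[OF rc Hs rHs])
  finally show "(vnorm g)\<^sup>2 = (vnorm (res t))\<^sup>2 + (vnorm (H *\<^sub>v itr t))\<^sup>2"
    by (simp add: r_def s_def)
  have "r \<bullet> g \<le> 0" unfolding rg using scalar_prod_self_nonneg[of r] by simp
  hence "0 \<le> r \<bullet> s"
    using cs ro rc unfolding residual_cone_def r_def s_def by blast
  moreover have "g \<bullet> s = - (r \<bullet> s) - s \<bullet> (H *\<^sub>v s)"
    using comm_scalar_prod[OF sc Hs] rc sc Hs by (subst g_eq) (simp add: scalar_prod_linear)
  ultimately show "g \<bullet> itr t \<le> - (itr t \<bullet> (H *\<^sub>v itr t))" by (simp add: s_def)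
qed

text \<open>A Krylov space that does not grow at step \<open>j\<close> contains the residual at \<open>j\<close>, which is orthogonal to the
  image of that space and hence has zero curvature.\<close>

lemma positive_curvature_below_grade:
  assumes pos: "\<And>j. j < t \<Longrightarrow> res j \<bullet> (H *\<^sub>v res j) > 0"
    and m: "\<And>t. (\<And>j. j < t \<Longrightarrow> (H ^\<^sub>m j) *\<^sub>v g \<notin> kry j) \<Longrightarrow> t \<le> m"
  shows "t \<le> m"
proof (rule m)
  fix j assume j: "j < t"
  have pj: "res i \<bullet> (H *\<^sub>v res i) > 0" if "i < j" for i using pos that j by simp
  note st = iterate_of_positive_curvature[of j, OF pj]
  show "(H ^\<^sub>m j) *\<^sub>v g \<notin> kry j"
  proof
    assume h: "(H ^\<^sub>m j) *\<^sub>v g \<in> kry j"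
    have "res j \<in> kry (Suc j)" by (rule residual_in_krylov[OF st(1)])
    hence "res j \<in> kry j"
      using h unfolding krylov_Suc[OF H g] by (auto intro!: krylov_add[OF H g] krylov_smult[OF H g])
    thus False using st(2) pos[OF j] by force
  qed
qed

context
  fixes \<sigma> M :: real
  assumes \<sigma>: "0 < \<sigma>" and M: "0 < M"
    and regular: "\<forall>m t. is_grade H g m \<and> t \<le> m \<and> (\<forall>i\<in>{1..t}. \<not> npc_detected H g i) \<longrightarrow>
        (\<forall>s\<in>krylov H g t. s \<bullet> (H *\<^sub>v s) \<ge> \<sigma> * (vnorm s)\<^sup>2)"
    and bounded: "\<forall>t. \<forall>v\<in>krylov H g t. vnorm (H *\<^sub>v v) \<le> M * vnorm v"
begin

lemma coercive_of_positive_curvature: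
  assumes pos: "\<And>j. j < t \<Longrightarrow> res j \<bullet> (H *\<^sub>v res j) > 0" and s: "s \<in> kry t"
  shows "s \<bullet> (H *\<^sub>v s) \<ge> \<sigma> * (vnorm s)\<^sup>2"
proof -
  obtain m where m: "is_grade H g m"
    "\<And>t. (\<And>j. j < t \<Longrightarrow> (H ^\<^sub>m j) *\<^sub>v g \<notin> kry j) \<Longrightarrow> t \<le> m"
    using grade_exists[OF H g] by metis
  have "\<not> npc_detected H g i" if "i \<in> {1..t}" for i
  proof -
    have "i - 1 < t" using that by auto
    thus ?thesis using pos[of "i - 1"] unfolding npc_detected_def by simp
  qed
  moreover have "t \<le> m" by (rule positive_curvature_below_grade[OF pos m(2)])
  ultimately show ?thesis using regular m(1) s by blast
qed

text \<open>A step along the residual, \<open>s\<^sub>t + (\<sigma> / M\<^sup>2) r\<^sub>t\<close>, stays in the next Krylov space and already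
  reduces the squared residual by the factor \<open>1 - \<sigma>\<^sup>2 / M\<^sup>2\<close>; the MINRES iterate does at least as well.\<close>

lemma residual_decay:
  assumes pos: "\<And>j. j < t \<Longrightarrow> res j \<bullet> (H *\<^sub>v res j) > 0"
  shows "(vnorm (res t))\<^sup>2 \<le> (1 - \<sigma>\<^sup>2 / M\<^sup>2) ^ t * (vnorm g)\<^sup>2"
  using pos
proof (induction t)
  case 0
  note st = iterate_of_positive_curvature[of 0, OF 0]
  show ?case using st(4) zero_le_power2[of "vnorm (H *\<^sub>v itr 0)"] by simp
next
  case (Suc t)
  have pos: "\<And>j. j < t \<Longrightarrow> res j \<bullet> (H *\<^sub>v res j) > 0" using Suc.prems by simp
  note st = iterate_of_positive_curvature[of t, OF pos]
  note st' = iterate_of_positive_curvature[of "Suc t", OF Suc.prems]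
  define r where "r = res t"
  have r: "r \<in> kry (Suc t)" unfolding r_def by (rule residual_in_krylov[OF st(1)])
  have rc: "r \<in> carrier_vec d" by (rule krylov_memD[OF r])
  have s: "itr t \<in> kry (Suc t)" using st(1) krylov_mono[OF H g, of t "Suc t"] by auto
  define a where "a = \<sigma> / M\<^sup>2"
  have a: "a > 0" using \<sigma> M by (simp add: a_def)
  define u where "u = itr t + a \<cdot>\<^sub>v r"
  have u: "u \<in> kry (Suc t)" unfolding u_def by (intro krylov_add[OF H g] krylov_smult[OF H g] s r)
  have "(vnorm (H *\<^sub>v itr (Suc t) + g))\<^sup>2 \<le> (vnorm (H *\<^sub>v u + g))\<^sup>2"
    using residual_norm_expansion[OF st'(1) u] st'(2) zero_le_power2[of "vnorm (H *\<^sub>v (u - itr (Suc t)))"]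
    by (simp add: residual_eq)
  hence "(vnorm (res (Suc t)))\<^sup>2 \<le> (vnorm (H *\<^sub>v u + g))\<^sup>2"
    by (simp add: st'(6) del: minres_iterate.simps)
  also have "H *\<^sub>v u + g = (-1) \<cdot>\<^sub>v (r - a \<cdot>\<^sub>v (H *\<^sub>v r))"
    unfolding u_def mult_add[OF krylov_memD[OF s] smult_carrier_vec[THEN iffD2, OF rc]] mult_smult[OF rc]
    unfolding r_def residual_eq
    using g mult_carrier[OF krylov_memD[OF s]] mult_carrier[OF rc] H by (intro eq_vecI) (auto simp: r_def residual_eq)
  also have "(vnorm \<dots>)\<^sup>2 = (vnorm (r - a \<cdot>\<^sub>v (H *\<^sub>v r)))\<^sup>2" by (simp add: vnorm_smult)
  also have "\<dots> = (vnorm r)\<^sup>2 - 2 * a * (r \<bullet> (H *\<^sub>v r)) + a\<^sup>2 * (vnorm (H *\<^sub>v r))\<^sup>2"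
    using rc mult_carrier[OF rc] comm_scalar_prod[OF rc mult_carrier[OF rc]]
    unfolding vnorm_square by (simp add: scalar_prod_linear power2_eq_square algebra_simps)
  also have "\<dots> \<le> (vnorm r)\<^sup>2 - 2 * a * (\<sigma> * (vnorm r)\<^sup>2) + a\<^sup>2 * (M * vnorm r)\<^sup>2"
  proof -
    have "\<sigma> * (vnorm r)\<^sup>2 \<le> r \<bullet> (H *\<^sub>v r)"
      by (rule coercive_of_positive_curvature[OF Suc.prems r])
    hence "2 * a * (\<sigma> * (vnorm r)\<^sup>2) \<le> 2 * a * (r \<bullet> (H *\<^sub>v r))" using a by simp
    moreover have "(vnorm (H *\<^sub>v r))\<^sup>2 \<le> (M * vnorm r)\<^sup>2" using bounded[rule_format, OF r] by (intro power_mono) auto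
    hence "a\<^sup>2 * (vnorm (H *\<^sub>v r))\<^sup>2 \<le> a\<^sup>2 * (M * vnorm r)\<^sup>2" by (intro mult_left_mono) auto
    ultimately show ?thesis by linarith
  qed
  also have "\<dots> = (1 - \<sigma>\<^sup>2 / M\<^sup>2) * (vnorm r)\<^sup>2"
    unfolding a_def using M by (simp add: power2_eq_square field_simps)
  finally have step: "(vnorm (res (Suc t)))\<^sup>2 \<le> (1 - \<sigma>\<^sup>2 / M\<^sup>2) * (vnorm r)\<^sup>2" .
  show ?case
  proof (cases "0 \<le> 1 - \<sigma>\<^sup>2 / M\<^sup>2")
    case True
    have "(vnorm r)\<^sup>2 \<le> (1 - \<sigma>\<^sup>2 / M\<^sup>2) ^ t * (vnorm g)\<^sup>2" using Suc.IH[OF pos] by (simp add: r_def)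
    from mult_left_mono[OF this True] step show ?thesis by (simp add: mult.assoc)
  next
    case False
    \<comment> \<open>a negative factor is impossible, since the curvature along \<open>r \<noteq> 0\<close> lies between \<open>\<sigma>\<close> and \<open>M\<close>\<close>
    hence "(1 - \<sigma>\<^sup>2 / M\<^sup>2) * (vnorm r)\<^sup>2 \<le> 0" by (simp add: mult_le_0_iff)
    hence "(vnorm (res (Suc t)))\<^sup>2 = 0" using step zero_le_power2[of "vnorm (res (Suc t))"] by linarith
    moreover have "r \<noteq> 0\<^sub>v d" using Suc.prems[of t] H by (auto simp: r_def mult_mat_zero_vec[OF H])
    hence "vnorm r > 0" using vnorm_eq_0_iff[OF rc] vnorm_nonneg[of r] by linarith
    moreover have "\<sigma> * (vnorm r)\<^sup>2 \<le> M * (vnorm r)\<^sup>2"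
    proof -
      have "\<sigma> * (vnorm r)\<^sup>2 \<le> r \<bullet> (H *\<^sub>v r)"
        by (rule coercive_of_positive_curvature[OF Suc.prems r])
      also have "\<dots> \<le> vnorm r * vnorm (H *\<^sub>v r)"
        using scalar_prod_abs_le_vnorm[OF rc mult_carrier[OF rc]] by simp
      also have "\<dots> \<le> vnorm r * (M * vnorm r)" using bounded[rule_format, OF r] by (intro mult_left_mono) auto
      finally show ?thesis by (simp add: power2_eq_square algebra_simps)
    qed
    ultimately have "\<sigma> \<le> M" by simp
    hence "\<sigma>\<^sup>2 \<le> M\<^sup>2" using \<sigma> by (intro power_mono) auto
    thus ?thesis using False M by simp
  qed
qed

text \<open>A zero residual passes the solution test, so an undetected residual is nonzero and has positive
  curvature.\<close>

lemma not_detected_positive_curvature: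
  assumes "\<And>i. 1 \<le> i \<Longrightarrow> i \<le> t \<Longrightarrow> \<not> npc_detected H g i \<and> \<not> sol_detected H g \<eta> i"
    and "0 \<le> \<eta>" and "j < t"
  shows "res j \<bullet> (H *\<^sub>v res j) > 0"
proof -
  have nd: "\<not> npc_detected H g (Suc j)" "\<not> sol_detected H g \<eta> (Suc j)" using assms(1)[of "Suc j"] assms(3) by auto
  have "res j \<noteq> 0\<^sub>v d"
  proof
    assume "res j = 0\<^sub>v d"
    thus False using nd(2) assms(2) unfolding sol_detected_def by (simp add: mult_mat_zero_vec[OF H])
  qed
  thus ?thesis using nd(1) g unfolding npc_detected_def by auto
qed

text \<open>By Pythagoras the failed solution test bounds the residual from below by a fixed fraction of \<open>g\<close>,
  against which the geometric decay works.\<close>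

lemma not_detected_count:
  assumes nd: "\<And>i. 1 \<le> i \<Longrightarrow> i \<le> Suc t \<Longrightarrow> \<not> npc_detected H g i \<and> \<not> sol_detected H g \<eta> i"
    and \<eta>: "0 < \<eta>" and g0: "g \<noteq> 0\<^sub>v d"
  shows "\<eta>\<^sup>2 < (M\<^sup>2 + \<eta>\<^sup>2) * (1 - \<sigma>\<^sup>2 / M\<^sup>2) ^ t"
proof -
  have pos: "res j \<bullet> (H *\<^sub>v res j) > 0" if "j < t" for j
    by (rule not_detected_positive_curvature[of "Suc t" \<eta>]) (use nd \<eta> that in auto)
  note st = iterate_of_positive_curvature[of t, OF pos]
  have "\<not> sol_detected H g \<eta> (Suc t)" using nd[of "Suc t"] by simp
  hence gt: "\<eta> * vnorm (H *\<^sub>v itr t) < vnorm (H *\<^sub>v res t)" unfolding sol_detected_def by simp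
  have "(\<eta> * vnorm (H *\<^sub>v itr t))\<^sup>2 < (vnorm (H *\<^sub>v res t))\<^sup>2"
    using gt \<eta> by (intro power_strict_mono) auto
  also have "\<dots> \<le> (M * vnorm (res t))\<^sup>2"
    using bounded[rule_format, OF residual_in_krylov[OF st(1)]] by (intro power_mono) auto
  finally have "\<eta>\<^sup>2 * (vnorm g)\<^sup>2 < (M\<^sup>2 + \<eta>\<^sup>2) * (vnorm (res t))\<^sup>2"
    using st(4) by (simp add: power_mult_distrib algebra_simps)
  also have "\<dots> \<le> (M\<^sup>2 + \<eta>\<^sup>2) * ((1 - \<sigma>\<^sup>2 / M\<^sup>2) ^ t * (vnorm g)\<^sup>2)"
    by (intro mult_left_mono residual_decay pos) auto
  finally have "\<eta>\<^sup>2 * (vnorm g)\<^sup>2 < ((M\<^sup>2 + \<eta>\<^sup>2) * (1 - \<sigma>\<^sup>2 / M\<^sup>2) ^ t) * (vnorm g)\<^sup>2"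
    by (simp add: mult.assoc)
  moreover have "vnorm g > 0" using vnorm_eq_0_iff[OF g] g0 vnorm_nonneg[of g] by linarith
  ultimately show ?thesis by simp
qed

lemma minres_returns_exists:
  assumes \<eta>: "0 < \<eta>" and g0: "g \<noteq> 0\<^sub>v d" and q: "0 \<le> 1 - \<sigma>\<^sup>2 / M\<^sup>2"
  obtains t p flag where "minres_returns H g \<eta> t p flag"
proof -
  let ?D = "\<lambda>i. 1 \<le> i \<and> (npc_detected H g i \<or> sol_detected H g \<eta> i)"
  have "\<exists>i. ?D i"
  proof (rule ccontr)
    assume "\<not> ?thesis"
    hence nd: "\<eta>\<^sup>2 < (M\<^sup>2 + \<eta>\<^sup>2) * (1 - \<sigma>\<^sup>2 / M\<^sup>2) ^ t" for t
      by (intro not_detected_count \<eta> g0) auto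
    have pp: "M\<^sup>2 + \<eta>\<^sup>2 > 0" using M by (intro add_pos_nonneg) auto
    obtain n where n: "(1 - \<sigma>\<^sup>2 / M\<^sup>2) ^ n < \<eta>\<^sup>2 / (M\<^sup>2 + \<eta>\<^sup>2)"
      using real_arch_pow_inv[of "\<eta>\<^sup>2 / (M\<^sup>2 + \<eta>\<^sup>2)" "1 - \<sigma>\<^sup>2 / M\<^sup>2"] \<eta> pp q \<sigma> M by auto
    show False using nd[of n] n pp by (simp add: field_simps)
  qed
  then obtain t where t: "?D t" "\<And>i. i < t \<Longrightarrow> \<not> ?D i" using exists_least_iff[of ?D] by auto
  show thesis
  proof (cases "npc_detected H g t")
    case True
    hence "minres_returns H g \<eta> t (res (t - 1)) NPC" using t unfolding minres_returns_def by auto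
    thus thesis by (rule that)
  next
    case False
    hence "minres_returns H g \<eta> t (itr (t - 1)) SOL" using t unfolding minres_returns_def by auto
    thus thesis by (rule that)
  qed
qed

text \<open>The last claim limits \<open>t\<close> for a long direction: with \<open>p\<close> comparable to \<open>g\<close> the power of the decay factor
  cannot be small.\<close>

lemma minres_returns_npc:
  assumes ret: "minres_returns H g \<eta> t p NPC" and \<eta>: "0 < \<eta>"
  shows "p \<in> carrier_vec d" "p \<noteq> 0\<^sub>v d" "p \<bullet> (H *\<^sub>v p) \<le> 0" "g \<bullet> p = - (vnorm p)\<^sup>2"
    "(vnorm p)\<^sup>2 \<le> (1 - \<sigma>\<^sup>2 / M\<^sup>2) ^ (t - 1) * (vnorm g)\<^sup>2"
proof -
  have t: "1 \<le> t" "\<And>i. 1 \<le> i \<Longrightarrow> i \<le> t - 1 \<Longrightarrow> \<not> npc_detected H g i \<and> \<not> sol_detected H g \<eta> i"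
    and npc: "npc_detected H g t" and p: "p = res (t - 1)"
    using ret unfolding minres_returns_def by auto
  have pos: "res j \<bullet> (H *\<^sub>v res j) > 0" if "j < t - 1" for j
    by (rule not_detected_positive_curvature[of "t - 1" \<eta>]) (use t \<eta> that in auto)
  note st = iterate_of_positive_curvature[of "t - 1", OF pos]
  show "p \<in> carrier_vec d" unfolding p by (rule krylov_memD[OF residual_in_krylov[OF st(1)]])
  show "p \<noteq> 0\<^sub>v d" "p \<bullet> (H *\<^sub>v p) \<le> 0" using npc g unfolding npc_detected_def p by auto
  show "g \<bullet> p = - (vnorm p)\<^sup>2" unfolding p by (rule st(3))
  show "(vnorm p)\<^sup>2 \<le> (1 - \<sigma>\<^sup>2 / M\<^sup>2) ^ (t - 1) * (vnorm g)\<^sup>2"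
    unfolding p by (rule residual_decay[OF pos])
qed

text \<open>The returned residual is small relative to \<open>p\<close> by the solution test, because the Hessian is bounded
  below by \<open>\<sigma>\<close> on the Krylov space of the residual and above by \<open>M\<close> on that of \<open>p\<close>. The last claim uses
  that the tests failed at iteration \<open>t - 1\<close>, which exists only for \<open>t \<ge> 2\<close>.\<close>

lemma minres_returns_sol:
  assumes ret: "minres_returns H g \<eta> t p SOL" and \<eta>: "0 < \<eta>" and g0: "g \<noteq> 0\<^sub>v d"
  shows "p \<in> carrier_vec d" "\<sigma> * (vnorm p)\<^sup>2 \<le> p \<bullet> (H *\<^sub>v p)" "g \<bullet> p \<le> - (p \<bullet> (H *\<^sub>v p))"
    "\<sigma> * vnorm (H *\<^sub>v p + g) \<le> \<eta> * M * vnorm p"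
    "2 \<le> t \<Longrightarrow> \<eta>\<^sup>2 < (M\<^sup>2 + \<eta>\<^sup>2) * (1 - \<sigma>\<^sup>2 / M\<^sup>2) ^ (t - 2)"
proof -
  have t: "1 \<le> t" "\<And>i. 1 \<le> i \<Longrightarrow> i \<le> t - 1 \<Longrightarrow> \<not> npc_detected H g i \<and> \<not> sol_detected H g \<eta> i"
    and npc: "\<not> npc_detected H g t" and sol: "sol_detected H g \<eta> t" and p: "p = itr (t - 1)"
    using ret unfolding minres_returns_def by auto
  have pos: "res j \<bullet> (H *\<^sub>v res j) > 0" if "j < t - 1" for j
    by (rule not_detected_positive_curvature[of "t - 1" \<eta>]) (use t \<eta> that in auto)
  note st = iterate_of_positive_curvature[of "t - 1", OF pos]
  show "p \<in> carrier_vec d" unfolding p by (rule krylov_memD[OF st(1)])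
  show "\<sigma> * (vnorm p)\<^sup>2 \<le> p \<bullet> (H *\<^sub>v p)"
    unfolding p by (rule coercive_of_positive_curvature[OF pos st(1)])
  show "g \<bullet> p \<le> - (p \<bullet> (H *\<^sub>v p))" unfolding p by (rule st(5))
  define r where "r = res (t - 1)"
  have r: "r \<in> kry t" using residual_in_krylov[OF st(1)] t(1) by (simp add: r_def)
  have rc: "r \<in> carrier_vec d" by (rule krylov_memD[OF r])
  have "\<sigma> * vnorm r \<le> \<eta> * M * vnorm p"
  proof (cases "r = 0\<^sub>v d")
    case True
    thus ?thesis using \<eta> M by simp
  next
    case False
    hence rr: "r \<bullet> (H *\<^sub>v r) > 0" using npc g unfolding npc_detected_def r_def by auto
    have pos': "res j \<bullet> (H *\<^sub>v res j) > 0" if "j < t" for j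
      using pos[of j] rr that by (cases "j = t - 1") (auto simp: r_def)
    have "\<sigma> * vnorm r * vnorm r \<le> r \<bullet> (H *\<^sub>v r)"
      using coercive_of_positive_curvature[OF pos' r] by (simp add: power2_eq_square mult.assoc)
    also have "\<dots> \<le> vnorm (H *\<^sub>v r) * vnorm r"
      using scalar_prod_abs_le_vnorm[OF rc mult_carrier[OF rc]] by (simp add: mult.commute)
    finally have "\<sigma> * vnorm r \<le> vnorm (H *\<^sub>v r)"
      using False vnorm_eq_0_iff[OF rc] vnorm_nonneg[of r] by (metis mult_le_cancel_right_pos order_le_less)
    also have "\<dots> \<le> \<eta> * vnorm (H *\<^sub>v p)" using sol unfolding sol_detected_def p r_def .
    also have "\<dots> \<le> \<eta> * (M * vnorm p)" using bounded[rule_format, OF st(1)] \<eta> by (simp add: p)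
    finally show ?thesis by (simp add: mult.assoc)
  qed
  thus "\<sigma> * vnorm (H *\<^sub>v p + g) \<le> \<eta> * M * vnorm p" using st(6) by (simp add: p r_def)
  show "\<eta>\<^sup>2 < (M\<^sup>2 + \<eta>\<^sup>2) * (1 - \<sigma>\<^sup>2 / M\<^sup>2) ^ (t - 2)" if "2 \<le> t"
    by (rule not_detected_count[OF _ \<eta> g0]) (use t that in auto)
qed

end

end

section \<open>Calculus along lines\<close>

lemma has_gradient_line_derivative:
  assumes grad: "has_gradient d f v (x + a \<cdot>\<^sub>v p)" and x: "x \<in> carrier_vec d" and p: "p \<in> carrier_vec d"
  shows "((\<lambda>a. f (x + a \<cdot>\<^sub>v p)) has_real_derivative v \<bullet> p) (at a)"
  unfolding DERIV_def
proof (rule LIM_I)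
  fix r :: real assume r: "0 < r"
  have v: "v \<in> carrier_vec d" using grad by (simp add: has_gradient_def)
  define e where "e = r / (2 * (vnorm p + 1))"
  have n: "vnorm p + 1 > 0" using vnorm_nonneg[of p] by linarith
  have e: "e > 0" using r n by (simp add: e_def)
  then obtain \<delta> where \<delta>: "\<delta> > 0" "\<And>h. h \<in> carrier_vec d \<Longrightarrow> vnorm h < \<delta> \<Longrightarrow>
      \<bar>f (x + a \<cdot>\<^sub>v p + h) - f (x + a \<cdot>\<^sub>v p) - v \<bullet> h\<bar> \<le> e * vnorm h"
    using grad unfolding has_gradient_def by blast
  have "norm ((f (x + (a + t) \<cdot>\<^sub>v p) - f (x + a \<cdot>\<^sub>v p)) / t - v \<bullet> p) < r"
    if t: "t \<noteq> 0" "norm (t - 0) < \<delta> / (vnorm p + 1)" for t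
  proof -
    have "vnorm (t \<cdot>\<^sub>v p) \<le> \<bar>t\<bar> * (vnorm p + 1)" by (simp add: vnorm_smult mult_left_mono)
    also have "\<dots> < \<delta>" using t n by (simp add: field_simps)
    finally have "\<bar>f (x + a \<cdot>\<^sub>v p + t \<cdot>\<^sub>v p) - f (x + a \<cdot>\<^sub>v p) - v \<bullet> (t \<cdot>\<^sub>v p)\<bar> \<le> e * vnorm (t \<cdot>\<^sub>v p)"
      using \<delta>(2)[of "t \<cdot>\<^sub>v p"] p by simp
    moreover have "x + a \<cdot>\<^sub>v p + t \<cdot>\<^sub>v p = x + (a + t) \<cdot>\<^sub>v p"
      using x p by (intro eq_vecI) (auto simp: algebra_simps)
    ultimately have "\<bar>f (x + (a + t) \<cdot>\<^sub>v p) - f (x + a \<cdot>\<^sub>v p) - t * (v \<bullet> p)\<bar> \<le> e * (\<bar>t\<bar> * vnorm p)"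
      using v p by (simp add: vnorm_smult)
    moreover have "(f (x + (a + t) \<cdot>\<^sub>v p) - f (x + a \<cdot>\<^sub>v p)) / t - v \<bullet> p =
        (f (x + (a + t) \<cdot>\<^sub>v p) - f (x + a \<cdot>\<^sub>v p) - t * (v \<bullet> p)) / t"
      using t(1) by (simp add: field_simps)
    ultimately have "norm ((f (x + (a + t) \<cdot>\<^sub>v p) - f (x + a \<cdot>\<^sub>v p)) / t - v \<bullet> p) \<le> e * vnorm p"
      using t(1) by (simp add: abs_divide field_simps)
    also have "\<dots> \<le> e * (vnorm p + 1)" using e by simp
    also have "\<dots> = r / 2" using n by (simp add: e_def field_simps)
    also have "\<dots> < r" using r by simp
    finally show ?thesis .
  qed
  thus "\<exists>s>0. \<forall>t. t \<noteq> 0 \<and> norm (t - 0) < s \<longrightarrow>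
      norm ((f (x + (a + t) \<cdot>\<^sub>v p) - f (x + a \<cdot>\<^sub>v p)) / t - v \<bullet> p) < r"
    using \<delta>(1) n by (intro exI[of _ "\<delta> / (vnorm p + 1)"]) simp
qed

text \<open>Pairing with a fixed vector reduces derivatives of the gradient map to derivatives of real-valued
  functions.\<close>

lemma has_gradient_scalar_prod_jacobian:
  assumes jac: "has_jacobian d G A x" and x: "x \<in> carrier_vec d" and w: "w \<in> carrier_vec d"
    and G: "\<And>y. y \<in> carrier_vec d \<Longrightarrow> G y \<in> carrier_vec d"
  shows "has_gradient d (\<lambda>y. w \<bullet> G y) (A\<^sup>T *\<^sub>v w) x"
proof -
  have A: "A \<in> carrier_mat d d" using jac by (simp add: has_jacobian_def)
  have "\<exists>\<delta>>0. \<forall>h\<in>carrier_vec d. vnorm h < \<delta> \<longrightarrow>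
      \<bar>w \<bullet> G (x + h) - w \<bullet> G x - (A\<^sup>T *\<^sub>v w) \<bullet> h\<bar> \<le> e * vnorm h" if e: "e > 0" for e
  proof -
    define e' where "e' = e / (vnorm w + 1)"
    have n: "vnorm w + 1 > 0" using vnorm_nonneg[of w] by linarith
    have e': "e' > 0" using e n by (simp add: e'_def)
    then obtain \<delta> where \<delta>: "\<delta> > 0" "\<And>h. h \<in> carrier_vec d \<Longrightarrow> vnorm h < \<delta> \<Longrightarrow>
        vnorm (G (x + h) - G x - A *\<^sub>v h) \<le> e' * vnorm h"
      using jac unfolding has_jacobian_def by blast
    have "\<bar>w \<bullet> G (x + h) - w \<bullet> G x - (A\<^sup>T *\<^sub>v w) \<bullet> h\<bar> \<le> e * vnorm h"
      if h: "h \<in> carrier_vec d" "vnorm h < \<delta>" for h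
    proof -
      have c: "G (x + h) \<in> carrier_vec d" "G x \<in> carrier_vec d" "A *\<^sub>v h \<in> carrier_vec d"
        using G x h A by auto
      have "(A\<^sup>T *\<^sub>v w) \<bullet> h = w \<bullet> (A *\<^sub>v h)"
        using transpose_vec_mult_scalar[OF A h(1) w] by simp
      hence "w \<bullet> G (x + h) - w \<bullet> G x - (A\<^sup>T *\<^sub>v w) \<bullet> h = w \<bullet> (G (x + h) - G x - A *\<^sub>v h)"
        using c w by (simp add: scalar_prod_minus_distrib[of _ d])
      also have "\<bar>\<dots>\<bar> \<le> vnorm w * vnorm (G (x + h) - G x - A *\<^sub>v h)"
        by (rule scalar_prod_abs_le_vnorm[OF w]) (use c in auto)
      also have "\<dots> \<le> (vnorm w + 1) * (e' * vnorm h)"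
        using \<delta>(2)[OF h] n by (intro mult_mono) auto
      also have "\<dots> = e * vnorm h" using n by (simp add: e'_def)
      finally show ?thesis .
    qed
    thus ?thesis using \<delta>(1) by blast
  qed
  thus ?thesis using A w unfolding has_gradient_def by auto
qed

context
  fixes d :: nat and f :: "real vec \<Rightarrow> real" and g :: "real vec \<Rightarrow> real vec" and H :: "real vec \<Rightarrow> real mat"
  assumes C2: "twice_continuously_differentiable d f g H"
begin

lemma gradient_carrier: "x \<in> carrier_vec d \<Longrightarrow> g x \<in> carrier_vec d"
  using C2 by (auto simp: twice_continuously_differentiable_def has_gradient_def)

lemma hessian_carrier: "x \<in> carrier_vec d \<Longrightarrow> H x \<in> carrier_mat d d"
  using C2 by (auto simp: twice_continuously_differentiable_def has_jacobian_def)

lemma line_derivative: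
  assumes x: "x \<in> carrier_vec d" and p: "p \<in> carrier_vec d"
  shows "((\<lambda>a. f (x + a \<cdot>\<^sub>v p)) has_real_derivative g (x + a \<cdot>\<^sub>v p) \<bullet> p) (at a)"
  by (rule has_gradient_line_derivative[OF _ x p])
     (use C2 x p in \<open>auto simp: twice_continuously_differentiable_def\<close>)

lemma line_continuous:
  assumes "x \<in> carrier_vec d" "p \<in> carrier_vec d"
  shows "continuous_on UNIV (\<lambda>a. f (x + a \<cdot>\<^sub>v p))"
  using DERIV_isCont[OF line_derivative[OF assms]] by (simp add: continuous_at_imp_continuous_on)

lemma line_gradient_derivative:
  assumes x: "x \<in> carrier_vec d" and p: "p \<in> carrier_vec d" and w: "w \<in> carrier_vec d"
  shows "((\<lambda>a. w \<bullet> g (x + a \<cdot>\<^sub>v p)) has_real_derivative w \<bullet> (H (x + a \<cdot>\<^sub>v p) *\<^sub>v p)) (at a)"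
proof -
  have y: "x + a \<cdot>\<^sub>v p \<in> carrier_vec d" using x p by simp
  have jac: "has_jacobian d g (H (x + a \<cdot>\<^sub>v p)) (x + a \<cdot>\<^sub>v p)"
    using C2 y by (auto simp: twice_continuously_differentiable_def)
  have "((\<lambda>a. w \<bullet> g (x + a \<cdot>\<^sub>v p)) has_real_derivative ((H (x + a \<cdot>\<^sub>v p))\<^sup>T *\<^sub>v w) \<bullet> p) (at a)"
    by (rule has_gradient_line_derivative[OF has_gradient_scalar_prod_jacobian[OF jac y w gradient_carrier] x p])
  thus ?thesis using transpose_vec_mult_scalar[OF hessian_carrier[OF y] p w] by simp
qed

text \<open>The mean value theorem, used once along \<open>u\<close> and once along \<open>v\<close>. The left-hand side is symmetric in \<open>u\<close>
  and \<open>v\<close>, which is what makes the Hessian symmetric.\<close>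

lemma second_difference:
  assumes x: "x \<in> carrier_vec d" and u: "u \<in> carrier_vec d" and v: "v \<in> carrier_vec d" and s: "0 < s"
  obtains a b where "0 < a" "a < s" "0 < b" "b < s"
    "f (x + s \<cdot>\<^sub>v v + s \<cdot>\<^sub>v u) - f (x + s \<cdot>\<^sub>v u) - f (x + s \<cdot>\<^sub>v v) + f x =
     s\<^sup>2 * (u \<bullet> (H (x + a \<cdot>\<^sub>v u + b \<cdot>\<^sub>v v) *\<^sub>v v))"
proof -
  have xv: "x + s \<cdot>\<^sub>v v \<in> carrier_vec d" using x v by simp
  have "((\<lambda>a. f (x + s \<cdot>\<^sub>v v + a \<cdot>\<^sub>v u) - f (x + a \<cdot>\<^sub>v u)) has_real_derivative
      g (x + s \<cdot>\<^sub>v v + a \<cdot>\<^sub>v u) \<bullet> u - g (x + a \<cdot>\<^sub>v u) \<bullet> u) (at a)" for a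
    by (intro DERIV_diff line_derivative xv x u)
  from MVT2[OF s this] obtain a where a: "0 < a" "a < s"
    "f (x + s \<cdot>\<^sub>v v + s \<cdot>\<^sub>v u) - f (x + s \<cdot>\<^sub>v u) - (f (x + s \<cdot>\<^sub>v v + 0 \<cdot>\<^sub>v u) - f (x + 0 \<cdot>\<^sub>v u)) =
      s * (g (x + s \<cdot>\<^sub>v v + a \<cdot>\<^sub>v u) \<bullet> u - g (x + a \<cdot>\<^sub>v u) \<bullet> u)"
    by auto
  have xa: "x + a \<cdot>\<^sub>v u \<in> carrier_vec d" using x u by simp
  have "((\<lambda>b. u \<bullet> g (x + a \<cdot>\<^sub>v u + b \<cdot>\<^sub>v v)) has_real_derivative
      u \<bullet> (H (x + a \<cdot>\<^sub>v u + b \<cdot>\<^sub>v v) *\<^sub>v v)) (at b)" for b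
    by (rule line_gradient_derivative[OF xa v u])
  from MVT2[OF s this] obtain b where b: "0 < b" "b < s"
    "u \<bullet> g (x + a \<cdot>\<^sub>v u + s \<cdot>\<^sub>v v) - u \<bullet> g (x + a \<cdot>\<^sub>v u + 0 \<cdot>\<^sub>v v) =
      s * (u \<bullet> (H (x + a \<cdot>\<^sub>v u + b \<cdot>\<^sub>v v) *\<^sub>v v))"
    by auto
  have e: "x + s \<cdot>\<^sub>v v + 0 \<cdot>\<^sub>v u = x + s \<cdot>\<^sub>v v" "x + 0 \<cdot>\<^sub>v u = x"
    "x + a \<cdot>\<^sub>v u + 0 \<cdot>\<^sub>v v = x + a \<cdot>\<^sub>v u"
    "x + s \<cdot>\<^sub>v v + a \<cdot>\<^sub>v u = x + a \<cdot>\<^sub>v u + s \<cdot>\<^sub>v v"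
    using x u v by (auto intro!: eq_vecI)
  have cm: "g y \<bullet> u = u \<bullet> g y" if "y \<in> carrier_vec d" for y
    using comm_scalar_prod[OF gradient_carrier[OF that] u] .
  have "x + a \<cdot>\<^sub>v u + s \<cdot>\<^sub>v v \<in> carrier_vec d" using x u v by simp
  note cm[OF this] cm[OF xa]
  hence "f (x + s \<cdot>\<^sub>v v + s \<cdot>\<^sub>v u) - f (x + s \<cdot>\<^sub>v u) - f (x + s \<cdot>\<^sub>v v) + f x =
     s\<^sup>2 * (u \<bullet> (H (x + a \<cdot>\<^sub>v u + b \<cdot>\<^sub>v v) *\<^sub>v v))"
    using a(3) b(3) unfolding e by (simp add: power2_eq_square)
  thus thesis using that a b by blast
qed

lemma hessian_form_continuous:
  assumes x: "x \<in> carrier_vec d" and u: "u \<in> carrier_vec d" and v: "v \<in> carrier_vec d" and e: "0 < e"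
  obtains s where "0 < s"
    "\<And>a b. 0 < a \<Longrightarrow> a < s \<Longrightarrow> 0 < b \<Longrightarrow> b < s \<Longrightarrow>
      \<bar>u \<bullet> (H (x + a \<cdot>\<^sub>v u + b \<cdot>\<^sub>v v) *\<^sub>v v) - u \<bullet> (H x *\<^sub>v v)\<bar> \<le> e * (vnorm u * vnorm v)"
proof -
  obtain \<delta> where \<delta>: "\<delta> > 0" "\<And>y. y \<in> carrier_vec d \<Longrightarrow> vnorm (y - x) < \<delta> \<Longrightarrow> spectral_norm (H y - H x) < e"
    using C2 x e unfolding twice_continuously_differentiable_def by meson
  define s where "s = \<delta> / (vnorm u + vnorm v + 1)"
  have n: "vnorm u + vnorm v + 1 > 0" using vnorm_nonneg[of u] vnorm_nonneg[of v] by linarith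
  have s: "s > 0" using \<delta>(1) n by (simp add: s_def)
  have "\<bar>u \<bullet> (H (x + a \<cdot>\<^sub>v u + b \<cdot>\<^sub>v v) *\<^sub>v v) - u \<bullet> (H x *\<^sub>v v)\<bar> \<le> e * (vnorm u * vnorm v)"
    if ab: "0 < a" "a < s" "0 < b" "b < s" for a b
  proof -
    let ?y = "x + a \<cdot>\<^sub>v u + b \<cdot>\<^sub>v v"
    have y: "?y \<in> carrier_vec d" using x u v by simp
    have "?y - x = a \<cdot>\<^sub>v u + b \<cdot>\<^sub>v v" using x u v by (intro eq_vecI) auto
    hence "vnorm (?y - x) \<le> a * vnorm u + b * vnorm v"
      using vnorm_triangle[of "a \<cdot>\<^sub>v u" d "b \<cdot>\<^sub>v v"] u v ab by (simp add: vnorm_smult)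
    also have "\<dots> \<le> s * vnorm u + s * vnorm v" using ab by (intro add_mono mult_right_mono) auto
    also have "\<dots> < s * (vnorm u + vnorm v + 1)" using s by (simp add: algebra_simps)
    also have "\<dots> = \<delta>" using n by (simp add: s_def)
    finally have sn: "spectral_norm (H ?y - H x) < e" using \<delta>(2)[OF y] by simp
    have D: "H ?y - H x \<in> carrier_mat d d" using hessian_carrier[OF x] hessian_carrier[OF y] by auto
    have Hv: "H ?y *\<^sub>v v \<in> carrier_vec d" "H x *\<^sub>v v \<in> carrier_vec d"
      using hessian_carrier[OF x] hessian_carrier[OF y] v by auto
    have "u \<bullet> (H ?y *\<^sub>v v) - u \<bullet> (H x *\<^sub>v v) = u \<bullet> ((H ?y - H x) *\<^sub>v v)"
      using minus_mult_distrib_mat_vec[OF hessian_carrier[OF y] hessian_carrier[OF x] v] u Hv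
      by (simp add: scalar_prod_minus_distrib[of _ d])
    also have "\<bar>\<dots>\<bar> \<le> vnorm u * vnorm ((H ?y - H x) *\<^sub>v v)"
      by (rule scalar_prod_abs_le_vnorm[OF u mult_mat_vec_carrier[OF D v]])
    also have "\<dots> \<le> vnorm u * (spectral_norm (H ?y - H x) * vnorm v)"
      by (intro mult_left_mono vnorm_mult_mat_vec_le_spectral_norm[OF D v]) simp
    also have "\<dots> \<le> vnorm u * (e * vnorm v)" using sn by (intro mult_left_mono mult_right_mono) auto
    finally show ?thesis by (simp add: mult_ac)
  qed
  thus thesis using that s by blast
qed

text \<open>Schwarz's theorem: the Hessian forms for the two orders of differentiation both evaluate the same
  second difference, at points that tend to \<open>x\<close>.\<close>

lemma hessian_symmetric:
  assumes x: "x \<in> carrier_vec d"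
  shows "(H x)\<^sup>T = H x"
proof -
  have form: "u \<bullet> (H x *\<^sub>v v) = v \<bullet> (H x *\<^sub>v u)"
    if u: "u \<in> carrier_vec d" and v: "v \<in> carrier_vec d" for u v
  proof -
    have "\<bar>u \<bullet> (H x *\<^sub>v v) - v \<bullet> (H x *\<^sub>v u)\<bar> \<le> e" if e: "e > 0" for e
    proof -
      define e' where "e' = e / (2 * (vnorm u * vnorm v + 1))"
      have n: "vnorm u * vnorm v + 1 > 0" by (intro add_nonneg_pos mult_nonneg_nonneg) auto
      have e': "e' > 0" using e n by (simp add: e'_def)
      obtain s1 where s1: "0 < s1" "\<And>a b. 0 < a \<Longrightarrow> a < s1 \<Longrightarrow> 0 < b \<Longrightarrow> b < s1 \<Longrightarrow>
          \<bar>u \<bullet> (H (x + a \<cdot>\<^sub>v u + b \<cdot>\<^sub>v v) *\<^sub>v v) - u \<bullet> (H x *\<^sub>v v)\<bar> \<le> e' * (vnorm u * vnorm v)"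
        using hessian_form_continuous[OF x u v e'] by blast
      obtain s2 where s2: "0 < s2" "\<And>a b. 0 < a \<Longrightarrow> a < s2 \<Longrightarrow> 0 < b \<Longrightarrow> b < s2 \<Longrightarrow>
          \<bar>v \<bullet> (H (x + a \<cdot>\<^sub>v v + b \<cdot>\<^sub>v u) *\<^sub>v u) - v \<bullet> (H x *\<^sub>v u)\<bar> \<le> e' * (vnorm v * vnorm u)"
        using hessian_form_continuous[OF x v u e'] by blast
      define s where "s = min s1 s2"
      have s: "0 < s" using s1 s2 by (simp add: s_def)
      obtain a b where ab: "0 < a" "a < s" "0 < b" "b < s"
        "f (x + s \<cdot>\<^sub>v v + s \<cdot>\<^sub>v u) - f (x + s \<cdot>\<^sub>v u) - f (x + s \<cdot>\<^sub>v v) + f x =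
          s\<^sup>2 * (u \<bullet> (H (x + a \<cdot>\<^sub>v u + b \<cdot>\<^sub>v v) *\<^sub>v v))"
        using second_difference[OF x u v s] by metis
      obtain a' b' where ab': "0 < a'" "a' < s" "0 < b'" "b' < s"
        "f (x + s \<cdot>\<^sub>v u + s \<cdot>\<^sub>v v) - f (x + s \<cdot>\<^sub>v v) - f (x + s \<cdot>\<^sub>v u) + f x =
          s\<^sup>2 * (v \<bullet> (H (x + a' \<cdot>\<^sub>v v + b' \<cdot>\<^sub>v u) *\<^sub>v u))"
        using second_difference[OF x v u s] by metis
      have swap: "x + s \<cdot>\<^sub>v u + s \<cdot>\<^sub>v v = x + s \<cdot>\<^sub>v v + s \<cdot>\<^sub>v u"
        using x u v by (intro eq_vecI) auto
      have "s\<^sup>2 * (u \<bullet> (H (x + a \<cdot>\<^sub>v u + b \<cdot>\<^sub>v v) *\<^sub>v v)) = s\<^sup>2 * (v \<bullet> (H (x + a' \<cdot>\<^sub>v v + b' \<cdot>\<^sub>v u) *\<^sub>v u))"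
        using ab(5) ab'(5) unfolding swap by linarith
      hence "u \<bullet> (H (x + a \<cdot>\<^sub>v u + b \<cdot>\<^sub>v v) *\<^sub>v v) = v \<bullet> (H (x + a' \<cdot>\<^sub>v v + b' \<cdot>\<^sub>v u) *\<^sub>v u)"
        using s by simp
      hence "\<bar>u \<bullet> (H x *\<^sub>v v) - v \<bullet> (H x *\<^sub>v u)\<bar> \<le> 2 * (e' * (vnorm u * vnorm v))"
        using s1(2)[of a b] s2(2)[of a' b'] ab ab' by (simp add: s_def mult.commute abs_le_iff)
      also have "\<dots> \<le> 2 * (e' * (vnorm u * vnorm v + 1))" using e' by simp
      also have "\<dots> = e"
      proof -
        have "2 * (e / (2 * k) * k) = e" if "k > 0" for k :: real using that by simp
        thus ?thesis unfolding e'_def using n by blast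
      qed
      finally show ?thesis .
    qed
    hence "\<bar>u \<bullet> (H x *\<^sub>v v) - v \<bullet> (H x *\<^sub>v u)\<bar> \<le> 0" by (meson dense_ge)
    thus ?thesis by simp
  qed
  have Hx: "H x \<in> carrier_mat d d" by (rule hessian_carrier[OF x])
  show ?thesis
  proof (rule eq_matI)
    fix i j assume "i < dim_row (H x)" "j < dim_col (H x)"
    hence ij: "i < d" "j < d" using Hx by auto
    have "(H x)\<^sup>T $$ (i, j) = unit_vec d j \<bullet> (H x *\<^sub>v unit_vec d i)" using Hx ij by simp
    also have "\<dots> = unit_vec d i \<bullet> (H x *\<^sub>v unit_vec d j)" by (rule form) auto
    also have "\<dots> = H x $$ (i, j)" using Hx ij by simp
    finally show "(H x)\<^sup>T $$ (i, j) = H x $$ (i, j)" .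
  qed (use Hx in auto)
qed

context
  fixes L :: real
  assumes L: "0 \<le> L" and lip: "lipschitz_hessian d H L"
begin

lemma lipschitz_hessian_vec:
  assumes x: "x \<in> carrier_vec d" and p: "p \<in> carrier_vec d" and a: "0 \<le> a" and w: "w \<in> carrier_vec d"
  shows "\<bar>w \<bullet> (H (x + a \<cdot>\<^sub>v p) *\<^sub>v p) - w \<bullet> (H x *\<^sub>v p)\<bar> \<le> L * a * (vnorm p)\<^sup>2 * vnorm w"
proof -
  let ?y = "x + a \<cdot>\<^sub>v p"
  have y: "?y \<in> carrier_vec d" using x p by simp
  have D: "H ?y - H x \<in> carrier_mat d d" using hessian_carrier[OF x] hessian_carrier[OF y] by auto
  have Hp: "H ?y *\<^sub>v p \<in> carrier_vec d" "H x *\<^sub>v p \<in> carrier_vec d"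
    using hessian_carrier[OF x] hessian_carrier[OF y] p by auto
  have yx: "?y - x = a \<cdot>\<^sub>v p" using x p by (intro eq_vecI) auto
  have "spectral_norm (H ?y - H x) \<le> L * vnorm (?y - x)"
    using lip x y unfolding lipschitz_hessian_def by blast
  hence sn: "spectral_norm (H ?y - H x) \<le> L * (a * vnorm p)" using a by (simp add: yx vnorm_smult)
  have "w \<bullet> (H ?y *\<^sub>v p) - w \<bullet> (H x *\<^sub>v p) = w \<bullet> ((H ?y - H x) *\<^sub>v p)"
    using minus_mult_distrib_mat_vec[OF hessian_carrier[OF y] hessian_carrier[OF x] p] w Hp
    by (simp add: scalar_prod_minus_distrib[of _ d])
  also have "\<bar>\<dots>\<bar> \<le> vnorm w * vnorm ((H ?y - H x) *\<^sub>v p)"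
    by (rule scalar_prod_abs_le_vnorm[OF w mult_mat_vec_carrier[OF D p]])
  also have "\<dots> \<le> vnorm w * (spectral_norm (H ?y - H x) * vnorm p)"
    by (intro mult_left_mono vnorm_mult_mat_vec_le_spectral_norm[OF D p]) simp
  also have "\<dots> \<le> vnorm w * (L * (a * vnorm p) * vnorm p)"
    using sn by (intro mult_left_mono mult_right_mono) auto
  finally show ?thesis by (simp add: power2_eq_square mult_ac)
qed

text \<open>Taylor's theorem with second-order remainder. The factor \<open>1 / 2\<close> of the quadratic term has to
  be exact, since \<open>\<rho>\<^sub>S\<close> may be arbitrarily close to \<open>1 / 2\<close>; the constant of the cubic term is not sharp.\<close>

lemma cubic_upper_bound:
  assumes x: "x \<in> carrier_vec d" and p: "p \<in> carrier_vec d" and a: "0 < a"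
  shows "f (x + a \<cdot>\<^sub>v p) \<le> f x + a * (g x \<bullet> p) + a\<^sup>2 / 2 * (p \<bullet> (H x *\<^sub>v p)) + L / 2 * a ^ 3 * (vnorm p) ^ 3"
proof -
  define D where "D m = (if m = 0 then (\<lambda>a. f (x + a \<cdot>\<^sub>v p)) else if m = 1 then (\<lambda>a. p \<bullet> g (x + a \<cdot>\<^sub>v p))
      else (\<lambda>a. p \<bullet> (H (x + a \<cdot>\<^sub>v p) *\<^sub>v p)))" for m :: nat
  have x0: "x + 0 \<cdot>\<^sub>v p = x" using x p by (intro eq_vecI) auto
  have der: "(D m has_real_derivative D (Suc m) t) (at t)" if "m < 2" for m t
  proof -
    have c: "x + t \<cdot>\<^sub>v p \<in> carrier_vec d" using x p by simp
    have "m = 0 \<or> m = 1" using that by auto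
    thus ?thesis
      using line_derivative[OF x p, of t] line_gradient_derivative[OF x p p, of t]
        comm_scalar_prod[OF gradient_carrier[OF c] p] by (auto simp: D_def)
  qed
  from Maclaurin[of a 2 D "D 0"] a der obtain t where t: "0 < t" "t < a"
    "D 0 a = (\<Sum>m<2. D m 0 / fact m * a ^ m) + D 2 t / fact 2 * a\<^sup>2" by auto
  have "f (x + a \<cdot>\<^sub>v p) = f x + a * (p \<bullet> g x) + a\<^sup>2 / 2 * (p \<bullet> (H (x + t \<cdot>\<^sub>v p) *\<^sub>v p))"
    using t(3) by (simp add: D_def x0 numeral_2_eq_2)
  also have "\<dots> \<le> f x + a * (p \<bullet> g x) + a\<^sup>2 / 2 * (p \<bullet> (H x *\<^sub>v p) + L * a * (vnorm p)\<^sup>2 * vnorm p)"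
  proof -
    have "p \<bullet> (H (x + t \<cdot>\<^sub>v p) *\<^sub>v p) \<le> p \<bullet> (H x *\<^sub>v p) + L * t * (vnorm p)\<^sup>2 * vnorm p"
      using lipschitz_hessian_vec[OF x p less_imp_le[OF t(1)] p] by linarith
    also have "L * t * (vnorm p)\<^sup>2 * vnorm p \<le> L * a * (vnorm p)\<^sup>2 * vnorm p"
      using t L by (intro mult_right_mono mult_left_mono) auto
    finally show ?thesis by (intro add_left_mono mult_left_mono) auto
  qed
  also have "\<dots> = f x + a * (g x \<bullet> p) + a\<^sup>2 / 2 * (p \<bullet> (H x *\<^sub>v p)) + L / 2 * a ^ 3 * (vnorm p) ^ 3"
    using comm_scalar_prod[OF gradient_carrier[OF x] p]
    by (simp add: power2_eq_square power3_eq_cube algebra_simps)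
  finally show ?thesis .
qed

text \<open>The mean value theorem is applied in the direction \<open>w\<close> of the linearisation error itself.\<close>

lemma gradient_after_unit_step:
  assumes x: "x \<in> carrier_vec d" and p: "p \<in> carrier_vec d"
  shows "vnorm (g (x + p)) \<le> vnorm (H x *\<^sub>v p + g x) + L * (vnorm p)\<^sup>2"
proof -
  have xp: "x + p \<in> carrier_vec d" using x p by simp
  have Hp: "H x *\<^sub>v p \<in> carrier_vec d" using hessian_carrier[OF x] p by auto
  define w where "w = g (x + p) - (H x *\<^sub>v p + g x)"
  have w: "w \<in> carrier_vec d" using gradient_carrier[OF xp] gradient_carrier[OF x] Hp by (auto simp: w_def)
  obtain t where t: "0 < t" "t < 1"
    "w \<bullet> g (x + 1 \<cdot>\<^sub>v p) - w \<bullet> g (x + 0 \<cdot>\<^sub>v p) = (1 - 0) * (w \<bullet> (H (x + t \<cdot>\<^sub>v p) *\<^sub>v p))"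
    using MVT2[of 0 1 "\<lambda>a. w \<bullet> g (x + a \<cdot>\<^sub>v p)", OF _ line_gradient_derivative[OF x p w]] by auto
  have e: "x + 1 \<cdot>\<^sub>v p = x + p" "x + 0 \<cdot>\<^sub>v p = x" using x p by (auto intro!: eq_vecI)
  have "w \<bullet> w = w \<bullet> g (x + p) - w \<bullet> g x - w \<bullet> (H x *\<^sub>v p)"
    using w gradient_carrier[OF xp] gradient_carrier[OF x] Hp
    by (subst (2) w_def) (simp add: scalar_prod_minus_distrib[of _ d] scalar_prod_add_distrib[of _ d])
  also have "\<dots> = w \<bullet> (H (x + t \<cdot>\<^sub>v p) *\<^sub>v p) - w \<bullet> (H x *\<^sub>v p)" using t(3) unfolding e by simp
  also have "\<dots> \<le> L * t * (vnorm p)\<^sup>2 * vnorm w"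
    using lipschitz_hessian_vec[OF x p less_imp_le[OF t(1)] w] by linarith
  also have "\<dots> \<le> L * 1 * (vnorm p)\<^sup>2 * vnorm w"
    using t L by (intro mult_right_mono mult_left_mono) auto
  finally have "vnorm w * vnorm w \<le> (L * (vnorm p)\<^sup>2) * vnorm w"
    by (simp add: vnorm_square[symmetric] power2_eq_square)
  hence wle: "vnorm w \<le> L * (vnorm p)\<^sup>2"
    using vnorm_nonneg[of w] L by (cases "vnorm w = 0") auto
  have "g (x + p) = (H x *\<^sub>v p + g x) + w"
    unfolding w_def using gradient_carrier[OF xp] gradient_carrier[OF x] Hp hessian_carrier[OF x]
    by (intro eq_vecI) auto
  hence "vnorm (g (x + p)) \<le> vnorm (H x *\<^sub>v p + g x) + vnorm w"
    using vnorm_triangle[of "H x *\<^sub>v p + g x" d w] Hp gradient_carrier[OF x] w by simp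
  thus ?thesis using wle by linarith
qed

end

end

section \<open>The two kinds of steps\<close>

text \<open>The admissible steps in \<open>[a, b]\<close> form a compact set. Staying above \<open>a\<close> keeps the maximum away from
  the excluded step length \<open>0\<close>.\<close>

lemma largest_step_exists:
  fixes \<psi> :: "real \<Rightarrow> real"
  assumes cont: "continuous_on UNIV \<psi>" and a: "0 < a" "a \<le> b" "\<psi> a \<le> 0"
  obtains \<alpha> where "a \<le> \<alpha>" "\<alpha> \<le> b" "\<psi> \<alpha> \<le> 0" "\<And>\<beta>. \<beta> \<le> b \<Longrightarrow> \<psi> \<beta> \<le> 0 \<Longrightarrow> \<beta> \<le> \<alpha>"
proof -
  have "closed {\<beta>. \<psi> \<beta> \<le> 0}" by (intro closed_Collect_le cont continuous_on_const)
  hence "compact ({a..b} \<inter> {\<beta>. \<psi> \<beta> \<le> 0})" by (intro compact_Int_closed compact_Icc)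
  moreover have "{a..b} \<inter> {\<beta>. \<psi> \<beta> \<le> 0} \<noteq> {}" using a by force
  ultimately obtain \<alpha> where \<alpha>: "\<alpha> \<in> {a..b} \<inter> {\<beta>. \<psi> \<beta> \<le> 0}"
    "\<And>\<beta>. \<beta> \<in> {a..b} \<inter> {\<beta>. \<psi> \<beta> \<le> 0} \<Longrightarrow> \<beta> \<le> \<alpha>"
    using compact_attains_sup by metis
  have "\<beta> \<le> \<alpha>" if "\<beta> \<le> b" "\<psi> \<beta> \<le> 0" for \<beta>
  proof (cases "a \<le> \<beta>")
    case False
    thus ?thesis using \<alpha>(1) by auto
  qed (use \<alpha>(2)[of \<beta>] that in auto)
  thus thesis using \<alpha>(1) that by auto
qed

text \<open>With nonpositive curvature the quadratic term helps, and the cubic term is dominated up to a step of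
  order \<open>1 / sqrt \<parallel>p\<parallel>\<close>. Since \<open>f\<close> is bounded below and the slope is negative, the admissible steps are
  bounded, so there is a largest one.\<close>

lemma npc_step:
  assumes C2: "twice_continuously_differentiable d f g H" and L: "0 \<le> L" and lip: "lipschitz_hessian d H L"
    and \<rho>: "0 < \<rho>\<^sub>N" "\<rho>\<^sub>N < 1"
    and low: "\<And>y. y \<in> carrier_vec d \<Longrightarrow> m \<le> f y"
    and x: "x \<in> carrier_vec d" and p: "p \<in> carrier_vec d" "p \<noteq> 0\<^sub>v d"
    and curv: "p \<bullet> (H x *\<^sub>v p) \<le> 0" and slope: "g x \<bullet> p = - (vnorm p)\<^sup>2"
  obtains \<alpha> where "line_search f g \<rho>\<^sub>S \<rho>\<^sub>N x p NPC \<alpha>"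
    "\<rho>\<^sub>N * sqrt ((1 - \<rho>\<^sub>N) / (L + 1)) * (vnorm p * sqrt (vnorm p)) \<le> f x - f (x + \<alpha> \<cdot>\<^sub>v p)"
proof -
  define n where "n = vnorm p"
  have n: "n > 0" unfolding n_def using vnorm_eq_0_iff[OF p(1)] p(2) vnorm_nonneg[of p] by linarith
  define \<psi> where "\<psi> \<beta> = f (x + \<beta> \<cdot>\<^sub>v p) - (f x + \<rho>\<^sub>N * \<beta> * (g x \<bullet> p))" for \<beta>
  have cont: "continuous_on UNIV \<psi>"
    unfolding \<psi>_def by (intro continuous_intros line_continuous[OF C2 x p(1)])
  define a where "a = sqrt ((1 - \<rho>\<^sub>N) / ((L + 1) * n))"
  have a0: "a > 0" using \<rho> L n by (simp add: a_def)
  have a2: "a\<^sup>2 * n = (1 - \<rho>\<^sub>N) / (L + 1)" using \<rho> L n by (simp add: a_def)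
  have "\<psi> a \<le> a * n\<^sup>2 * (L / 2 * (a\<^sup>2 * n) - (1 - \<rho>\<^sub>N))"
  proof -
    have "a\<^sup>2 / 2 * (p \<bullet> (H x *\<^sub>v p)) \<le> 0" using curv by (simp add: mult_nonneg_nonpos)
    hence "\<psi> a \<le> a * (g x \<bullet> p) + L / 2 * a ^ 3 * n ^ 3 - \<rho>\<^sub>N * a * (g x \<bullet> p)"
      using cubic_upper_bound[OF C2 L lip x p(1) a0] unfolding \<psi>_def n_def by linarith
    thus ?thesis unfolding slope n_def[symmetric]
      by (simp add: power2_eq_square power3_eq_cube algebra_simps)
  qed
  also have "\<dots> \<le> 0"
  proof -
    have "L / 2 * ((1 - \<rho>\<^sub>N) / (L + 1)) = L / (2 * (L + 1)) * (1 - \<rho>\<^sub>N)" by simp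
    also have "\<dots> \<le> 1 * (1 - \<rho>\<^sub>N)"
      using L \<rho> by (intro mult_right_mono) (auto simp: divide_le_eq)
    finally have "L / 2 * ((1 - \<rho>\<^sub>N) / (L + 1)) \<le> 1 * (1 - \<rho>\<^sub>N)" .
    thus ?thesis unfolding a2 using a0 by (intro mult_nonneg_nonpos) auto
  qed
  finally have \<psi>a: "\<psi> a \<le> 0" .
  define b where "b = (f x - m) / (\<rho>\<^sub>N * n\<^sup>2)"
  have ub: "\<beta> \<le> b" if "\<psi> \<beta> \<le> 0" for \<beta>
  proof -
    have "m \<le> f (x + \<beta> \<cdot>\<^sub>v p)" using x p by (intro low) auto
    hence "m \<le> f x - \<rho>\<^sub>N * \<beta> * n\<^sup>2" using that unfolding \<psi>_def slope n_def by simp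
    thus ?thesis unfolding b_def using \<rho> n by (simp add: pos_le_divide_eq mult_ac)
  qed
  obtain \<alpha> where \<alpha>: "a \<le> \<alpha>" "\<psi> \<alpha> \<le> 0" "\<And>\<beta>. \<psi> \<beta> \<le> 0 \<Longrightarrow> \<beta> \<le> \<alpha>"
    using largest_step_exists[OF cont a0 ub[OF \<psi>a] \<psi>a] ub by metis
  have "line_search f g \<rho>\<^sub>S \<rho>\<^sub>N x p NPC \<alpha>"
    unfolding line_search_def Let_def using \<alpha> a0 by (auto simp: \<psi>_def)
  moreover have "\<rho>\<^sub>N * sqrt ((1 - \<rho>\<^sub>N) / (L + 1)) * (n * sqrt n) \<le> f x - f (x + \<alpha> \<cdot>\<^sub>v p)"
  proof -
    have "a * n\<^sup>2 = sqrt ((1 - \<rho>\<^sub>N) / (L + 1)) * (n * sqrt n)"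
    proof -
      define q where "q = sqrt n"
      have q: "q > 0" using n by (simp add: q_def)
      have "a = sqrt ((1 - \<rho>\<^sub>N) / (L + 1)) / q"
        unfolding a_def q_def by (simp add: real_sqrt_divide real_sqrt_mult)
      moreover have "n\<^sup>2 = n * (q * q)" using n by (simp add: power2_eq_square q_def)
      ultimately have "a * n\<^sup>2 = sqrt ((1 - \<rho>\<^sub>N) / (L + 1)) / q * (n * (q * q))" by simp
      also have "\<dots> = sqrt ((1 - \<rho>\<^sub>N) / (L + 1)) * (n * q)" using q by simp
      finally show ?thesis by (simp add: q_def)
    qed
    hence "\<rho>\<^sub>N * sqrt ((1 - \<rho>\<^sub>N) / (L + 1)) * (n * sqrt n) = \<rho>\<^sub>N * (a * n\<^sup>2)" by simp
    also have "\<dots> \<le> \<rho>\<^sub>N * (\<alpha> * n\<^sup>2)" using \<alpha>(1) \<rho> by (intro mult_left_mono mult_right_mono) auto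
    also have "\<dots> \<le> f x - f (x + \<alpha> \<cdot>\<^sub>v p)" using \<alpha>(2) unfolding \<psi>_def slope n_def by (simp add: mult_ac)
    finally show ?thesis .
  qed
  ultimately show thesis using that unfolding n_def by blast
qed

text \<open>A step of length at most \<open>1\<close> is admissible as long as the displacement \<open>a \<parallel>p\<parallel>\<close> is at most \<open>\<kappa>\<close>: then the
  cubic term is dominated by the part of the curvature term left over since \<open>\<rho>\<^sub>S < 1 / 2\<close>. Either the unit
  step qualifies, or \<open>p\<close> is longer than \<open>\<kappa>\<close> and the decrease is bounded below by a constant.\<close>

lemma sol_step:
  assumes C2: "twice_continuously_differentiable d f g H" and L: "0 \<le> L" and lip: "lipschitz_hessian d H L"
    and \<rho>: "0 < \<rho>\<^sub>S" "\<rho>\<^sub>S < 1/2" and \<sigma>: "0 < \<sigma>"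
    and x: "x \<in> carrier_vec d" and p: "p \<in> carrier_vec d"
    and curv: "\<sigma> * (vnorm p)\<^sup>2 \<le> p \<bullet> (H x *\<^sub>v p)" and slope: "g x \<bullet> p \<le> - (p \<bullet> (H x *\<^sub>v p))"
  defines "\<kappa> \<equiv> (1 - 2 * \<rho>\<^sub>S) * \<sigma> / (L + 1)"
  obtains \<alpha> where "line_search f g \<rho>\<^sub>S \<rho>\<^sub>N x p SOL \<alpha>"
    "\<alpha> = 1 \<and> \<rho>\<^sub>S * \<sigma> * (vnorm p)\<^sup>2 \<le> f x - f (x + \<alpha> \<cdot>\<^sub>v p) \<or>
     \<rho>\<^sub>S * \<sigma> * \<kappa>\<^sup>2 \<le> f x - f (x + \<alpha> \<cdot>\<^sub>v p)"
proof -
  define n where "n = vnorm p"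
  define S where "S = p \<bullet> (H x *\<^sub>v p)"
  have n: "n \<ge> 0" by (simp add: n_def)
  have S: "\<sigma> * n\<^sup>2 \<le> S" "g x \<bullet> p \<le> - S" using curv slope by (auto simp: S_def n_def)
  have S0: "0 \<le> S" using S(1) \<sigma> by (meson less_imp_le mult_nonneg_nonneg order_trans zero_le_power2)
  have \<kappa>: "\<kappa> > 0" using \<rho> \<sigma> L by (simp add: \<kappa>_def)
  define \<psi> where "\<psi> \<beta> = f (x + \<beta> \<cdot>\<^sub>v p) - (f x + \<rho>\<^sub>S * \<beta> * (g x \<bullet> p))" for \<beta>
  have cont: "continuous_on UNIV \<psi>"
    unfolding \<psi>_def by (intro continuous_intros line_continuous[OF C2 x p(1)])
  have adm: "\<psi> a \<le> 0" if a: "0 < a" "a \<le> 1" "a * n \<le> \<kappa>" for a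
  proof -
    have "L * (a * (a * n)) \<le> L * (1 * \<kappa>)" using a n \<kappa> L by (intro mult_left_mono mult_mono) auto
    also have "\<dots> \<le> (1 - 2 * \<rho>\<^sub>S) * \<sigma>" using L \<rho> \<sigma> by (simp add: \<kappa>_def field_simps)
    finally have "L * (a * (a * n)) * n\<^sup>2 \<le> (1 - 2 * \<rho>\<^sub>S) * \<sigma> * n\<^sup>2" by (intro mult_right_mono) auto
    also have "\<dots> \<le> (1 - 2 * \<rho>\<^sub>S) * S" using S(1) \<rho> by (simp add: mult.assoc)
    finally have le: "L / 2 * a\<^sup>2 * n ^ 3 \<le> (1/2 - \<rho>\<^sub>S) * S"
      by (simp add: power2_eq_square power3_eq_cube algebra_simps)
    have "\<psi> a \<le> (1 - \<rho>\<^sub>S) * a * (g x \<bullet> p) + a * (a * S / 2) + L / 2 * a ^ 3 * n ^ 3"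
      using cubic_upper_bound[OF C2 L lip x p a(1)] unfolding \<psi>_def n_def[symmetric] S_def[symmetric]
      by (simp add: power2_eq_square algebra_simps)
    also have "\<dots> \<le> (1 - \<rho>\<^sub>S) * a * (- S) + a * (1 * S / 2) + L / 2 * a ^ 3 * n ^ 3"
      using S S0 a \<rho> L by (intro add_mono mult_left_mono divide_right_mono mult_right_mono) auto
    also have "\<dots> = a * (L / 2 * a\<^sup>2 * n ^ 3 - (1/2 - \<rho>\<^sub>S) * S)"
      by (simp add: power2_eq_square power3_eq_cube algebra_simps)
    also have "\<dots> \<le> 0" using a(1) le by (intro mult_nonneg_nonpos) auto
    finally show ?thesis .
  qed
  have dec: "\<rho>\<^sub>S * \<sigma> * (\<alpha> * n\<^sup>2) \<le> f x - f (x + \<alpha> \<cdot>\<^sub>v p)" if "\<psi> \<alpha> \<le> 0" "0 \<le> \<alpha>" for \<alpha>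
  proof -
    have "\<rho>\<^sub>S * \<alpha> * (\<sigma> * n\<^sup>2) \<le> \<rho>\<^sub>S * \<alpha> * (- (g x \<bullet> p))"
      using S that \<rho> by (intro mult_left_mono) auto
    thus ?thesis using that unfolding \<psi>_def by (simp add: mult_ac)
  qed
  define a where "a = (if n \<le> \<kappa> then 1 else \<kappa> / n)"
  have a: "0 < a" "a \<le> 1" "a * n \<le> \<kappa>" using \<kappa> n by (auto simp: a_def)
  obtain \<alpha> where \<alpha>: "a \<le> \<alpha>" "\<alpha> \<le> 1" "\<psi> \<alpha> \<le> 0" "\<And>\<beta>. \<beta> \<le> 1 \<Longrightarrow> \<psi> \<beta> \<le> 0 \<Longrightarrow> \<beta> \<le> \<alpha>"
    using largest_step_exists[OF cont a(1,2) adm[OF a]] by metis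
  have ls: "line_search f g \<rho>\<^sub>S \<rho>\<^sub>N x p SOL \<alpha>"
    unfolding line_search_def Let_def using \<alpha> a by (auto simp: \<psi>_def)
  show thesis
  proof (cases "n \<le> \<kappa>")
    case True
    hence "\<alpha> = 1" using \<alpha>(1,2) by (simp add: a_def)
    thus thesis using that[OF ls] dec[OF \<alpha>(3)] by (simp add: n_def)
  next
    case False
    hence "\<kappa>\<^sup>2 \<le> a * n\<^sup>2" using \<kappa> by (simp add: a_def power2_eq_square)
    also have "\<dots> \<le> \<alpha> * n\<^sup>2" using \<alpha>(1) by (intro mult_right_mono) auto
    finally have "\<rho>\<^sub>S * \<sigma> * \<kappa>\<^sup>2 \<le> \<rho>\<^sub>S * \<sigma> * (\<alpha> * n\<^sup>2)" using \<rho> \<sigma> by (intro mult_left_mono) auto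
    also have "\<dots> \<le> f x - f (x + \<alpha> \<cdot>\<^sub>v p)" using \<alpha> a by (intro dec) auto
    finally show thesis using that[OF ls] by blast
  qed
qed

section \<open>Counting evaluations\<close>

text \<open>Bernoulli's inequality for the square root of \<open>1 / q\<close> gives the order \<open>1 / sqrt y\<close>; applied to \<open>1 / q\<close>
  directly it would give only \<open>1 / y\<close>, and with \<open>y\<close> of order \<open>\<epsilon>\<^sub>g\<close> this is too much for a step whose
  decrease is of order \<open>\<epsilon>\<^sub>g\<close>.\<close>

lemma geometric_count:
  fixes q y :: real
  assumes q: "0 < q" "q < 1" and y: "0 < y" "y \<le> q ^ n"
  shows "real n \<le> 1 / ((1 / sqrt q - 1) * sqrt y)"
proof -
  define b where "b = 1 / sqrt q"
  have b: "b > 1" using q by (simp add: b_def)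
  have "1 + real n * (b - 1) \<le> (1 + (b - 1)) ^ n" using b by (intro Bernoulli_inequality) auto
  hence "real n * (b - 1) \<le> b ^ n" by simp
  hence "real n * (b - 1) * sqrt y \<le> b ^ n * sqrt y" using y by (intro mult_right_mono) auto
  also have "\<dots> \<le> b ^ n * sqrt (q ^ n)" using y b by (intro mult_left_mono) auto
  also have "\<dots> = (b * sqrt q) ^ n" by (simp add: real_sqrt_power power_mult_distrib)
  also have "\<dots> = 1" using q by (simp add: b_def)
  finally have "real n * ((b - 1) * sqrt y) \<le> 1" by (simp add: mult.assoc)
  thus ?thesis using b y unfolding b_def[symmetric] by (simp add: pos_le_divide_eq)
qed

text \<open>One outer iteration with all constants explicit, so that they visibly depend on neither the dimension
  nor \<open>\<epsilon>\<close>. The constant \<open>M\<close> bounds the Hessian on the Krylov spaces and exceeds \<open>\<sigma>\<close>, which keeps the decay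
  factor strictly between \<open>0\<close> and \<open>1\<close>. The first alternative belongs to the flag \<open>NPC\<close>, the second to
  \<open>SOL\<close>.\<close>

lemma newton_mr_step:
  fixes L\<^sub>g L\<^sub>H \<sigma> \<omega> \<theta> \<rho>\<^sub>S \<rho>\<^sub>N :: real
  assumes pos: "0 \<le> L\<^sub>g" "0 \<le> L\<^sub>H" "0 < \<sigma>" "0 < \<omega>" "0 < \<theta>"
    and \<rho>: "0 < \<rho>\<^sub>S" "\<rho>\<^sub>S < 1/2" "0 < \<rho>\<^sub>N" "\<rho>\<^sub>N < 1"
    and \<epsilon>: "0 < \<epsilon>" "\<epsilon> \<le> 1"
    and C2: "twice_continuously_differentiable d f g H"
    and low: "\<forall>y\<in>carrier_vec d. m \<le> f y"
    and bd: "relevant_hessian_bounded d g H L\<^sub>g" and lip: "lipschitz_hessian d H L\<^sub>H"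
    and regI: "krylov_regularity_I d g H \<sigma>"
    and x: "x \<in> carrier_vec d" and gx: "vnorm (g x) > \<epsilon>"
    and regII: "\<forall>t p. minres_returns (H x) (g x) (\<theta> * sqrt \<epsilon>) t p NPC \<longrightarrow> vnorm p \<ge> \<omega> * vnorm (g x)"
  defines "M \<equiv> L\<^sub>g + \<sigma> + 1"
  defines "\<delta> \<equiv> 1 / sqrt (1 - \<sigma>\<^sup>2 / M\<^sup>2) - 1"
  defines "c \<equiv> min 1 (1 / (\<theta> * M / \<sigma> + (L\<^sub>H + 1)))"
  defines "\<kappa> \<equiv> (1 - 2 * \<rho>\<^sub>S) * \<sigma> / (L\<^sub>H + 1)"
  obtains t p flag \<alpha> where "p \<in> carrier_vec d"
    "minres_returns (H x) (g x) (\<theta> * sqrt \<epsilon>) t p flag" "line_search f g \<rho>\<^sub>S \<rho>\<^sub>N x p flag \<alpha>"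
    "real (1 + t) \<le> 2 + 1 / (\<delta> * \<omega>) \<and>
       \<rho>\<^sub>N * sqrt ((1 - \<rho>\<^sub>N) / (L\<^sub>H + 1)) * (\<omega> * sqrt \<omega>) * (\<epsilon> * sqrt \<epsilon>) \<le> f x - f (x + \<alpha> \<cdot>\<^sub>v p) \<or>
     real (1 + t) \<le> (3 + sqrt (M\<^sup>2 + \<theta>\<^sup>2) / (\<delta> * \<theta>)) / sqrt \<epsilon> \<and>
       (vnorm (g (x + \<alpha> \<cdot>\<^sub>v p)) \<le> \<epsilon> \<or> \<rho>\<^sub>S * \<sigma> * min (c\<^sup>2) (\<kappa>\<^sup>2) * \<epsilon> \<le> f x - f (x + \<alpha> \<cdot>\<^sub>v p))"
proof -
  have Hx: "H x \<in> carrier_mat d d" by (rule hessian_carrier[OF C2 x])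
  have sym: "(H x)\<^sup>T = H x" by (rule hessian_symmetric[OF C2 x])
  have gc: "g x \<in> carrier_vec d" by (rule gradient_carrier[OF C2 x])
  have g0: "g x \<noteq> 0\<^sub>v d" using gx \<epsilon> by auto
  have ng: "vnorm (g x) > 0" using gx \<epsilon> by linarith
  have M: "M > 0" "\<sigma> < M" "L\<^sub>g \<le> M" using pos by (auto simp: M_def)
  define \<eta> where "\<eta> = \<theta> * sqrt \<epsilon>"
  have \<eta>: "\<eta> > 0" using pos \<epsilon> by (simp add: \<eta>_def)
  define q where "q = 1 - \<sigma>\<^sup>2 / M\<^sup>2"
  have "\<sigma>\<^sup>2 < M\<^sup>2" using M pos by (intro power_strict_mono) auto
  hence q: "0 < q" "q < 1" using M pos by (auto simp: q_def)
  have \<delta>: "\<delta> = 1 / sqrt q - 1" "\<delta> > 0" using q by (auto simp: \<delta>_def q_def[symmetric])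
  have bounded: "\<forall>t. \<forall>v\<in>krylov (H x) (g x) t. vnorm (H x *\<^sub>v v) \<le> M * vnorm v"
  proof (intro allI ballI)
    fix t v assume v: "v \<in> krylov (H x) (g x) t"
    have vc: "v \<in> carrier_vec d" using krylov_carrier[OF Hx gc] v by auto
    have "vnorm (H x *\<^sub>v v) \<le> L\<^sub>g * vnorm v"
    proof (rule vnorm_mult_mat_vec_le_relevant[OF Hx sym pos(1) _ vc])
      show "spectral_norm (U\<^sup>T * H x * U) \<le> L\<^sub>g" if "is_U (H x) (g x) U" for U
        using bd x that unfolding relevant_hessian_bounded_def by blast
      fix l u assume l: "l \<notin> relevant (H x) (g x)" and u: "u \<in> eigenspace (H x) l"
      hence uc: "u \<in> carrier_vec d" and Hu: "H x *\<^sub>v u = l \<cdot>\<^sub>v u"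
        unfolding eigenspace_eq[OF Hx] by auto
      have "u \<bullet> g x = 0"
      proof (cases "u = 0\<^sub>v d")
        case False
        hence "eigenvalue (H x) l" using uc Hu Hx unfolding eigenvalue_def eigenvector_def by auto
        thus ?thesis using l u unfolding relevant_def by blast
      qed (use gc in simp)
      thus "u \<bullet> v = 0" by (rule orthogonal_eigenvector_krylov[OF Hx gc sym uc Hu _ v])
    qed
    also have "\<dots> \<le> M * vnorm v" using M by (intro mult_right_mono) auto
    finally show "vnorm (H x *\<^sub>v v) \<le> M * vnorm v" .
  qed
  have regular: "\<forall>m t. is_grade (H x) (g x) m \<and> t \<le> m \<and> (\<forall>i\<in>{1..t}. \<not> npc_detected (H x) (g x) i) \<longrightarrow>
      (\<forall>s\<in>krylov (H x) (g x) t. s \<bullet> (H x *\<^sub>v s) \<ge> \<sigma> * (vnorm s)\<^sup>2)"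
    using regI x unfolding krylov_regularity_I_def by blast
  obtain t p flag where ret: "minres_returns (H x) (g x) \<eta> t p flag"
    using minres_returns_exists[OF Hx sym gc pos(3) M(1) regular bounded \<eta> g0] q
    unfolding q_def by auto
  show thesis
  proof (cases flag)
    case NPC
    note ret = ret[unfolded NPC]
    note npc = minres_returns_npc[OF Hx sym gc pos(3) M(1) regular bounded ret \<eta>]
    have t1: "1 \<le> t" using ret by (simp add: minres_returns_def)
    have big: "\<omega> * vnorm (g x) \<le> vnorm p" using regII ret unfolding \<eta>_def by simp
    have "\<omega>\<^sup>2 * (vnorm (g x))\<^sup>2 \<le> (vnorm p)\<^sup>2"
      using power_mono[OF big, of 2] pos by (simp add: power_mult_distrib)
    also have "\<dots> \<le> q ^ (t - 1) * (vnorm (g x))\<^sup>2" unfolding q_def by (rule npc(5))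
    finally have "\<omega>\<^sup>2 \<le> q ^ (t - 1)" using ng by simp
    hence "real (t - 1) \<le> 1 / (\<delta> * \<omega>)"
      using geometric_count[OF q, of "\<omega>\<^sup>2" "t - 1"] pos unfolding \<delta>(1) by simp
    hence count: "real (1 + t) \<le> 2 + 1 / (\<delta> * \<omega>)" using t1 by (simp add: of_nat_diff)
    obtain \<alpha> where \<alpha>: "line_search f g \<rho>\<^sub>S \<rho>\<^sub>N x p NPC \<alpha>"
      "\<rho>\<^sub>N * sqrt ((1 - \<rho>\<^sub>N) / (L\<^sub>H + 1)) * (vnorm p * sqrt (vnorm p)) \<le> f x - f (x + \<alpha> \<cdot>\<^sub>v p)"
      using npc_step[OF C2 pos(2) lip \<rho>(3,4) bspec[OF low] x npc(1-4)] by metis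
    have "\<omega> * \<epsilon> \<le> \<omega> * vnorm (g x)" using gx pos by simp
    hence big': "\<omega> * \<epsilon> \<le> vnorm p" using big by linarith
    have "(\<omega> * \<epsilon>) * sqrt (\<omega> * \<epsilon>) \<le> vnorm p * sqrt (vnorm p)"
      using big' pos \<epsilon> by (intro mult_mono) auto
    hence "\<omega> * sqrt \<omega> * (\<epsilon> * sqrt \<epsilon>) \<le> vnorm p * sqrt (vnorm p)"
      by (simp add: real_sqrt_mult mult_ac)
    hence "\<rho>\<^sub>N * sqrt ((1 - \<rho>\<^sub>N) / (L\<^sub>H + 1)) * (\<omega> * sqrt \<omega> * (\<epsilon> * sqrt \<epsilon>)) \<le>
        \<rho>\<^sub>N * sqrt ((1 - \<rho>\<^sub>N) / (L\<^sub>H + 1)) * (vnorm p * sqrt (vnorm p))"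
      using \<rho> pos by (intro mult_left_mono) auto
    hence "\<rho>\<^sub>N * sqrt ((1 - \<rho>\<^sub>N) / (L\<^sub>H + 1)) * (\<omega> * sqrt \<omega>) * (\<epsilon> * sqrt \<epsilon>) \<le> f x - f (x + \<alpha> \<cdot>\<^sub>v p)"
      using \<alpha>(2) by (simp add: mult.assoc)
    thus thesis using that[OF npc(1) ret[unfolded \<eta>_def] \<alpha>(1)] count by blast
  next
    case SOL
    note ret = ret[unfolded SOL]
    note sol = minres_returns_sol[OF Hx sym gc pos(3) M(1) regular bounded ret \<eta> g0]
    have se: "sqrt \<epsilon> > 0" "sqrt \<epsilon> \<le> 1" using \<epsilon> by auto
    have "real (t - 2) \<le> sqrt (M\<^sup>2 + \<theta>\<^sup>2) / (\<delta> * \<theta>) / sqrt \<epsilon>"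
    proof (cases "2 \<le> t")
      case True
      define y where "y = \<eta>\<^sup>2 / (M\<^sup>2 + \<theta>\<^sup>2)"
      have P: "M\<^sup>2 + \<theta>\<^sup>2 > 0" using M by (intro add_pos_nonneg) auto
      have y: "y > 0" using \<eta> P by (simp add: y_def)
      have sy: "sqrt y = \<theta> * sqrt \<epsilon> / sqrt (M\<^sup>2 + \<theta>\<^sup>2)"
        using \<eta> by (simp add: y_def real_sqrt_divide \<eta>_def)
      have "\<eta>\<^sup>2 \<le> \<theta>\<^sup>2" using \<epsilon> pos by (simp add: \<eta>_def power_mult_distrib mult_left_le)
      hence "(M\<^sup>2 + \<eta>\<^sup>2) * q ^ (t - 2) \<le> (M\<^sup>2 + \<theta>\<^sup>2) * q ^ (t - 2)"
        using q by (intro mult_right_mono) auto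
      hence "\<eta>\<^sup>2 \<le> (M\<^sup>2 + \<theta>\<^sup>2) * q ^ (t - 2)" using sol(5)[OF True] unfolding q_def by linarith
      hence "y \<le> q ^ (t - 2)" unfolding y_def using P by (simp add: pos_divide_le_eq mult.commute)
      from geometric_count[OF q y this] show ?thesis unfolding \<delta>(1)[symmetric] sy by simp
    next
      case False
      thus ?thesis using \<delta> pos se by (simp add: divide_nonneg_nonneg)
    qed
    moreover have "real (1 + t) \<le> 3 + real (t - 2)" by linarith
    moreover have "3 \<le> 3 / sqrt \<epsilon>" using se by (simp add: pos_le_divide_eq)
    ultimately have count: "real (1 + t) \<le> (3 + sqrt (M\<^sup>2 + \<theta>\<^sup>2) / (\<delta> * \<theta>)) / sqrt \<epsilon>"
      by (simp add: add_divide_distrib)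
    obtain \<alpha> where \<alpha>: "line_search f g \<rho>\<^sub>S \<rho>\<^sub>N x p SOL \<alpha>"
      "\<alpha> = 1 \<and> \<rho>\<^sub>S * \<sigma> * (vnorm p)\<^sup>2 \<le> f x - f (x + \<alpha> \<cdot>\<^sub>v p) \<or>
       \<rho>\<^sub>S * \<sigma> * \<kappa>\<^sup>2 \<le> f x - f (x + \<alpha> \<cdot>\<^sub>v p)"
      using sol_step[OF C2 pos(2) lip \<rho>(1,2) pos(3) x sol(1-3)] unfolding \<kappa>_def by metis
    have rs: "\<rho>\<^sub>S * \<sigma> > 0" using \<rho> pos by simp
    have "vnorm (g (x + \<alpha> \<cdot>\<^sub>v p)) \<le> \<epsilon> \<or> \<rho>\<^sub>S * \<sigma> * min (c\<^sup>2) (\<kappa>\<^sup>2) * \<epsilon> \<le> f x - f (x + \<alpha> \<cdot>\<^sub>v p)"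
      using \<alpha>(2)
    proof
      assume A: "\<alpha> = 1 \<and> \<rho>\<^sub>S * \<sigma> * (vnorm p)\<^sup>2 \<le> f x - f (x + \<alpha> \<cdot>\<^sub>v p)"
      define D where "D = \<theta> * M / \<sigma> + (L\<^sub>H + 1)"
      have "\<theta> * M / \<sigma> > 0" using pos M by simp
      hence D: "D > 0" using pos by (simp add: D_def)
      have cD: "c = min 1 (1 / D)" unfolding c_def D_def ..
      have c: "c > 0" "c \<le> 1" using D by (auto simp: cD)
      have "c \<le> 1 / D" by (simp add: cD)
      hence cD1: "c * D \<le> 1" using D by (simp add: pos_le_divide_eq)
      show ?thesis
      proof (cases "c * sqrt \<epsilon> \<le> vnorm p")
        case True
        hence "(c * sqrt \<epsilon>)\<^sup>2 \<le> (vnorm p)\<^sup>2" using c se by (intro power_mono) auto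
        hence "c\<^sup>2 * \<epsilon> \<le> (vnorm p)\<^sup>2" using \<epsilon> by (simp add: power_mult_distrib)
        moreover have "min (c\<^sup>2) (\<kappa>\<^sup>2) * \<epsilon> \<le> c\<^sup>2 * \<epsilon>" using \<epsilon> by (intro mult_right_mono) auto
        ultimately have "\<rho>\<^sub>S * \<sigma> * (min (c\<^sup>2) (\<kappa>\<^sup>2) * \<epsilon>) \<le> \<rho>\<^sub>S * \<sigma> * (vnorm p)\<^sup>2"
          using rs by (intro mult_left_mono) auto
        hence "\<rho>\<^sub>S * \<sigma> * min (c\<^sup>2) (\<kappa>\<^sup>2) * \<epsilon> \<le> \<rho>\<^sub>S * \<sigma> * (vnorm p)\<^sup>2" by (simp only: mult.assoc)
        thus ?thesis using conjunct2[OF A] by (meson order_trans)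
      next
        case False
        \<comment> \<open>\<open>c\<close> is chosen such that after so short a step the gradient is at most \<open>\<epsilon>\<close>\<close>
        hence ps: "vnorm p \<le> c * sqrt \<epsilon>" by simp
        have "x + \<alpha> \<cdot>\<^sub>v p = x + p" using A by simp
        hence "vnorm (g (x + \<alpha> \<cdot>\<^sub>v p)) \<le> vnorm (H x *\<^sub>v p + g x) + L\<^sub>H * (vnorm p)\<^sup>2"
          using gradient_after_unit_step[OF C2 pos(2) lip x sol(1)] by simp
        also have "\<dots> \<le> \<theta> * M / \<sigma> * (sqrt \<epsilon> * (c * sqrt \<epsilon>)) + (L\<^sub>H + 1) * (sqrt \<epsilon> * (c * sqrt \<epsilon>))"
        proof (rule add_mono)
          have "vnorm (H x *\<^sub>v p + g x) \<le> \<eta> * M * vnorm p / \<sigma>"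
            using sol(4) pos by (simp add: pos_le_divide_eq mult.commute)
          also have "\<dots> = \<theta> * M / \<sigma> * (sqrt \<epsilon> * vnorm p)" by (simp add: \<eta>_def)
          also have "\<dots> \<le> \<theta> * M / \<sigma> * (sqrt \<epsilon> * (c * sqrt \<epsilon>))"
            using ps pos M se by (intro mult_left_mono) auto
          finally show "vnorm (H x *\<^sub>v p + g x) \<le> \<theta> * M / \<sigma> * (sqrt \<epsilon> * (c * sqrt \<epsilon>))" .
          have "vnorm p \<le> sqrt \<epsilon>" using ps c se by (meson mult_left_le_one_le less_imp_le order_trans)
          hence "vnorm p * vnorm p \<le> sqrt \<epsilon> * (c * sqrt \<epsilon>)"
            using ps c se by (intro mult_mono) auto
          thus "L\<^sub>H * (vnorm p)\<^sup>2 \<le> (L\<^sub>H + 1) * (sqrt \<epsilon> * (c * sqrt \<epsilon>))"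
            unfolding power2_eq_square by (rule mult_mono[rotated]) (use pos in auto)
        qed
        also have "\<dots> = (c * D) * (sqrt \<epsilon> * sqrt \<epsilon>)" by (simp only: D_def algebra_simps)
        also have "\<dots> = (c * D) * \<epsilon>" using \<epsilon> by simp
        also have "\<dots> \<le> 1 * \<epsilon>" using cD1 \<epsilon> by (intro mult_right_mono) auto
        finally show ?thesis by simp
      qed
    next
      assume A: "\<rho>\<^sub>S * \<sigma> * \<kappa>\<^sup>2 \<le> f x - f (x + \<alpha> \<cdot>\<^sub>v p)"
      have "min (c\<^sup>2) (\<kappa>\<^sup>2) * \<epsilon> \<le> \<kappa>\<^sup>2 * 1" using \<epsilon> by (intro mult_mono) auto
      hence "\<rho>\<^sub>S * \<sigma> * (min (c\<^sup>2) (\<kappa>\<^sup>2) * \<epsilon>) \<le> \<rho>\<^sub>S * \<sigma> * \<kappa>\<^sup>2" using rs by (intro mult_left_mono) auto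
      hence "\<rho>\<^sub>S * \<sigma> * min (c\<^sup>2) (\<kappa>\<^sup>2) * \<epsilon> \<le> \<rho>\<^sub>S * \<sigma> * \<kappa>\<^sup>2" by (simp only: mult.assoc)
      thus ?thesis using A by (meson order_trans)
    qed
    thus thesis using that[OF sol(1) ret[unfolded \<eta>_def] \<alpha>(1)] count by blast
  qed
qed

text \<open>A charging argument: a step costs at most \<open>A\<close> times its decrease of \<open>f\<close>, except for a last step, which
  costs at most \<open>B\<close>. It also yields termination: the cost grows by at least \<open>1\<close> in each step, while
  the charged part never exceeds \<open>A\<close> times the total decrease, so the difference serves as an
  induction measure.\<close>

lemma amortized_count:
  fixes reach :: "'a \<Rightarrow> nat \<Rightarrow> bool" and f :: "'a \<Rightarrow> real"
  assumes step: "\<And>x n. reach x n \<Longrightarrow> \<not> goal x \<Longrightarrow>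
      \<exists>y t. reach y (n + 1 + t) \<and> (goal y \<and> real (1 + t) \<le> B \<or> real (1 + t) \<le> A * (f x - f y))"
    and start: "reach x\<^sub>0 0" and A: "0 \<le> A" and B: "0 \<le> B" and low: "\<And>x n. reach x n \<Longrightarrow> m \<le> f x"
  obtains x n where "reach x n" "goal x" "real n \<le> A * (f x\<^sub>0 - m) + B"
proof -
  have "\<exists>y n. reach y n \<and> goal y \<and> real n \<le> A * (f x\<^sub>0 - m) + B"
    if "reach x n" "real n \<le> A * (f x\<^sub>0 - f x)" "A * (f x\<^sub>0 - m) - real n \<le> real k" for k x n
    using that
  proof (induction k arbitrary: x n)
    case (0 x n)
    have mono: "A * (f x\<^sub>0 - f y) \<le> A * (f x\<^sub>0 - m)" if "reach y n'" for y n'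
      using low[OF that] A by (intro mult_left_mono) auto
    show ?case
    proof (cases "goal x")
      case True
      thus ?thesis using 0 mono[OF 0(1)] B by (intro exI[of _ x] exI[of _ n]) auto
    next
      case False
      then obtain y t where y: "reach y (n + 1 + t)"
        "goal y \<and> real (1 + t) \<le> B \<or> real (1 + t) \<le> A * (f x - f y)" using step[OF 0(1)] by blast
      have "real (n + 1 + t) \<le> A * (f x\<^sub>0 - f y)" if "real (1 + t) \<le> A * (f x - f y)"
        using that 0(2) by (simp add: algebra_simps)
      hence "\<not> real (1 + t) \<le> A * (f x - f y)" using mono[OF y(1)] 0(3) by auto
      hence "goal y" "real (1 + t) \<le> B" using y(2) by auto
      thus ?thesis using y(1) 0(2) mono[OF 0(1)] by (intro exI[of _ y] exI[of _ "n + 1 + t"]) auto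
    qed
  next
    case (Suc k x n)
    have mono: "A * (f x\<^sub>0 - f x) \<le> A * (f x\<^sub>0 - m)"
      using low[OF Suc.prems(1)] A by (intro mult_left_mono) auto
    show ?case
    proof (cases "goal x")
      case True
      thus ?thesis using Suc.prems mono B by (intro exI[of _ x] exI[of _ n]) auto
    next
      case False
      then obtain y t where y: "reach y (n + 1 + t)"
        "goal y \<and> real (1 + t) \<le> B \<or> real (1 + t) \<le> A * (f x - f y)" using step[OF Suc.prems(1)] by blast
      show ?thesis
      proof (cases "real (1 + t) \<le> A * (f x - f y)")
        case True
        hence "real (n + 1 + t) \<le> A * (f x\<^sub>0 - f y)"
          using Suc.prems(2) by (simp add: algebra_simps)
        thus ?thesis using Suc.prems(3) by (intro Suc.IH[OF y(1)]) auto
      next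
        case False
        hence "goal y" "real (1 + t) \<le> B" using y(2) by auto
        thus ?thesis using y(1) Suc.prems(2) mono by (intro exI[of _ y] exI[of _ "n + 1 + t"]) auto
      qed
    qed
  qed
  from this[OF start, of "nat \<lceil>A * (f x\<^sub>0 - m)\<rceil>"] show thesis using that
    by (auto simp: of_nat_ceiling)
qed

theorem theorem4:
  fixes L\<^sub>g L\<^sub>H \<sigma> \<omega> \<mu> \<theta> \<rho>\<^sub>S \<rho>\<^sub>N \<Delta> :: real
  assumes "0 \<le> L\<^sub>g" and "0 \<le> L\<^sub>H" and "0 < \<sigma>" and "0 < \<omega>" and "0 < \<mu>" and "0 < \<theta>"
    and "0 < \<rho>\<^sub>S" and "\<rho>\<^sub>S < 1/2" and "0 < \<rho>\<^sub>N" and "\<rho>\<^sub>N < 1"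
  shows "\<exists>C :: real. \<forall>(d :: nat) (f :: real vec \<Rightarrow> real) (g :: real vec \<Rightarrow> real vec)
           (H :: real vec \<Rightarrow> real mat) (x\<^sub>0 :: real vec) (\<epsilon>\<^sub>g :: real) (\<nu> :: real).
     twice_continuously_differentiable d f g H \<and>
     x\<^sub>0 \<in> carrier_vec d \<and>
     (\<exists>z\<in>carrier_vec d. (\<forall>y\<in>carrier_vec d. f z \<le> f y) \<and> f x\<^sub>0 - f z \<le> \<Delta>) \<and>
     0 < \<epsilon>\<^sub>g \<and> \<epsilon>\<^sub>g \<le> 1 \<and>
     relevant_hessian_bounded d g H L\<^sub>g \<and>
     lipschitz_hessian d H L\<^sub>H \<and>
     krylov_regularity_I d g H \<sigma> \<and>
     krylov_regularity_II f g H \<theta> \<rho>\<^sub>S \<rho>\<^sub>N \<epsilon>\<^sub>g x\<^sub>0 \<omega> \<and>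
     L\<^sub>g\<^sup>2 / (L\<^sub>g\<^sup>2 + \<theta>\<^sup>2 * \<epsilon>\<^sub>g) \<le> \<nu> \<and> \<nu> \<le> 1 \<and>
     spectral_assumption d g H \<mu> \<nu> \<longrightarrow>
     (\<exists>x n. newton_mr f g H \<theta> \<rho>\<^sub>S \<rho>\<^sub>N \<epsilon>\<^sub>g x\<^sub>0 x n \<and> vnorm (g x) \<le> \<epsilon>\<^sub>g \<and>
        real (n + 1) \<le> C * \<epsilon>\<^sub>g powr (- 3 / 2))"
proof -
  define M where "M = L\<^sub>g + \<sigma> + 1"
  define \<delta> where "\<delta> = 1 / sqrt (1 - \<sigma>\<^sup>2 / M\<^sup>2) - 1"
  define c where "c = min 1 (1 / (\<theta> * M / \<sigma> + (L\<^sub>H + 1)))"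
  define \<kappa> where "\<kappa> = (1 - 2 * \<rho>\<^sub>S) * \<sigma> / (L\<^sub>H + 1)"
  define K\<^sub>N where "K\<^sub>N = 2 + 1 / (\<delta> * \<omega>)"
  define K\<^sub>S where "K\<^sub>S = 3 + sqrt (M\<^sup>2 + \<theta>\<^sup>2) / (\<delta> * \<theta>)"
  define c\<^sub>N where "c\<^sub>N = \<rho>\<^sub>N * sqrt ((1 - \<rho>\<^sub>N) / (L\<^sub>H + 1)) * (\<omega> * sqrt \<omega>)"
  define c\<^sub>S where "c\<^sub>S = \<rho>\<^sub>S * \<sigma> * min (c\<^sup>2) (\<kappa>\<^sup>2)"
  have M: "M > 0" "\<sigma> < M" using assms by (auto simp: M_def)
  have "\<sigma>\<^sup>2 < M\<^sup>2" using M assms by (intro power_strict_mono) auto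
  hence "0 < 1 - \<sigma>\<^sup>2 / M\<^sup>2" "1 - \<sigma>\<^sup>2 / M\<^sup>2 < 1" using M assms by auto
  hence \<delta>: "\<delta> > 0" by (simp add: \<delta>_def)
  have KN: "K\<^sub>N > 0" using \<delta> assms by (simp add: K\<^sub>N_def add_pos_pos)
  have KS: "K\<^sub>S > 0" using \<delta> assms by (simp add: K\<^sub>S_def add_pos_nonneg)
  have cN: "c\<^sub>N > 0" using assms by (simp add: c\<^sub>N_def)
  have "\<theta> * M / \<sigma> > 0" using assms M by simp
  hence "c > 0" using assms by (simp add: c_def)
  moreover have "\<kappa> > 0" using assms by (simp add: \<kappa>_def)
  ultimately have cS: "c\<^sub>S > 0" using assms by (simp add: c\<^sub>S_def)
  define A where "A = max (K\<^sub>N / c\<^sub>N) (K\<^sub>S / c\<^sub>S)"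
  have A: "A > 0" using KN cN by (simp add: A_def less_max_iff_disj)
  show ?thesis
  proof (intro exI[of _ "A * \<Delta> + K\<^sub>S + 1"] allI impI, elim conjE)
    fix d :: nat and f :: "real vec \<Rightarrow> real" and g :: "real vec \<Rightarrow> real vec"
      and H :: "real vec \<Rightarrow> real mat" and x\<^sub>0 :: "real vec" and \<epsilon> \<nu> :: real
    assume C2: "twice_continuously_differentiable d f g H" and x0: "x\<^sub>0 \<in> carrier_vec d"
      and "\<exists>z\<in>carrier_vec d. (\<forall>y\<in>carrier_vec d. f z \<le> f y) \<and> f x\<^sub>0 - f z \<le> \<Delta>"
      and \<epsilon>: "0 < \<epsilon>" "\<epsilon> \<le> 1" and bd: "relevant_hessian_bounded d g H L\<^sub>g"
      and lip: "lipschitz_hessian d H L\<^sub>H" and regI: "krylov_regularity_I d g H \<sigma>"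
      and regII: "krylov_regularity_II f g H \<theta> \<rho>\<^sub>S \<rho>\<^sub>N \<epsilon> x\<^sub>0 \<omega>"
    then obtain z where z: "\<forall>y\<in>carrier_vec d. f z \<le> f y" "f x\<^sub>0 - f z \<le> \<Delta>" by blast
    \<comment> \<open>\<open>A * E\<close> evaluations are charged per unit of decrease\<close>
    define E where "E = 1 / (\<epsilon> * sqrt \<epsilon>)"
    have se: "0 < sqrt \<epsilon>" "sqrt \<epsilon> \<le> 1" using \<epsilon> by auto
    have E1: "E \<ge> 1" using se \<epsilon> by (simp add: E_def mult_le_one)
    have E: "E = \<epsilon> powr (- 3 / 2)"
    proof -
      have "\<epsilon> powr (3 / 2) = \<epsilon> powr (1 + 1 / 2)" by simp
      also have "\<dots> = \<epsilon> powr 1 * \<epsilon> powr (1 / 2)" by (rule powr_add)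
      also have "\<dots> = \<epsilon> * sqrt \<epsilon>" using \<epsilon> by (simp add: powr_half_sqrt)
      finally have "\<epsilon> powr (3 / 2) = \<epsilon> * sqrt \<epsilon>" .
      moreover have "\<epsilon> powr (- (3 / 2)) = inverse (\<epsilon> powr (3 / 2))" by (rule powr_minus)
      ultimately show ?thesis by (simp add: E_def inverse_eq_divide)
    qed
    have SE: "1 / sqrt \<epsilon> = \<epsilon> * E" using \<epsilon> by (simp add: E_def)
    let ?reach = "\<lambda>x n. x \<in> carrier_vec d \<and> newton_mr f g H \<theta> \<rho>\<^sub>S \<rho>\<^sub>N \<epsilon> x\<^sub>0 x n"
    have step: "\<exists>y t. ?reach y (n + 1 + t) \<and>
        (vnorm (g y) \<le> \<epsilon> \<and> real (1 + t) \<le> K\<^sub>S * E \<or> real (1 + t) \<le> (A * E) * (f x - f y))"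
      if r: "?reach x n" and ng: "\<not> vnorm (g x) \<le> \<epsilon>" for x n
    proof -
      have x: "x \<in> carrier_vec d" and gx: "vnorm (g x) > \<epsilon>" using r ng by auto
      have big: "\<forall>t p. minres_returns (H x) (g x) (\<theta> * sqrt \<epsilon>) t p NPC \<longrightarrow> vnorm p \<ge> \<omega> * vnorm (g x)"
        using regII r gx unfolding krylov_regularity_II_def by blast
      obtain t p flag \<alpha> where p: "p \<in> carrier_vec d"
        and ret: "minres_returns (H x) (g x) (\<theta> * sqrt \<epsilon>) t p flag"
        and ls: "line_search f g \<rho>\<^sub>S \<rho>\<^sub>N x p flag \<alpha>"
        and res: "real (1 + t) \<le> K\<^sub>N \<and> c\<^sub>N * (\<epsilon> * sqrt \<epsilon>) \<le> f x - f (x + \<alpha> \<cdot>\<^sub>v p) \<or>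
          real (1 + t) \<le> K\<^sub>S / sqrt \<epsilon> \<and>
           (vnorm (g (x + \<alpha> \<cdot>\<^sub>v p)) \<le> \<epsilon> \<or> c\<^sub>S * \<epsilon> \<le> f x - f (x + \<alpha> \<cdot>\<^sub>v p))"
        using newton_mr_step[OF assms(1-4,6-10) \<epsilon> C2 z(1) bd lip regI x gx big]
        unfolding M_def[symmetric] \<delta>_def[symmetric] c_def[symmetric] \<kappa>_def[symmetric]
          K\<^sub>N_def[symmetric] K\<^sub>S_def[symmetric] c\<^sub>N_def[symmetric] c\<^sub>S_def[symmetric] by metis
      define y where "y = x + \<alpha> \<cdot>\<^sub>v p"
      have y: "?reach y (n + 1 + t)"
        unfolding y_def using newton_mr.step[OF conjunct2[OF r] gx ret ls] x p by auto
      have KSE: "K\<^sub>S / sqrt \<epsilon> = K\<^sub>S * (\<epsilon> * E)" using SE by (simp add: divide_inverse)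
      have count: "real (1 + t) \<le> (A * E) * (f x - f y)"
        if K: "real (1 + t) \<le> K * (w * E)" "0 < c'" "K / c' \<le> A" "0 < w" "c' * w \<le> f x - f y" "0 < K"
        for K c' w
      proof -
        have "K * (w * E) = (K / c') * E * (c' * w)" using K by simp
        also have "\<dots> \<le> A * E * (f x - f y)" using K A E1 by (intro mult_mono) auto
        finally show ?thesis using K(1) by linarith
      qed
      have "vnorm (g y) \<le> \<epsilon> \<and> real (1 + t) \<le> K\<^sub>S * E \<or> real (1 + t) \<le> (A * E) * (f x - f y)"
        using res
      proof (elim disjE conjE)
        assume "real (1 + t) \<le> K\<^sub>N" "c\<^sub>N * (\<epsilon> * sqrt \<epsilon>) \<le> f x - f (x + \<alpha> \<cdot>\<^sub>v p)"
        moreover have "(\<epsilon> * sqrt \<epsilon>) * E = 1" using \<epsilon> by (simp add: E_def)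
        ultimately show ?thesis
          using count[of K\<^sub>N "\<epsilon> * sqrt \<epsilon>" c\<^sub>N] cN KN \<epsilon> by (simp add: A_def y_def)
      next
        assume "real (1 + t) \<le> K\<^sub>S / sqrt \<epsilon>" "vnorm (g (x + \<alpha> \<cdot>\<^sub>v p)) \<le> \<epsilon>"
        moreover have "K\<^sub>S * (\<epsilon> * E) \<le> K\<^sub>S * (1 * E)"
          using KS \<epsilon> E1 by (intro mult_left_mono mult_right_mono) auto
        ultimately show ?thesis unfolding KSE y_def by simp
      next
        assume "real (1 + t) \<le> K\<^sub>S / sqrt \<epsilon>" "c\<^sub>S * \<epsilon> \<le> f x - f (x + \<alpha> \<cdot>\<^sub>v p)"
        thus ?thesis using count[of K\<^sub>S \<epsilon> c\<^sub>S] cS KS \<epsilon> unfolding KSE by (simp add: A_def y_def)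
      qed
      thus ?thesis using y by blast
    qed
    have "\<exists>x n. ?reach x n \<and> vnorm (g x) \<le> \<epsilon> \<and> real n \<le> (A * E) * (f x\<^sub>0 - f z) + K\<^sub>S * E"
    proof (rule amortized_count[of ?reach "\<lambda>x. vnorm (g x) \<le> \<epsilon>" "K\<^sub>S * E" "A * E" f x\<^sub>0 "f z"])
      show "?reach x\<^sub>0 0" using x0 newton_mr.start by blast
      show "0 \<le> A * E" "0 \<le> K\<^sub>S * E" using A KS E1 by auto
    qed (use step z(1) in blast)+
    then obtain x n where xn: "?reach x n" "vnorm (g x) \<le> \<epsilon>"
      "real n \<le> (A * E) * (f x\<^sub>0 - f z) + K\<^sub>S * E" by blast
    have "(A * E) * (f x\<^sub>0 - f z) \<le> (A * E) * \<Delta>" using z(2) A E1 by (intro mult_left_mono) auto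
    hence "real (n + 1) \<le> (A * \<Delta> + K\<^sub>S + 1) * E" using xn(3) E1 by (simp add: algebra_simps)
    thus "\<exists>x n. newton_mr f g H \<theta> \<rho>\<^sub>S \<rho>\<^sub>N \<epsilon> x\<^sub>0 x n \<and> vnorm (g x) \<le> \<epsilon> \<and>
        real (n + 1) \<le> (A * \<Delta> + K\<^sub>S + 1) * \<epsilon> powr (- 3 / 2)"
      using xn unfolding E by blast
  qed
qed

end
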